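(* For each positive integer $n$ let $X_n$ be the random variable `size' on the set of $(2n+1,2n+3)$-core partitions with distinct parts, equipped with the uniform distribution. Then the scaled fifth moment of $X_n$ satisfies $$ \lim_{n\to\infty}\frac{\mathbb{E}\big[(X_n-\mathbb{E}[X_n])^5\big]}{\mathrm{Var}(X_n)^{5/2}}=\frac{3429664365055}{156594294624768}\,\sqrt{467}\,\sqrt{7680}. $$
   Context: A partition is a non-increasing finite sequence $\lambda=(\lambda_1,\dots,\lambda_k)$, $k\ge 0$, of positive integers (the empty partition is allowed); its size is $\lambda_1+\dots+\lambda_k$, and it has distinct parts if the $\lambda_i$ are pairwise distinct. The hook length of a cell $(i,j)$, $1\le j\le\lambda_i$, of its Ferrers (Young) diagram is $\lambda_i-i+\lambda'_j-j+1$, where $\lambda'$ is the conjugate partition. A partition is an $(s,t)$-core partition if none of its hook lengths equals $s$ and none equals $t$. For $s=2n+1$, $t=2n+3$ (relatively prime) the set of $(s,t)$-core partitions is finite. *)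

theory Defs
  imports "HOL-Probability.Probability"
begin

definition is_partition :: "nat list \<Rightarrow> bool" where
  "is_partition p \<longleftrightarrow> sorted_wrt (\<ge>) p \<and> (\<forall>k\<in>set p. 0 < k)"

text \<open>Rows, columns and parts are indexed from 1, so \<open>nth_part p i\<close> is only meaningful
  for \<open>1 \<le> i \<le> length p\<close>.\<close>

definition nth_part :: "nat list \<Rightarrow> nat \<Rightarrow> nat" where
  "nth_part p i = p ! (i - 1)"

definition cells :: "nat list \<Rightarrow> (nat \<times> nat) set" where
  "cells p = {(i, j). 1 \<le> i \<and> i \<le> length p \<and> 1 \<le> j \<and> j \<le> nth_part p i}"

definition conjugate_part :: "nat list \<Rightarrow> nat \<Rightarrow> nat" where
  "conjugate_part p j = card {i \<in> {1..length p}. j \<le> nth_part p i}"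

text \<open>The value is an integer because the intermediate difference \<open>nth_part p i - i\<close> may be negative.\<close>

definition hook_length :: "nat list \<Rightarrow> nat \<Rightarrow> nat \<Rightarrow> int" where
  "hook_length p i j =
     int (nth_part p i) - int i + int (conjugate_part p j) - int j + 1"

definition is_core :: "nat \<Rightarrow> nat \<Rightarrow> nat list \<Rightarrow> bool" where
  "is_core s t p \<longleftrightarrow> is_partition p \<and>
     (\<forall>(i, j)\<in>cells p. hook_length p i j \<noteq> int s \<and> hook_length p i j \<noteq> int t)"

definition distinct_cores :: "nat \<Rightarrow> nat list set" where
  "distinct_cores n = {p. is_core (2 * n + 1) (2 * n + 3) p \<and> distinct p}"

text \<open>\<open>pmf_of_set\<close> is the uniform distribution only on finite nonempty sets;
  \<open>distinct_cores n\<close> is finite because \<open>2 * n + 1\<close> and \<open>2 * n + 3\<close> are coprime,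
  and it contains the empty partition.\<close>

definition core_pmf :: "nat \<Rightarrow> nat list pmf" where
  "core_pmf n = pmf_of_set (distinct_cores n)"

definition partition_size :: "nat list \<Rightarrow> real" where
  "partition_size p = real (sum_list p)"

end

theory Submission
  imports Defs
begin

text \<open>A partition is determined by the set of its first-column hook lengths. For a
\<open>(2n+1, 2n+3)\<close>-core with distinct parts this is a finite set \<open>B\<close> of positive integers, closed
under subtracting \<open>s = 2n+1\<close> and \<open>s+2\<close>, without two consecutive elements. On the abacus with \<open>s\<close>
runners such a set is given by the heights \<open>h(1), \<dots>, h(2n)\<close> of its runners. Reading the runners
in the order \<open>0, 2, \<dots>, 2n, 1, 3, \<dots>, 2n-1\<close>, the height rises by at most 1 per step (by at most 2
across the turn from \<open>2n\<close> to \<open>1\<close>), and neighbouring runners are never both occupied. The size of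
the core is \<open>n C - A\<^sup>2/2\<close> up to an error \<open>O(n A)\<close>, where \<open>A\<close> and \<open>C\<close> are essentially the sums of the
heights and of their squares (\<open>core_size\<close>). Heights are typically of order \<open>n\<^bsup>1/2\<^esup>\<close>, so the main term
has order \<open>n\<^sup>3\<close> and the error only \<open>n\<^bsup>5/2\<^esup>\<close>. The scaled moments of the size are therefore governed
by the limits of \<open>E[A\<^sup>a C\<^sup>b] / n\<^bsup>3a/2+2b\<^esup>\<close>.

These limits come from the generating function of \<open>exp(\<alpha> A + \<beta> C)\<close> over all \<open>n\<close>. A word of heights
splits into blocks in which the heights are positive, and these are weighted Catalan objects; raising a block
of length \<open>m\<close> by one level turns \<open>(A, C)\<close> into \<open>(A + m, C + 2A + m)\<close>. Hence the series
obey three functional equations (\<open>Tf_eq\<close>, \<open>Jf_Tf\<close>, \<open>Gf_Jf\<close>): a quadratic one for single blocks, a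
linear one for blocks with a marked entry, which describe the heights around the turn, and a quotient
for the whole word. Coefficientwise in \<open>\<alpha>\<close> and \<open>\<beta>\<close> all series are Laurent
polynomials in \<open>u = (1 - 4x)\<^bsup>1/2\<^esup>\<close>. Giving \<open>u, \<alpha>, \<beta>\<close> the degrees 1, 3, 4, raising the level changes a
series only in degree at least one higher, so that the lowest-degree parts satisfy a Riccati equation
and two linear ones (\<open>Y_lead\<close>, \<open>J_lead\<close>, \<open>G_lead\<close>). They are solved recursively, and the lowest power of \<open>u\<close>
determines the growth of the coefficients in \<open>x\<close> (\<open>moment_asymp\<close>). The moments of the size of
order at most five involve the finitely many coefficients with \<open>a + 2b \<le> 10\<close>.\<close>

no_notation vec_nth (infixl "$" 90)
unbundle fps_syntax

section \<open>Generating functions of words\<close>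

text \<open>The letters of a word are the heights of the runners \<open>1, 2, \<dots>\<close>; \<open>p\<close> and \<open>q\<close> are the two letters
before the word. A letter is bounded by the one two places earlier, since the abacus order advances by two
runners per step.\<close>

primrec admissible :: "nat \<Rightarrow> nat \<Rightarrow> nat list \<Rightarrow> bool" where
  "admissible p q [] \<longleftrightarrow> True"
| "admissible p q (x # w) \<longleftrightarrow> (x = 0 \<or> q = 0 \<and> x \<le> p + 1) \<and> admissible q x w"

definition words :: "nat \<Rightarrow> nat \<Rightarrow> nat \<Rightarrow> nat list set" where
  "words p q L = {w. length w = L \<and> admissible p q w}"

lemma words_0 [simp]: "words p q 0 = {[]}"
  by (auto simp: words_def)

lemma words_Suc_pos: "0 < q \<Longrightarrow> words p q (Suc L) = (#) 0 ` words q 0 L"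
  by (auto simp: words_def length_Suc_conv image_iff)

lemma words_Suc_zero: "words p 0 (Suc L) = (\<Union>x\<in>{..p + 1}. (#) x ` words 0 x L)"
  by (auto simp: words_def length_Suc_conv)

lemma finite_words [simp]: "finite (words p q L)"
  by (induction L arbitrary: p q) (case_tac "q = 0"; simp add: words_Suc_pos words_Suc_zero)+

text \<open>The last letter is prescribed because the bound on the first letter of a closed word comes from its
last one.\<close>

definition wsum :: "(nat \<Rightarrow> 'r::comm_ring_1) \<Rightarrow> nat \<Rightarrow> nat \<Rightarrow> nat \<Rightarrow> nat \<Rightarrow> 'r" where
  "wsum om r p q L = (\<Sum>w\<in>words p q L. if last (q # w) = r then prod_list (map om w) else 0)"

lemma wsum_0: "wsum om r p q 0 = (if q = r then 1 else 0)"
  by (simp add: wsum_def)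

lemma wsum_Suc_pos:
  assumes "0 < q" "om 0 = 1"
  shows "wsum om r p q (Suc L) = wsum om r q 0 L"
  unfolding wsum_def words_Suc_pos [OF assms(1)]
  by (subst sum.reindex) (auto simp: assms intro!: sum.cong)

lemma wsum_Suc_zero:
  assumes "om 0 = 1"
  shows "wsum om r p 0 (Suc L) = wsum om r 0 0 L + (\<Sum>y=1..p+1. om y * wsum om r 0 y L)"
proof -
  have "wsum om r p 0 (Suc L) = (\<Sum>x\<le>p+1. \<Sum>w\<in>(#) x ` words 0 x L. if last (0 # w) = r then prod_list (map om w) else 0)"
    unfolding wsum_def words_Suc_zero by (subst sum.UNION_disjoint) auto
  also have "\<dots> = (\<Sum>x\<le>p+1. om x * wsum om r 0 x L)"
  proof (intro sum.cong refl)
    fix x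
    have "(\<Sum>w\<in>(#) x ` words 0 x L. if last (0 # w) = r then prod_list (map om w) else 0) =
        (\<Sum>w\<in>words 0 x L. if last (x # w) = r then om x * prod_list (map om w) else 0)"
      by (subst sum.reindex) (auto intro!: sum.cong)
    then show "(\<Sum>w\<in>(#) x ` words 0 x L. if last (0 # w) = r then prod_list (map om w) else 0) = om x * wsum om r 0 x L"
      by (simp add: wsum_def sum_distrib_left if_distrib cong: if_cong)
  qed
  also have "{..p+1} = insert 0 {1..p+1}" by auto
  finally show ?thesis by (simp add: assms)
qed

text \<open>Coefficient \<open>n\<close> is the total weight of the lists of \<open>n\<close> letters greater than \<open>k\<close> that start with
\<open>k + 1\<close> and rise by at most 1 per step: up to the weights, a Catalan number. The recursion cuts
such a list before its second letter \<open>k + 1\<close>.\<close>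

fun cc :: "(nat \<Rightarrow> 'r::comm_ring_1) \<Rightarrow> nat \<Rightarrow> nat \<Rightarrow> 'r" where
  "cc om k 0 = 1"
| "cc om k (Suc n) = om (Suc k) * (\<Sum>i\<le>n. cc om (Suc k) i * cc om k (n - i))"

definition Cf :: "(nat \<Rightarrow> 'r::comm_ring_1) \<Rightarrow> nat \<Rightarrow> 'r fps" where
  "Cf om k = Abs_fps (cc om k)"

lemma Cf_eq: "Cf om k = 1 + fps_X * fps_const (om (Suc k)) * Cf om (Suc k) * Cf om k"
proof (rule fps_ext)
  fix n
  show "Cf om k $ n = (1 + fps_X * fps_const (om (Suc k)) * Cf om (Suc k) * Cf om k) $ n"
    by (cases n) (simp_all only: mult.assoc, simp_all add: Cf_def fps_mult_nth [of "Abs_fps _"] atLeast0AtMost)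
qed

text \<open>The product \<open>Cf om k * Jf om k\<close> enumerates the same lists with one marked letter that exceeds its
predecessor by exactly 1 (for the first letter, the level \<open>k\<close>), the power of the variable not counting the mark. In a closed word the mark is a virtual letter,
one more than the last letter, inserted at the turn of the abacus order: it splits the rise by
at most 2 there into a rise by exactly 1 and a rise by at most 1.\<close>

fun jj :: "(nat \<Rightarrow> 'r::comm_ring_1) \<Rightarrow> nat \<Rightarrow> nat \<Rightarrow> 'r" where
  "jj om k 0 = om (Suc k)"
| "jj om k (Suc n) = om (Suc k) * (cc om (Suc k) (Suc n)
     + (\<Sum>i\<le>n. (Cf om (Suc k) * Cf om k) $ i * jj om (Suc k) (n - i)))"

definition Jf :: "(nat \<Rightarrow> 'r::comm_ring_1) \<Rightarrow> nat \<Rightarrow> 'r fps" where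
  "Jf om k = Abs_fps (jj om k)"

lemma Jf_eq: "Jf om k = fps_const (om (Suc k)) * (Cf om (Suc k) + fps_X * (Cf om (Suc k) * Cf om k * Jf om (Suc k)))"
proof (rule fps_ext)
  fix n
  show "Jf om k $ n = (fps_const (om (Suc k)) * (Cf om (Suc k) + fps_X * (Cf om (Suc k) * Cf om k * Jf om (Suc k)))) $ n"
    by (cases n) (simp_all add: Jf_def fps_mult_nth [of "_ * _" "Abs_fps _"] atLeast0AtMost, simp_all add: Cf_def)
qed

text \<open>Enumerating runs by their first letter leads to linear systems of this shape; a coefficient of a solution
depends only on lower coefficients.\<close>

lemma system_unique:
  fixes F F' :: "nat \<Rightarrow> 'r::comm_ring_1 fps"
  assumes "\<And>v. F v = C v + fps_X * (\<Sum>y=1..v+1. fps_const (om y) * F y)"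
    and "\<And>v. F' v = C v + fps_X * (\<Sum>y=1..v+1. fps_const (om y) * F' y)"
  shows "F v = F' v"
proof -
  have "F v $ n = F' v $ n" for v n
  proof (induction n arbitrary: v)
    case 0
    then show ?case by (subst assms(1), subst assms(2)) simp
  next
    case (Suc n)
    then show ?case by (subst assms(1), subst assms(2)) (simp add: fps_sum_nth)
  qed
  then show ?thesis by (simp add: fps_eq_iff)
qed

text \<open>Letters rise by at most 1, so the first coefficients see only boundary terms near the starting level.
This replaces infinite sums over the last letter by finite ones.\<close>

lemma system_trunc:
  fixes F F' :: "nat \<Rightarrow> 'r::comm_ring_1 fps"
  assumes "\<And>v. F v = C v + fps_X * (\<Sum>y=1..v+1. fps_const (om y) * F y)"
    and "\<And>v. F' v = C' v + fps_X * (\<Sum>y=1..v+1. fps_const (om y) * F' y)"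
    and "\<And>v. v \<le> N \<Longrightarrow> C v = C' v"
    and "v + n \<le> N"
  shows "F v $ n = F' v $ n"
  using assms(4)
proof (induction n arbitrary: v)
  case 0
  then show ?case by (subst assms(1), subst assms(2)) (simp add: assms(3))
next
  case (Suc n)
  then have "(\<Sum>y=1..v+1. fps_const (om y) * F y) $ n = (\<Sum>y=1..v+1. fps_const (om y) * F' y) $ n"
    unfolding fps_sum_nth by (intro sum.cong) auto
  then show ?case using Suc.prems by (subst assms(1), subst assms(2)) (simp add: assms(3))
qed

text \<open>A run whose first letter is at most \<open>v + 1\<close> passes through the levels \<open>v, \<dots>, 0\<close> in turn; each contributes a factor,
possibly the trivial one of an empty list.\<close>

definition Df :: "(nat \<Rightarrow> 'r::comm_ring_1) \<Rightarrow> nat \<Rightarrow> 'r fps" where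
  "Df om v = (\<Prod>k\<le>v. Cf om k)"

lemma Df_rec: "Df om (Suc v) = Df om v + fps_X * fps_const (om (v + 2)) * Df om (v + 2)"
proof -
  have "Df om (Suc v) = Df om v * (1 + fps_X * fps_const (om (v + 2)) * Cf om (v + 2) * Cf om (Suc v))"
    using Cf_eq [of om "Suc v"] by (simp add: Df_def)
  also have "\<dots> = Df om v + fps_X * fps_const (om (v + 2)) * (Df om v * Cf om (Suc v) * Cf om (v + 2))"
    by (simp only: ring_distribs mult_ac mult_1_right mult_1_left)
  finally show ?thesis by (simp add: Df_def)
qed

lemma Df_0: "Df om 0 = 1 + fps_X * fps_const (om 1) * Df om 1"
  using Cf_eq [of om 0] by (simp add: Df_def mult_ac)

lemma Df_eq: "Df om v = 1 + fps_X * (\<Sum>y=1..v+1. fps_const (om y) * Df om y)"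
proof (induction v)
  case 0
  then show ?case using Df_0 [of om] by (simp add: mult.assoc)
next
  case (Suc v)
  have "Df om (Suc v) = 1 + fps_X * (\<Sum>y=1..v+1. fps_const (om y) * Df om y) + fps_X * fps_const (om (v + 2)) * Df om (v + 2)"
    by (subst Df_rec, subst Suc) simp
  then show ?case by (simp add: algebra_simps)
qed

lemma system_const:
  assumes "\<And>v. F v = C + fps_X * (\<Sum>y=1..v+1. fps_const (om y) * F y)"
  shows "F v = C * Df om v"
proof (rule system_unique [where C = "\<lambda>_. C", OF assms])
  show "C * Df om v = C + fps_X * (\<Sum>y=1..v+1. fps_const (om y) * (C * Df om y))" for v
    by (subst Df_eq) (simp add: algebra_simps sum_distrib_left)
qed

lemma marked_step:
  fixes x w c c' :: "'a::comm_ring_1"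
  assumes "c = 1 + x * w * c' * c" "J = w * (c' + x * (c' * c * J'))"
  shows "x * (w * (d * c * c' * (J' + R))) = d * (J - w * c') + d * (c - 1) * R"
proof -
  have "x * w * c' * c = c - 1" using assms(1) by (metis add_diff_cancel_left')
  moreover have "x * w * c' * c * J' = J - w * c'" using assms(2) by (simp add: algebra_simps)
  moreover have "x * (w * (d * c * c' * (J' + R))) = d * (x * w * c' * c * J') + d * (x * w * c' * c) * R"
    by (simp add: algebra_simps)
  ultimately show ?thesis by simp
qed

text \<open>Runs from level \<open>v\<close> with a marked rise by exactly 1. The mark lies in the part of the run
at some level \<open>k \<le> v\<close>; for \<open>k < v\<close> the case of the very first letter of that part is subtracted, as this
letter follows a descent and is not a rise.\<close>

definition Mf :: "(nat \<Rightarrow> 'r::comm_ring_1) \<Rightarrow> nat \<Rightarrow> 'r fps" where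
  "Mf om v = Df om v * (Jf om v + (\<Sum>k<v. Jf om k - fps_const (om (Suc k)) * Cf om (Suc k)))"

lemma Mf_eq: "Mf om v = fps_const (om (v + 1)) * Df om (v + 1) + fps_X * (\<Sum>y=1..v+1. fps_const (om y) * Mf om y)"
proof (induction v)
  case 0
  let ?w = "fps_const (om (Suc 0))" and ?c0 = "Cf om 0" and ?c1 = "Cf om (Suc 0)"
    and ?J0 = "Jf om 0" and ?J1 = "Jf om (Suc 0)"
  note c = Cf_eq [of om 0] and J = Jf_eq [of om 0]
  have "Mf om 0 = ?c0 * ?J0" by (simp add: Mf_def Df_def)
  moreover have "Mf om (Suc 0) = ?c0 * ?c1 * (?J1 + (?J0 - ?w * ?c1))" by (simp add: Mf_def Df_def algebra_simps)
  moreover have "?c0 * ?J0 = ?w * (?c0 * ?c1) + fps_X * (?w * (?c0 * ?c1 * (?J1 + (?J0 - ?w * ?c1))))"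
    using marked_step [OF c J, of 1 "?J0 - ?w * ?c1"] unfolding mult_1_left
    by (simp only:) (simp add: algebra_simps)
  ultimately show ?case by (simp add: Df_def)
next
  case (Suc v)
  define S where "S = (\<Sum>k<v. Jf om k - fps_const (om (Suc k)) * Cf om (Suc k))"
  define d where "d = Df om v"
  let ?w = "fps_const (om (Suc (Suc v)))" and ?w1 = "fps_const (om (Suc v))"
  let ?c1 = "Cf om (Suc v)" and ?c2 = "Cf om (Suc (Suc v))"
  let ?J = "Jf om v" and ?J1 = "Jf om (Suc v)" and ?J2 = "Jf om (Suc (Suc v))"
  note c = Cf_eq [of om "Suc v"] and J = Jf_eq [of om "Suc v"]
  have D1: "Df om (Suc v) = d * ?c1" and D2: "Df om (Suc (Suc v)) = d * ?c1 * ?c2"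
    by (simp_all add: Df_def d_def mult_ac)
  have M: "Mf om v = d * (?J + S)" by (simp add: Mf_def d_def S_def)
  have M1: "Mf om (Suc v) = d * ?c1 * (?J1 + (S + (?J - ?w1 * ?c1)))"
    by (simp add: Mf_def D1 S_def)
  have M2: "Mf om (Suc (Suc v)) = d * ?c1 * ?c2 * (?J2 + (S + (?J - ?w1 * ?c1) + (?J1 - ?w * ?c2)))"
    by (simp add: Mf_def D2 S_def)
  have "Mf om (Suc v) = Mf om v - ?w1 * Df om (Suc v) + ?w * Df om (Suc (Suc v)) + fps_X * (?w * Mf om (Suc (Suc v)))"
    unfolding M M1 M2 D1 D2 marked_step [OF c J, of d "S + (?J - ?w1 * ?c1) + (?J1 - ?w * ?c2)"]
    by (simp add: algebra_simps)
  moreover define T where "T = (\<Sum>y=1..v+1. fps_const (om y) * Mf om y)"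
  have "Mf om v - ?w1 * Df om (Suc v) = fps_X * T"
    unfolding T_def by (subst Suc.IH) simp
  ultimately have fin: "Mf om (Suc v) = fps_X * T + ?w * Df om (Suc (Suc v)) + fps_X * (?w * Mf om (Suc (Suc v)))"
    by metis
  have sum: "(\<Sum>y=1..Suc v+1. fps_const (om y) * Mf om y) = T + ?w * Mf om (Suc (Suc v))"
    by (simp add: T_def)
  show ?case
    unfolding sum fin by (simp add: algebra_simps)
qed

text \<open>Words of even and of odd length are kept apart: an occupied runner and the empty one after it
use two places, a single empty runner uses one, and only words of even length \<open>2 * n\<close> matter in the end.\<close>

definition Pf :: "(nat \<Rightarrow> 'r::comm_ring_1) \<Rightarrow> nat \<Rightarrow> nat \<Rightarrow> 'r fps" where
  "Pf om r v = Abs_fps (\<lambda>n. wsum om r v 0 (2 * n))"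

definition Qf :: "(nat \<Rightarrow> 'r::comm_ring_1) \<Rightarrow> nat \<Rightarrow> nat \<Rightarrow> 'r fps" where
  "Qf om r v = Abs_fps (\<lambda>n. wsum om r v 0 (2 * n + 1))"

lemma Pf_eq:
  assumes "om 0 = 1"
  shows "Pf om r v = (if r = 0 then 1 else 0) + fps_X * Qf om r 0
     + fps_X * (\<Sum>y=1..v+1. fps_const (om y) * Pf om r y)"
proof (rule fps_ext)
  fix n
  show "Pf om r v $ n = ((if r = 0 then 1 else 0) + fps_X * Qf om r 0
     + fps_X * (\<Sum>y=1..v+1. fps_const (om y) * Pf om r y)) $ n"
  proof (cases n)
    case 0
    then show ?thesis by (simp add: Pf_def wsum_0)
  next
    case (Suc m)
    have "wsum om r v 0 (2 * n) = wsum om r v 0 (Suc (Suc (2 * m)))" by (simp add: Suc)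
    also have "\<dots> = wsum om r 0 0 (Suc (2 * m)) + (\<Sum>y=1..v+1. om y * wsum om r 0 y (Suc (2 * m)))"
      by (rule wsum_Suc_zero [where L = "Suc (2 * m)" and om = om, OF assms])
    also have "(\<Sum>y=1..v+1. om y * wsum om r 0 y (Suc (2 * m))) = (\<Sum>y=1..v+1. om y * wsum om r y 0 (2 * m))"
      by (intro sum.cong refl) (simp add: wsum_Suc_pos assms)
    finally show ?thesis by (simp add: Suc Pf_def Qf_def fps_sum_nth)
  qed
qed

lemma Qf_eq:
  assumes "om 0 = 1"
  shows "Qf om r v = Pf om r 0 + fps_const (if 1 \<le> r \<and> r \<le> v + 1 then om r else 0)
     + fps_X * (\<Sum>y=1..v+1. fps_const (om y) * Qf om r y)"
proof (rule fps_ext)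
  fix n
  show "Qf om r v $ n = (Pf om r 0 + fps_const (if 1 \<le> r \<and> r \<le> v + 1 then om r else 0)
     + fps_X * (\<Sum>y=1..v+1. fps_const (om y) * Qf om r y)) $ n"
  proof (cases n)
    case 0
    have "wsum om r v 0 (Suc 0) = wsum om r 0 0 0 + (\<Sum>y=1..v+1. om y * wsum om r 0 y 0)"
      by (rule wsum_Suc_zero, rule assms)
    also have "(\<Sum>y=1..v+1. om y * wsum om r 0 y 0) = (\<Sum>y\<in>{1..v+1}. if y = r then om y else 0)"
      by (intro sum.cong refl) (simp add: wsum_0)
    also have "\<dots> = (if 1 \<le> r \<and> r \<le> v + 1 then om r else 0)"
      by (subst sum.delta) auto
    finally show ?thesis using 0 by (simp add: Pf_def Qf_def)
  next
    case (Suc m)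
    have "wsum om r v 0 (Suc (2 * n)) = wsum om r 0 0 (2 * n) + (\<Sum>y=1..v+1. om y * wsum om r 0 y (2 * n))"
      by (rule wsum_Suc_zero, rule assms)
    also have "(\<Sum>y=1..v+1. om y * wsum om r 0 y (2 * n)) = (\<Sum>y=1..v+1. om y * Qf om r y $ m)"
    proof (intro sum.cong refl)
      fix y assume "y \<in> {1..v+1}"
      then have "wsum om r 0 y (Suc (Suc (2 * m))) = wsum om r y 0 (Suc (2 * m))"
        by (intro wsum_Suc_pos assms) simp
      then show "om y * wsum om r 0 y (2 * n) = om y * Qf om r y $ m"
        by (simp add: Suc Qf_def)
    qed
    finally have "Qf om r v $ n = Pf om r 0 $ n + (\<Sum>y=1..v+1. om y * Qf om r y $ m)"
      by (simp only: Qf_def Pf_def fps_nth_Abs_fps Suc_eq_plus1)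
    moreover have "(fps_X * (\<Sum>y=1..v+1. fps_const (om y) * Qf om r y)) $ n = (\<Sum>y=1..v+1. om y * Qf om r y $ m)"
      by (simp only: Suc fps_X_mult_nth fps_sum_nth fps_mult_left_const_nth) simp
    ultimately show ?thesis by (simp add: Suc)
  qed
qed

text \<open>Runs without single empty runners, from level \<open>v\<close> to last letter \<open>r\<close>.\<close>

fun ss :: "(nat \<Rightarrow> 'r::comm_ring_1) \<Rightarrow> nat \<Rightarrow> nat \<Rightarrow> nat \<Rightarrow> 'r" where
  "ss om r v 0 = (if 1 \<le> r \<and> r \<le> v + 1 then om r else 0)"
| "ss om r v (Suc n) = (\<Sum>y=1..v+1. om y * ss om r y n)"

definition Sf :: "(nat \<Rightarrow> 'r::comm_ring_1) \<Rightarrow> nat \<Rightarrow> nat \<Rightarrow> 'r fps" where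
  "Sf om r v = Abs_fps (ss om r v)"

lemma Sf_eq: "Sf om r v = fps_const (if 1 \<le> r \<and> r \<le> v + 1 then om r else 0)
     + fps_X * (\<Sum>y=1..v+1. fps_const (om y) * Sf om r y)"
proof (rule fps_ext)
  fix n
  show "Sf om r v $ n = (fps_const (if 1 \<le> r \<and> r \<le> v + 1 then om r else 0)
     + fps_X * (\<Sum>y=1..v+1. fps_const (om y) * Sf om r y)) $ n"
    by (cases n) (simp_all add: Sf_def fps_sum_nth)
qed

lemma renewal:
  fixes a :: "'a::comm_ring_1"
  assumes "a = e + x * (a * c * c + s)"
  shows "a * (1 - x * c\<^sup>2) = e + x * s"
proof -
  have "a * (1 - x * c\<^sup>2) = a - x * (a * c * c)" by (simp add: power2_eq_square algebra_simps)
  also have "\<dots> = e + x * (a * c * c + s) - x * (a * c * c)" unfolding assms [symmetric] ..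
  also have "\<dots> = e + x * s" by (simp add: algebra_simps)
  finally show ?thesis .
qed

text \<open>The first and the last run of a word are counted by \<open>Df\<close> and \<open>Sf\<close>; in between there is an even number of
unmarked runs from level 0, whence the geometric series in \<open>x c\<^sup>2\<close>.\<close>

lemma Pf_solve:
  assumes "om 0 = 1"
  shows "Pf om r v * (1 - fps_X * (Cf om 0)\<^sup>2) = ((if r = 0 then 1 else 0) + fps_X * Sf om r 0) * Df om v"
proof -
  define e :: "'a fps" where "e = (if r = 0 then 1 else 0)"
  let ?c = "Cf om 0"
  have P: "Pf om r v = (e + fps_X * Qf om r 0) * Df om v" for v
    unfolding e_def by (rule system_const [where F = "Pf om r" and om = om], rule Pf_eq, rule assms)
  have "Qf om r v - Sf om r v = Pf om r 0 * Df om v" for v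
  proof (rule system_const [where F = "\<lambda>v. Qf om r v - Sf om r v" and om = om])
    fix v
    show "Qf om r v - Sf om r v = Pf om r 0 + fps_X * (\<Sum>y=1..v+1. fps_const (om y) * (Qf om r y - Sf om r y))"
      unfolding right_diff_distrib sum_subtractf
      by (subst Qf_eq, rule assms, subst Sf_eq) simp
  qed
  from this [of 0] have Q: "Qf om r 0 = Pf om r 0 * ?c + Sf om r 0" by (simp add: Df_def diff_eq_eq)
  define A where "A = e + fps_X * Qf om r 0"
  have P0: "Pf om r 0 = A * ?c" unfolding A_def P [of 0] by (simp add: Df_def)
  have AQ: "Qf om r 0 = A * ?c * ?c + Sf om r 0"
    using Q unfolding P0 .
  have "A = e + fps_X * (A * ?c * ?c + Sf om r 0)"
    unfolding AQ [symmetric] by (rule A_def)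
  then have "A * (1 - fps_X * ?c\<^sup>2) = e + fps_X * Sf om r 0"
    by (rule renewal)
  then have "A * (1 - fps_X * ?c\<^sup>2) * Df om v = (e + fps_X * Sf om r 0) * Df om v" by simp
  then show ?thesis unfolding P A_def [symmetric] e_def [symmetric] by (simp only: mult_ac)
qed

text \<open>Closed words, with the extra weight of the virtual letter \<open>Suc r\<close>. A last letter \<open>r > n\<close> is
impossible (\<open>Pf_eq_0\<close>).\<close>

definition Gf :: "(nat \<Rightarrow> 'r::comm_ring_1) \<Rightarrow> 'r fps" where
  "Gf om = Abs_fps (\<lambda>n. \<Sum>r\<le>n. om (Suc r) * wsum om r (Suc r) 0 (2 * n))"


lemma ss_eq_0: "v + 1 + n < r \<Longrightarrow> ss om r v n = 0"
proof (induction n arbitrary: v)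
  case (Suc n)
  have "om y * ss om r y n = 0" if "y \<in> {1..v + 1}" for y
    using Suc that by simp
  then show ?case unfolding ss.simps by (rule sum.neutral [rule_format])
qed simp

lemma Pf_eq_0:
  assumes "om 0 = 1" "m < r"
  shows "Pf om r v $ m = 0"
  using assms(2)
proof (induction m rule: less_induct)
  case (less m)
  define P where "P = Pf om r v"
  have "P * (1 - fps_X * (Cf om 0)\<^sup>2) = fps_X * (Sf om r 0 * Df om v)"
    using Pf_solve [of om r v, OF assms(1)] less.prems by (simp add: P_def mult.assoc)
  then have "P - fps_X * ((Cf om 0)\<^sup>2 * P) = fps_X * (Sf om r 0 * Df om v)"
    by (simp add: algebra_simps)
  then have "P $ m - (fps_X * ((Cf om 0)\<^sup>2 * P)) $ m = (fps_X * (Sf om r 0 * Df om v)) $ m"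
    by (metis fps_sub_nth)
  then have "Pf om r v $ m = (fps_X * (Sf om r 0 * Df om v)) $ m + (fps_X * ((Cf om 0)\<^sup>2 * Pf om r v)) $ m"
    unfolding P_def by (simp only: diff_eq_eq)
  also have "(fps_X * (Sf om r 0 * Df om v)) $ m = 0"
  proof (cases m)
    case (Suc k)
    have "(Sf om r 0 * Df om v) $ k = 0"
      unfolding fps_mult_nth using less.prems Suc
      by (intro sum.neutral) (simp add: Sf_def ss_eq_0)
    then show ?thesis using Suc by simp
  qed simp
  also have "(fps_X * ((Cf om 0)\<^sup>2 * Pf om r v)) $ m = 0"
  proof (cases m)
    case (Suc k)
    have "((Cf om 0)\<^sup>2 * Pf om r v) $ k = 0"
      unfolding fps_mult_nth using less Suc by (intro sum.neutral) simp
    then show ?thesis using Suc by simp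
  qed simp
  finally show ?case by simp
qed

text \<open>Moving the last run in front of the virtual letter and the first run behind it makes one marked
block out of the three.\<close>

lemma Gf_Mf:
  assumes "om 0 = 1"
  shows "Gf om * (1 - fps_X * (Cf om 0)\<^sup>2) = Mf om 0"
proof (rule fps_ext)
  fix N
  define psi where "psi r = fps_const (om (Suc r)) * Df om (Suc r)" for r
  define GN where "GN = (\<Sum>r\<le>N. fps_const (om (Suc r)) * Pf om r (Suc r))"
  define C where "C v = (if v \<le> N then psi v else 0)" for v
  define MN where "MN v = C v + fps_X * (\<Sum>r\<le>N. Sf om r v * psi r)" for v
  have G: "GN $ m = Gf om $ m" if "m \<le> N" for m
  proof -
    have "GN $ m = (\<Sum>r\<le>N. om (Suc r) * Pf om r (Suc r) $ m)"
      by (simp add: GN_def fps_sum_nth)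
    also have "\<dots> = (\<Sum>r\<le>m. om (Suc r) * Pf om r (Suc r) $ m)"
      using that Pf_eq_0 [of om m] assms by (intro sum.mono_neutral_right) auto
    finally show ?thesis by (simp add: Gf_def Pf_def)
  qed
  have "GN * (1 - fps_X * (Cf om 0)\<^sup>2) = (\<Sum>r\<le>N. fps_const (om (Suc r)) * (((if r = 0 then 1 else 0) + fps_X * Sf om r 0) * Df om (Suc r)))"
    unfolding GN_def sum_distrib_right mult.assoc by (simp only: Pf_solve assms)
  also have "\<dots> = (\<Sum>r\<le>N. (if r = 0 then psi r else 0) + fps_X * (Sf om r 0 * psi r))"
    by (intro sum.cong refl) (simp add: psi_def algebra_simps)
  also have "\<dots> = MN 0"
    by (simp add: sum.distrib MN_def C_def sum_distrib_left)
  finally have GM: "GN * (1 - fps_X * (Cf om 0)\<^sup>2) = MN 0" .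
  have MN: "MN v = C v + fps_X * (\<Sum>y=1..v+1. fps_const (om y) * MN y)" for v
  proof -
    have "(\<Sum>r\<le>N. Sf om r v * psi r) =
        (\<Sum>r\<le>N. fps_const (if 1 \<le> r \<and> r \<le> v + 1 then om r else 0) * psi r) +
        (\<Sum>r\<le>N. \<Sum>y=1..v+1. fps_X * (fps_const (om y) * (Sf om r y * psi r)))"
      unfolding sum.distrib [symmetric]
      by (intro sum.cong refl, subst Sf_eq) (simp only: ring_distribs sum_distrib_left sum_distrib_right mult.assoc)
    also have "(\<Sum>r\<le>N. \<Sum>y=1..v+1. fps_X * (fps_const (om y) * (Sf om r y * psi r))) =
        (\<Sum>y=1..v+1. fps_const (om y) * (fps_X * (\<Sum>r\<le>N. Sf om r y * psi r)))"
      unfolding sum_distrib_left by (subst sum.swap) (simp only: mult.left_commute)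
    also have "(\<Sum>r\<le>N. fps_const (if 1 \<le> r \<and> r \<le> v + 1 then om r else 0) * psi r) =
        (\<Sum>r\<in>{..N} \<inter> {1..v+1}. fps_const (om r) * psi r)"
      by (intro sum.mono_neutral_cong_right) auto
    also have "\<dots> = (\<Sum>y=1..v+1. fps_const (om y) * C y)"
      by (intro sum.mono_neutral_cong_left) (auto simp: C_def)
    finally have "(\<Sum>r\<le>N. Sf om r v * psi r) = (\<Sum>y=1..v+1. fps_const (om y) * MN y)"
      by (simp only: MN_def ring_distribs sum.distrib)
    then show ?thesis by (simp only: MN_def)
  qed
  have "(Gf om * (1 - fps_X * (Cf om 0)\<^sup>2)) $ N = (GN * (1 - fps_X * (Cf om 0)\<^sup>2)) $ N"
    unfolding fps_mult_nth using G by (intro sum.cong) auto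
  also have "\<dots> = MN 0 $ N" by (simp only: GM)
  also have "\<dots> = Mf om 0 $ N"
  proof (rule system_trunc)
    show "MN v = C v + fps_X * (\<Sum>y=1..v+1. fps_const (om y) * MN y)" for v by (rule MN)
    show "Mf om v = fps_const (om (v + 1)) * Df om (v + 1) + fps_X * (\<Sum>y=1..v+1. fps_const (om y) * Mf om y)" for v
      by (rule Mf_eq)
    show "v \<le> N \<Longrightarrow> C v = fps_const (om (v + 1)) * Df om (v + 1)" for v
      by (simp add: C_def psi_def)
  qed simp
  finally show "(Gf om * (1 - fps_X * (Cf om 0)\<^sup>2)) $ N = Mf om 0 $ N" .
qed

text \<open>At trivial weights this is \<open>(1 - u) / 2\<close>, a polynomial in \<open>u = (1 - 4x)\<^bsup>1/2\<^esup>\<close>, whereas \<open>Cf\<close> is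
\<open>2 / (1 + u)\<close>. The three equations below are free of such denominators.\<close>

definition Tf :: "(nat \<Rightarrow> 'r::comm_ring_1) \<Rightarrow> nat \<Rightarrow> 'r fps" where
  "Tf om k = fps_X * Cf om k"

lemma Cf_unit: "Cf om k * (1 - fps_const (om (Suc k)) * Tf om (Suc k)) = 1"
proof -
  have "Cf om k * (1 - fps_const (om (Suc k)) * Tf om (Suc k)) =
      Cf om k - fps_X * fps_const (om (Suc k)) * Cf om (Suc k) * Cf om k"
    unfolding Tf_def by (simp add: algebra_simps)
  also have "\<dots> = 1" by (metis Cf_eq add_diff_cancel_right')
  finally show ?thesis .
qed

lemma Tf_eq: "Tf om k = fps_X + fps_const (om (Suc k)) * Tf om (Suc k) * Tf om k"
proof -
  have "Tf om k = fps_X * (1 + fps_X * fps_const (om (Suc k)) * Cf om (Suc k) * Cf om k)"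
    unfolding Tf_def by (metis Cf_eq)
  also have "\<dots> = fps_X + fps_const (om (Suc k)) * (fps_X * Cf om (Suc k)) * (fps_X * Cf om k)"
    by (simp only: ring_distribs mult_ac mult_1_right mult_1_left)
  finally show ?thesis by (simp only: Tf_def)
qed

lemma Jf_Tf: "Jf om k = fps_const (om (Suc k)) + fps_const (om (k + 2)) * Tf om (k + 2) * Jf om k
    + fps_const (om (Suc k)) * Tf om k * Jf om (Suc k)"
proof -
  let ?w = "fps_const (om (Suc k))"
  define z where "z = 1 - fps_const (om (k + 2)) * Tf om (k + 2)"
  have c: "Cf om (Suc k) * z = 1" using Cf_unit [of om "Suc k"] by (simp add: z_def)
  have "Jf om k * z = ?w * (Cf om (Suc k) + fps_X * (Cf om (Suc k) * Cf om k * Jf om (Suc k))) * z"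
    by (metis Jf_eq)
  also have "\<dots> = ?w * (Cf om (Suc k) * z) * (1 + Tf om k * Jf om (Suc k))"
    by (simp add: Tf_def algebra_simps)
  finally have "Jf om k * z = ?w * (1 + Tf om k * Jf om (Suc k))" by (simp add: c)
  then show ?thesis by (simp add: z_def algebra_simps)
qed

lemma Gf_Jf:
  assumes "om 0 = 1"
  shows "(1 - fps_const (om 1) * Tf om 1 - Tf om 0) * Gf om = Jf om 0"
proof -
  define z where "z = 1 - fps_const (om 1) * Tf om 1"
  let ?c = "Cf om 0"
  have c: "?c * z = 1" using Cf_unit [of om 0] by (simp add: z_def)
  have "1 - fps_X * ?c\<^sup>2 = ?c * z - fps_X * ?c\<^sup>2" by (simp add: c)
  also have "\<dots> = ?c * (z - Tf om 0)"
    by (simp add: Tf_def power2_eq_square algebra_simps)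
  finally have e: "1 - fps_X * ?c\<^sup>2 = ?c * (z - Tf om 0)" .
  have "Gf om * (?c * (z - Tf om 0)) = ?c * Jf om 0"
    using Gf_Mf [of om, OF assms] unfolding e by (simp add: Mf_def Df_def)
  then have "z * (Gf om * (?c * (z - Tf om 0))) = z * (?c * Jf om 0)" by simp
  then have "(?c * z) * (Gf om * (z - Tf om 0)) = (?c * z) * Jf om 0" by (simp only: mult_ac)
  then have "(z - Tf om 0) * Gf om = Jf om 0" unfolding c by (simp add: mult.commute)
  then show ?thesis by (simp only: z_def)
qed

section \<open>Laurent polynomials in the square root of 1 - 4x\<close>

text \<open>The power \<open>u\<^sup>k\<close> of \<open>u = (1 - 4x)\<^bsup>1/2\<^esup>\<close>, for integers \<open>k\<close>.\<close>

definition upow :: "int \<Rightarrow> real fps" where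
  "upow k = Abs_fps (\<lambda>n. (of_int k / 2 gchoose n) * (-4) ^ n)"

lemma upow_add: "upow (k + l) = upow k * upow l"
proof (rule fps_ext)
  fix n
  have "upow (k + l) $ n = (fps_binomial (of_int k / 2) * fps_binomial (of_int l / 2)) $ n * (-4) ^ n"
    by (simp add: upow_def fps_binomial_add_mult [symmetric] add_divide_distrib)
  also have "\<dots> = (\<Sum>i=0..n. (of_int k / 2 gchoose i) * (of_int l / 2 gchoose (n - i)) * ((-4) ^ i * (-4) ^ (n - i)))"
    by (simp add: fps_mult_nth sum_distrib_right flip: power_add)
  also have "\<dots> = (upow k * upow l) $ n"
    by (simp add: fps_mult_nth upow_def mult_ac)
  finally show "upow (k + l) $ n = (upow k * upow l) $ n" .
qed

lemma upow_0 [simp]: "upow 0 = 1"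
  by (rule fps_ext) (simp add: upow_def gbinomial_0_left)

lemma upow_2: "upow 2 = 1 - 4 * fps_X"
proof (rule fps_ext)
  fix n
  have "(1 gchoose n :: real) = of_nat (1 choose n)"
    by (simp add: binomial_gbinomial)
  moreover have "n = 0 \<or> n = 1 \<or> 1 < n" by linarith
  ultimately show "upow 2 $ n = (1 - 4 * fps_X) $ n"
    by (auto simp: upow_def fps_numeral_fps_const binomial_eq_0)
qed

text \<open>The operator \<open>x d/dx + d\<close>. It multiplies a coefficient by the length of the underlying block, which differs from
the exponent of \<open>x\<close> by a constant \<open>d\<close>.\<close>

definition theta :: "real \<Rightarrow> real fps \<Rightarrow> real fps" where
  "theta d f = Abs_fps (\<lambda>n. (real n + d) * f $ n)"

lemma theta_add: "theta d (f + g) = theta d f + theta d g"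
  by (rule fps_ext) (simp add: theta_def algebra_simps)
lemma theta_cmult: "theta d (fps_const c * f) = fps_const c * theta d f"
  by (rule fps_ext) (simp add: theta_def algebra_simps)
lemma theta_0 [simp]: "theta d 0 = 0"
  by (rule fps_ext) (simp add: theta_def)

text \<open>Each application lowers the order in \<open>u\<close> by at most two, and the shift \<open>d\<close> does not affect the lowest term.\<close>

lemma theta_upow:
  "theta d (upow k) = fps_const (- of_int k / 2) * upow (k - 2) + fps_const (of_int k / 2 + d) * upow k"
proof (rule fps_ext)
  fix n
  have "(of_int k / 2 - real n) * (of_int k / 2 gchoose n) = of_int k / 2 * (of_int k / 2 - 1 gchoose n)"
    by (rule gbinomial_absorb_comp)
  moreover have "of_int (k - 2) / 2 = (of_int k / 2 - 1 :: real)" by simp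
  ultimately have "(real n + d) * (of_int k / 2 gchoose n) =
      - of_int k / 2 * (of_int (k - 2) / 2 gchoose n) + (of_int k / 2 + d) * (of_int k / 2 gchoose n)"
    by (simp only:) (simp add: algebra_simps)
  then show "theta d (upow k) $ n =
      (fps_const (- of_int k / 2) * upow (k - 2) + fps_const (of_int k / 2 + d) * upow k) $ n"
    unfolding theta_def upow_def fps_nth_Abs_fps fps_add_nth fps_mult_left_const_nth
    by (metis (no_types, lifting) distrib_right mult.assoc)
qed

text \<open>The span of the powers of \<open>u\<close> with exponent at least \<open>k\<close>.\<close>

inductive_set lau :: "int \<Rightarrow> real fps set" for k where
  lau_zero: "0 \<in> lau k"
| lau_step: "f \<in> lau k \<Longrightarrow> k \<le> j \<Longrightarrow> fps_const c * upow j + f \<in> lau k"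

lemma lau_mono: "f \<in> lau k \<Longrightarrow> l \<le> k \<Longrightarrow> f \<in> lau l"
  by (induction rule: lau.induct) (auto intro: lau.intros)

lemma lau_monom: "k \<le> j \<Longrightarrow> fps_const c * upow j \<in> lau k"
  using lau_step [OF lau_zero, of k j c] by simp

lemma lau_add: "f \<in> lau k \<Longrightarrow> g \<in> lau k \<Longrightarrow> f + g \<in> lau k"
  by (induction rule: lau.induct) (auto simp: add.assoc intro: lau.intros)

lemma lau_cmult: "f \<in> lau k \<Longrightarrow> fps_const c * f \<in> lau k"
proof (induction rule: lau.induct)
  case (lau_step f j d)
  then show ?case
    using lau.lau_step [of "fps_const c * f" k j "c * d"]
    by (simp add: distrib_left mult.assoc flip: fps_const_mult)
qed (simp add: lau_zero)

lemma lau_minus: "f \<in> lau k \<Longrightarrow> - f \<in> lau k"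
  using lau_cmult [of f k "-1"] by (simp flip: fps_const_neg)

lemma lau_diff: "f \<in> lau k \<Longrightarrow> g \<in> lau k \<Longrightarrow> f - g \<in> lau k"
  using lau_add [of f k "- g"] lau_minus by fastforce

lemma lau_upow_mult: "f \<in> lau k \<Longrightarrow> upow j * f \<in> lau (k + j)"
proof (induction rule: lau.induct)
  case (lau_step f i d)
  have "upow j * (fps_const d * upow i + f) = fps_const d * upow (i + j) + upow j * f"
    by (simp add: upow_add algebra_simps)
  then show ?case using lau_step by (simp add: lau.lau_step)
qed (simp add: lau_zero)

lemma lau_mult:
  assumes "f \<in> lau k" "g \<in> lau l"
  shows "f * g \<in> lau (k + l)"
  using assms(1)
proof (induction rule: lau.induct)
  case (lau_step f j d)
  have "fps_const d * (upow j * g) \<in> lau (l + j)"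
    by (intro lau_cmult lau_upow_mult [OF assms(2)])
  then have "fps_const d * (upow j * g) \<in> lau (k + l)"
    using lau_mono lau_step by (metis add.commute add_left_mono)
  then show ?case using lau_step by (simp add: distrib_right lau_add mult.assoc)
qed (simp add: lau_zero)

lemma lau_sum: "(\<And>i. i \<in> S \<Longrightarrow> f i \<in> lau k) \<Longrightarrow> sum f S \<in> lau k"
  by (induction S rule: infinite_finite_induct) (auto intro: lau_zero lau_add)

lemma lau_theta: "f \<in> lau k \<Longrightarrow> theta d f \<in> lau (k - 2)"
proof (induction rule: lau.induct)
  case (lau_step f j c)
  have "theta d (upow j) \<in> lau (k - 2)"
    unfolding theta_upow by (intro lau_add lau_monom) (use lau_step in auto)
  then show ?case using lau_step by (simp add: theta_add theta_cmult lau_add lau_cmult)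
qed (simp add: lau_zero)

lemma lau_theta_pow: "f \<in> lau k \<Longrightarrow> (theta d ^^ p) f \<in> lau (k - 2 * int p)"
proof (induction p)
  case (Suc p)
  then show ?case using lau_theta [of "(theta d ^^ p) f" "k - 2 * int p" d] by (simp add: algebra_simps)
qed simp

text \<open>The coefficient \<open>c\<close> may vanish, so that predicted lowest terms can be added and multiplied without case
distinctions.\<close>

definition lead :: "int \<Rightarrow> real \<Rightarrow> real fps \<Rightarrow> bool" where
  "lead k c f \<longleftrightarrow> f - fps_const c * upow k \<in> lau (k + 1)"

lemma lead_add: "lead k c f \<Longrightarrow> lead k d g \<Longrightarrow> lead k (c + d) (f + g)"
  unfolding lead_def using lau_add [of "f - fps_const c * upow k" "k+1" "g - fps_const d * upow k"]
  by (simp add: algebra_simps flip: fps_const_add)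

lemma lead_cmult: "lead k c f \<Longrightarrow> lead k (d * c) (fps_const d * f)"
  unfolding lead_def using lau_cmult [of "f - fps_const c * upow k" "k+1" d]
  by (simp add: algebra_simps flip: fps_const_mult)

lemma lead_minus: "lead k c f \<Longrightarrow> lead k (- c) (- f)"
  using lead_cmult [of k c f "-1"] by (simp flip: fps_const_neg)

lemma lead_diff: "lead k c f \<Longrightarrow> lead k d g \<Longrightarrow> lead k (c - d) (f - g)"
  using lead_add [of k c f "-d" "-g"] lead_minus by fastforce

lemma lead_zero: "f \<in> lau l \<Longrightarrow> k < l \<Longrightarrow> lead k 0 f"
  unfolding lead_def using lau_mono [of f l "k + 1"] by simp

lemma lead_lau: "lead k c f \<Longrightarrow> f \<in> lau k"
  unfolding lead_def
  using lau_add [of "f - fps_const c * upow k" k "fps_const c * upow k"]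
  by (simp add: lau_mono lau_monom)

lemma lead_upow: "lead k 1 (upow k)"
  by (simp add: lead_def lau_zero)

lemma lead_mult:
  assumes "lead k c f" "lead l d g"
  shows "lead (k + l) (c * d) (f * g)"
proof -
  have 1: "(f - fps_const c * upow k) * g \<in> lau (k + 1 + l)"
    using assms(1) lead_lau [OF assms(2)] by (intro lau_mult) (auto simp: lead_def)
  have 2: "(fps_const c * upow k) * (g - fps_const d * upow l) \<in> lau (k + (l + 1))"
    using assms by (intro lau_mult lau_monom) (auto simp: lead_def)
  have "f * g - fps_const (c * d) * upow (k + l) =
      (f - fps_const c * upow k) * g + (fps_const c * upow k) * (g - fps_const d * upow l)"
    by (simp add: upow_add algebra_simps flip: fps_const_mult)
  with lau_add [OF _ 2, of "(f - fps_const c * upow k) * g"] 1 show ?thesis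
    by (simp add: lead_def algebra_simps)
qed

lemma lead_sum:
  "(\<And>i. i \<in> S \<Longrightarrow> lead k (c i) (f i)) \<Longrightarrow> lead k (sum c S) (sum f S)"
  by (induction S rule: infinite_finite_induct) (auto intro: lead_add lead_zero [OF lau_zero, of _ "_ + 1"])

lemma lead_theta: 
  assumes "lead k c f"
  shows "lead (k - 2) (- of_int k / 2 * c) (theta d f)"
proof -
  have "theta d (f - fps_const c * upow k) \<in> lau (k + 1 - 2)"
    using assms lau_theta unfolding lead_def by blast
  moreover have "fps_const (c * (of_int k / 2 + d)) * upow k \<in> lau (k - 1)"
    by (intro lau_monom) auto
  ultimately have "theta d (f - fps_const c * upow k) + fps_const (c * (of_int k / 2 + d)) * upow k \<in> lau (k - 1)"
    by (intro lau_add) auto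
  moreover have "theta d f = theta d (f - fps_const c * upow k) + theta d (fps_const c * upow k)"
    by (simp flip: theta_add)
  moreover have "theta d (fps_const c * upow k) = fps_const (- of_int k / 2 * c) * upow (k - 2)
      + fps_const (c * (of_int k / 2 + d)) * upow k"
    unfolding theta_cmult theta_upow distrib_left mult.assoc [symmetric] fps_const_mult
    by (simp add: mult.commute)
  ultimately have "theta d f - fps_const (- of_int k / 2 * c) * upow (k - 2) =
      theta d (f - fps_const c * upow k) + fps_const (c * (of_int k / 2 + d)) * upow k"
    and "theta d (f - fps_const c * upow k) + fps_const (c * (of_int k / 2 + d)) * upow k \<in> lau (k - 1)"
    by (simp_all only: add_diff_eq diff_add_eq add_diff_cancel_left' add.assoc) (simp_all add: algebra_simps)
  then show ?thesis by (simp add: lead_def)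
qed

lemma lead_upow_mult: "lead k c f \<Longrightarrow> lead (k + j) c (upow j * f)"
  using lead_mult [OF lead_upow, of k c f j] by (simp add: add.commute)

section \<open>Weighted degrees and the raising of levels\<close>

text \<open>The outer variable is \<open>x\<close>, the next one \<open>\<beta>\<close> and the innermost one \<open>\<alpha>\<close>; \<open>cf F a b\<close> is the coefficient of
\<open>\<alpha>\<^sup>a \<beta>\<^sup>b\<close>, a series in \<open>x\<close>.\<close>

type_synonym biseries = "real fps fps fps"

definition cf :: "biseries \<Rightarrow> nat \<Rightarrow> nat \<Rightarrow> real fps" where
  "cf F a b = Abs_fps (\<lambda>n. F $ n $ b $ a)"

definition conv :: "(nat \<Rightarrow> nat \<Rightarrow> 'a::comm_ring_1) \<Rightarrow> (nat \<Rightarrow> nat \<Rightarrow> 'a) \<Rightarrow> nat \<Rightarrow> nat \<Rightarrow> 'a" where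
  "conv f g a b = (\<Sum>(i, j)\<in>{..a} \<times> {..b}. f i j * g (a - i) (b - j))"

text \<open>The two excluded terms contain the unknown coefficient when a quadratic or linear equation is solved
at index \<open>(a, b)\<close>.\<close>

definition convI :: "(nat \<Rightarrow> nat \<Rightarrow> 'a::comm_ring_1) \<Rightarrow> (nat \<Rightarrow> nat \<Rightarrow> 'a) \<Rightarrow> nat \<Rightarrow> nat \<Rightarrow> 'a" where
  "convI f g a b = (\<Sum>(i, j)\<in>{..a} \<times> {..b} - {(0, 0), (a, b)}. f i j * g (a - i) (b - j))"

lemma conv_split:
  assumes "(a, b) \<noteq> (0, 0)"
  shows "conv f g a b = f 0 0 * g a b + f a b * g 0 0 + convI f g a b"
proof -
  have "{..a} \<times> {..b} = insert (0,0) (insert (a, b) ({..a} \<times> {..b} - {(0, 0), (a, b)}))"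
    by auto
  then have "conv f g a b = (\<Sum>(i, j)\<in>insert (0,0) (insert (a, b) ({..a} \<times> {..b} - {(0, 0), (a, b)})). f i j * g (a - i) (b - j))"
    by (simp add: conv_def)
  also have "\<dots> = f 0 0 * g (a - 0) (b - 0) + (f a b * g (a - a) (b - b) + convI f g a b)"
    unfolding convI_def using assms by (subst sum.insert; (subst sum.insert)?) auto
  finally show ?thesis by (simp add: add.assoc)
qed

lemma cf_add: "cf (F + G) a b = cf F a b + cf G a b"
  and cf_diff: "cf (F - G) a b = cf F a b - cf G a b"
  by (rule fps_ext, simp add: cf_def)+

lemma cf_mult: "cf (F * G) a b = conv (cf F) (cf G) a b"
proof (rule fps_ext)
  fix n
  have "cf (F * G) a b $ n = (\<Sum>m\<le>n. \<Sum>j\<le>b. \<Sum>i\<le>a. F $ m $ j $ i * G $ (n - m) $ (b - j) $ (a - i))"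
    by (simp add: cf_def fps_mult_nth fps_sum_nth atLeast0AtMost)
  also have "\<dots> = (\<Sum>m\<le>n. \<Sum>i\<le>a. \<Sum>j\<le>b. F $ m $ j $ i * G $ (n - m) $ (b - j) $ (a - i))"
    by (intro sum.cong refl sum.swap)
  also have "\<dots> = (\<Sum>m\<le>n. \<Sum>(i, j)\<in>{..a} \<times> {..b}. F $ m $ j $ i * G $ (n - m) $ (b - j) $ (a - i))"
    by (simp add: sum.cartesian_product)
  also have "\<dots> = (\<Sum>(i, j)\<in>{..a} \<times> {..b}. \<Sum>m\<le>n. F $ m $ j $ i * G $ (n - m) $ (b - j) $ (a - i))"
    by (subst sum.swap) (simp add: case_prod_unfold)
  also have "\<dots> = conv (cf F) (cf G) a b $ n"
    by (simp add: conv_def fps_sum_nth fps_mult_nth cf_def atLeast0AtMost case_prod_unfold)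
  finally show "cf (F * G) a b $ n = conv (cf F) (cf G) a b $ n" .
qed

text \<open>The second index dominates: raising the level turns \<open>\<beta> C\<close> into \<open>\<beta> C + 2 \<beta> A + \<dots>\<close> and thereby
replaces \<open>(a, b)\<close> by \<open>(a + 1, b - 1)\<close>.\<close>

definition lexless :: "nat \<times> nat \<Rightarrow> nat \<times> nat \<Rightarrow> bool" where
  "lexless p q \<longleftrightarrow> snd p < snd q \<or> snd p = snd q \<and> fst p < fst q"

lemma lexless_induct [case_names less]:
  assumes "\<And>a b. (\<And>i j. lexless (i, j) (a, b) \<Longrightarrow> P i j) \<Longrightarrow> P a b"
  shows "P a b"
proof -
  have wf: "wf (inv_image (less_than <*lex*> less_than) prod.swap)"
    by (intro wf_inv_image wf_lex_prod wf_less_than)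
  have "P (fst p) (snd p)" for p
  proof (induction p rule: wf_induct_rule [OF wf])
    case less_p: (1 p)
    show ?case
    proof (rule assms)
      fix i j assume "lexless (i, j) (fst p, snd p)"
      then show "P i j" using less_p [of "(i, j)"] by (cases p) (auto simp: lexless_def)
    qed
  qed
  from this [of "(a, b)"] show ?thesis by simp
qed

text \<open>Homogeneity for the degrees 1, 3, 4 of \<open>u\<close>, \<open>\<alpha>\<close>, \<open>\<beta>\<close>.\<close>

definition famlead :: "int \<Rightarrow> (nat \<Rightarrow> nat \<Rightarrow> real) \<Rightarrow> biseries \<Rightarrow> nat \<Rightarrow> nat \<Rightarrow> bool" where
  "famlead k c F a b \<longleftrightarrow> lead (k - 3 * int a - 4 * int b) (c a b) (cf F a b)"

lemma lead_convI:
  assumes "\<And>i j. lexless (i, j) (a, b) \<Longrightarrow> famlead k c F i j"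
    and "\<And>i j. lexless (i, j) (a, b) \<Longrightarrow> famlead l d G i j"
  shows "lead (k + l - 3 * int a - 4 * int b) (convI c d a b) (convI (cf F) (cf G) a b)"
  unfolding convI_def case_prod_unfold
proof (rule lead_sum)
  fix p assume "p \<in> {..a} \<times> {..b} - {(0, 0), (a, b)}"
  then obtain i j where p: "p = (i, j)" and *: "i \<le> a" "j \<le> b" "(i, j) \<noteq> (0, 0)" "(i, j) \<noteq> (a, b)"
    by (cases p) auto
  have "lexless (i, j) (a, b)" "lexless (a - i, b - j) (a, b)"
    using * by (auto simp: lexless_def)
  with assms have "lead (k - 3 * int i - 4 * int j + (l - 3 * int (a - i) - 4 * int (b - j)))
      (c i j * d (a - i) (b - j)) (cf F i j * cf G (a - i) (b - j))"
    unfolding famlead_def by (intro lead_mult) blast+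
  moreover have "k - 3 * int i - 4 * int j + (l - 3 * int (a - i) - 4 * int (b - j)) =
      k + l - 3 * int a - 4 * int b"
    using * by (simp add: of_nat_diff)
  ultimately have "lead (k + l - 3 * int a - 4 * int b)
      (c i j * d (a - i) (b - j)) (cf F i j * cf G (a - i) (b - j))"
    by metis
  then show "lead (k + l - 3 * int a - 4 * int b)
      (c (fst p) (snd p) * d (a - fst p) (b - snd p)) (cf F (fst p) (snd p) * cf G (a - fst p) (b - snd p))"
    by (simp add: p)
qed

definition famlau :: "int \<Rightarrow> biseries \<Rightarrow> nat \<Rightarrow> nat \<Rightarrow> bool" where
  "famlau k F a b \<longleftrightarrow> cf F a b \<in> lau (k - 3 * int a - 4 * int b)"

lemma famlead_imp_famlau: "famlead k c F a b \<Longrightarrow> famlau k F a b"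
  unfolding famlead_def famlau_def by (rule lead_lau)

lemma famlau_multI:
  assumes "\<And>i j. i \<le> a \<Longrightarrow> j \<le> b \<Longrightarrow> cf F i j = 0 \<or> famlau k F i j \<and> famlau l G (a - i) (b - j)"
  shows "famlau (k + l) (F * G) a b"
  unfolding famlau_def cf_mult conv_def case_prod_unfold
proof (rule lau_sum)
  fix p assume "p \<in> {..a} \<times> {..b}"
  then obtain i j where p: "p = (i, j)" and *: "i \<le> a" "j \<le> b" by (cases p) auto
  have "cf F i j * cf G (a - i) (b - j) \<in>
      lau (k - 3 * int i - 4 * int j + (l - 3 * int (a - i) - 4 * int (b - j)))"
    using assms [OF *]
  proof
    assume "famlau k F i j \<and> famlau l G (a - i) (b - j)"
    then show ?thesis unfolding famlau_def by (intro lau_mult) blast+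
  qed (simp add: lau_zero)
  moreover have "k - 3 * int i - 4 * int j + (l - 3 * int (a - i) - 4 * int (b - j)) =
      k + l - 3 * int a - 4 * int b"
    using * by (simp add: of_nat_diff)
  ultimately show "cf F (fst p) (snd p) * cf G (a - fst p) (b - snd p) \<in> lau (k + l - 3 * int a - 4 * int b)"
    by (metis p fst_conv snd_conv)
qed

text \<open>Multiplication by a series without constant coefficient does not use the coefficient of the other factor at
\<open>(a, b)\<close> itself; this keeps the inductions below well-founded.\<close>

lemma famlau_mult_zero:
  assumes zero: "cf F 0 0 = 0"
    and F: "\<And>i j. famlau k F i j"
    and G: "\<And>i j. lexless (i, j) (a, b) \<Longrightarrow> famlau l G i j"
  shows "famlau (k + l) (F * G) a b"
proof (rule famlau_multI)
  fix i j assume "i \<le> a" "j \<le> b"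
  then have "(i, j) = (0, 0) \<or> lexless (a - i, b - j) (a, b)" by (auto simp: lexless_def)
  then show "cf F i j = 0 \<or> famlau k F i j \<and> famlau l G (a - i) (b - j)"
    using zero F G by blast
qed

lemma famlau_mult:
  assumes "\<And>i j. i \<le> a \<Longrightarrow> j \<le> b \<Longrightarrow> famlau k F i j"
    and "\<And>i j. i \<le> a \<Longrightarrow> j \<le> b \<Longrightarrow> famlau l G i j"
  shows "famlau (k + l) (F * G) a b"
proof (rule famlau_multI)
  fix i j assume "i \<le> a" "j \<le> b"
  then show "cf F i j = 0 \<or> famlau k F i j \<and> famlau l G (a - i) (b - j)"
    using assms(1) [of i j] assms(2) [of "a - i" "b - j"] by simp
qed

text \<open>Index set of the expansion of \<open>exp((\<alpha> + \<beta>) m) F(\<alpha> + 2\<beta>, \<beta>)\<close>: powers \<open>i\<close> and \<open>j\<close> from the two exponentials, power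
\<open>l\<close> from the substitution.\<close>

definition trip :: "nat \<Rightarrow> nat \<Rightarrow> (nat \<times> nat \<times> nat) set" where
  "trip a b = {(i, j, l). i \<le> a \<and> j + l \<le> b}"

lemma finite_trip [simp]: "finite (trip a b)"
  by (rule finite_subset [of _ "{..a} \<times> {..b} \<times> {..b}"]) (auto simp: trip_def)

definition shift_term :: "real \<Rightarrow> biseries \<Rightarrow> nat \<Rightarrow> nat \<Rightarrow> nat \<times> nat \<times> nat \<Rightarrow> real fps" where
  "shift_term d F a b = (\<lambda>(i, j, l).
     fps_const (of_nat (a - i + l choose l) * 2 ^ l / (fact i * fact j)) *
     (theta d ^^ (i + j)) (cf F (a - i + l) (b - j - l)))"

definition shift_sum :: "real \<Rightarrow> biseries \<Rightarrow> nat \<Rightarrow> nat \<Rightarrow> real fps" where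
  "shift_sum d F a b = sum (shift_term d F a b) (trip a b)"

text \<open>\<open>F'\<close> arises from \<open>F\<close> by raising the level, up to terms of order 0 in \<open>u\<close>. This slack admits \<open>1 - 2 T\<close> besides \<open>T\<close>,
although constants are not invariant under the expansion when \<open>d \<noteq> 0\<close>.\<close>

definition shifted :: "real \<Rightarrow> biseries \<Rightarrow> biseries \<Rightarrow> bool" where
  "shifted d F F' \<longleftrightarrow> cf F' 0 0 = cf F 0 0 \<and> (\<forall>a b. cf F' a b - shift_sum d F a b \<in> lau 0)"

text \<open>The first-order part of raising the level, read off on lowest coefficients: \<open>\<alpha> x d/dx\<close> acts on
\<open>u\<^sup>e\<close> with factor \<open>- e / 2\<close>, where \<open>e = k - 3 (a - 1) - 4 b\<close>, and \<open>2 \<beta> d/d\<alpha>\<close> gives the second term.\<close>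

definition Lop :: "int \<Rightarrow> (nat \<Rightarrow> nat \<Rightarrow> real) \<Rightarrow> nat \<Rightarrow> nat \<Rightarrow> real" where
  "Lop k c a b = (if a = 0 then 0 else (3 * real a + 4 * real b - 3 - of_int k) / 2 * c (a - 1) b)
     + (if b = 0 then 0 else 2 * (real a + 1) * c (a + 1) (b - 1))"

text \<open>The term \<open>(i, j, l)\<close> of the expansion has degree \<open>i + 2 j + l\<close> above that of \<open>F\<close>, so only \<open>(1, 0, 0)\<close> and
\<open>(0, 0, 1)\<close> contribute in degree one.\<close>

lemma shift_diff:
  assumes sh: "shifted d F F'" and k: "k \<le> 1"
    and F: "\<And>i j. lexless (i, j) (a, b) \<Longrightarrow> famlead k c F i j"
    and ab: "(a, b) \<noteq> (0, 0)"
  shows "lead (k + 1 - 3 * int a - 4 * int b) (Lop k c a b) (cf F' a b - cf F a b)"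
proof -
  let ?m = "k + 1 - 3 * int a - 4 * int b"
  define x where "x = (3 * real a + 4 * real b - 3 - of_int k) / 2 * c (a - 1) b"
  define y where "y = 2 * (real a + 1) * c (a + 1) (b - 1)"
  define e where "e t = (if t = (1, 0, 0) then x else 0) + (if t = (0, 0, 1) then y else 0)"
    for t :: "nat \<times> nat \<times> nat"
  define T where "T t = (if t = (0, 0, 0) then 0 else shift_term d F a b t)" for t
  have split: "shift_sum d F a b = cf F a b + sum T (trip a b)"
  proof -
    have 0: "(0, 0, 0) \<in> trip a b" by (simp add: trip_def)
    have "shift_sum d F a b = shift_term d F a b (0, 0, 0) + sum (shift_term d F a b) (trip a b - {(0, 0, 0)})"
      unfolding shift_sum_def by (subst sum.remove [OF _ 0]) auto
    moreover have "sum T (trip a b) = sum T (trip a b - {(0, 0, 0)})"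
      by (subst sum.remove [OF _ 0]) (auto simp: T_def)
    moreover have "\<dots> = sum (shift_term d F a b) (trip a b - {(0, 0, 0)})"
      by (intro sum.cong) (auto simp: T_def)
    ultimately show ?thesis by (simp add: shift_term_def)
  qed
  have "lead ?m (sum e (trip a b)) (sum T (trip a b))"
  proof (rule lead_sum)
    fix t assume t: "t \<in> trip a b"
    obtain i j l where tt: "t = (i, j, l)" by (cases t) auto
    have ij: "i \<le> a" "j + l \<le> b" using t tt by (auto simp: trip_def)
    show "lead ?m (e t) (T t)"
    proof (cases "t = (0, 0, 0)")
      case True
      then show ?thesis by (simp add: e_def T_def lead_def lau_zero)
    next
      case nz: False
      let ?i = "a - i + l" and ?j = "b - j - l"
      let ?C = "of_nat (a - i + l choose l) * 2 ^ l / (fact i * fact j) :: real"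
      have less: "lexless (?i, ?j) (a, b)"
        using nz tt ij by (auto simp: lexless_def)
      have led: "lead (k - 3 * int ?i - 4 * int ?j) (c ?i ?j) (cf F ?i ?j)"
        using F [OF less] by (simp add: famlead_def)
      have Tt: "T t = fps_const ?C * (theta d ^^ (i + j)) (cf F ?i ?j)"
        using nz tt by (auto simp add: T_def shift_term_def)
      consider "t = (1, 0, 0)" | "t = (0, 0, 1)" | "2 \<le> i + 2 * j + l" "t \<noteq> (1, 0, 0)" "t \<noteq> (0, 0, 1)"
        using nz tt by (cases "i + 2 * j + l \<le> 1") (fastforce simp: le_Suc_eq)+
      then show ?thesis
      proof cases
        case 1
        then have "lead (k - 3 * int ?i - 4 * int ?j - 2) (- of_int (k - 3 * int ?i - 4 * int ?j) / 2 * c ?i ?j)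
            (theta d (cf F ?i ?j))"
          using lead_theta [OF led] by simp
        moreover have "k - 3 * int ?i - 4 * int ?j - 2 = ?m" 
          using 1 tt ij by (simp add: of_nat_diff)
        moreover have "- of_int (k - 3 * int ?i - 4 * int ?j) / 2 * c ?i ?j = x"
          using 1 tt ij by (simp add: x_def of_nat_diff field_simps)
        ultimately have "lead ?m x (theta d (cf F ?i ?j))" by metis
        moreover have "T t = theta d (cf F ?i ?j)" "e t = x" using 1 tt Tt by (auto simp: e_def)
        ultimately show ?thesis by metis
      next
        case 2
        have "lead (k - 3 * int ?i - 4 * int ?j) (2 * (real a + 1) * c ?i ?j)
            (fps_const (2 * (real a + 1)) * cf F ?i ?j)"
          by (rule lead_cmult [OF led])
        moreover have "k - 3 * int ?i - 4 * int ?j = ?m" 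
          using 2 tt ij by (simp add: of_nat_diff)
        moreover have "?C = 2 * (real a + 1)" using 2 tt by simp
        then have "T t = fps_const (2 * (real a + 1)) * cf F ?i ?j"
          unfolding Tt using 2 tt by simp
        moreover have "2 * (real a + 1) * c ?i ?j = e t"
          using 2 tt by (simp add: e_def y_def)
        ultimately show ?thesis by metis
      next
        case 3
        have "(theta d ^^ (i + j)) (cf F ?i ?j) \<in> lau (k - 3 * int ?i - 4 * int ?j - 2 * int (i + j))"
          by (rule lau_theta_pow [OF lead_lau [OF led]])
        then have "T t \<in> lau (k - 3 * int ?i - 4 * int ?j - 2 * int (i + j))"
          unfolding Tt by (rule lau_cmult)
        moreover have "?m < k - 3 * int ?i - 4 * int ?j - 2 * int (i + j)"
          using 3 ij by (simp add: of_nat_diff)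
        ultimately show ?thesis using lead_zero 3 by (simp add: e_def)
      qed
    qed
  qed
  moreover have "sum e (trip a b) = Lop k c a b"
  proof -
    have "sum e (trip a b) = (if (1, 0, 0) \<in> trip a b then x else 0) + (if (0, 0, 1) \<in> trip a b then y else 0)"
      unfolding e_def by (simp add: sum.distrib)
    then show ?thesis by (auto simp: trip_def Lop_def x_def y_def)
  qed
  moreover have "lead ?m 0 (cf F' a b - shift_sum d F a b)"
    using sh ab k unfolding shifted_def by (intro lead_zero [of _ 0]) auto
  ultimately have "lead ?m (Lop k c a b + 0) (sum T (trip a b) + (cf F' a b - shift_sum d F a b))"
    by (intro lead_add) auto
  then show ?thesis by (simp add: split)
qed

lemma shift_famlead:
  assumes sh: "shifted d F F'" and k: "k \<le> 1"
    and F: "\<And>i j. lexless (i, j) (a, b) \<or> (i, j) = (a, b) \<Longrightarrow> famlead k c F i j"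
  shows "famlead k c F' a b"
proof (cases "(a, b) = (0, 0)")
  case True
  then show ?thesis using F [of 0 0] sh by (simp add: shifted_def famlead_def)
next
  case False
  have "cf F' a b - cf F a b \<in> lau (k + 1 - 3 * int a - 4 * int b)"
    by (rule lead_lau [OF shift_diff [OF sh k _ False]]) (use F in blast)
  then have "lead (k - 3 * int a - 4 * int b) 0 (cf F' a b - cf F a b)"
    by (rule lead_zero) simp
  with F [of a b] show ?thesis
    unfolding famlead_def using lead_add [of _ "c a b" "cf F a b" 0] by fastforce
qed

lemma lexless_trans: "lexless p q \<Longrightarrow> lexless q r \<Longrightarrow> lexless p r"
  by (auto simp: lexless_def)

lemma cf_1: "cf 1 a b = (if a = 0 \<and> b = 0 then 1 else 0)"
  by (rule fps_ext) (simp add: cf_def)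


lemma theta_pow_diff: "(theta d ^^ p) (f - g) = (theta d ^^ p) f - (theta d ^^ p) g"
proof (induction p)
  case (Suc p)
  have "theta d (f - g) = theta d f - theta d g" for f g
    by (rule fps_ext) (simp add: theta_def algebra_simps)
  with Suc show ?case by simp
qed simp

lemma theta_pow_cmult: "(theta d ^^ p) (fps_const c * f) = fps_const c * (theta d ^^ p) f"
  by (induction p) (simp_all add: theta_cmult)

lemma shift_sum_diff: "shift_sum d (F - G) a b = shift_sum d F a b - shift_sum d G a b"
  unfolding shift_sum_def sum_subtractf [symmetric]
  by (intro sum.cong) (auto simp: shift_term_def cf_diff theta_pow_diff algebra_simps)

lemma shift_sum_numeral: "shift_sum d (2 * F) a b = fps_const 2 * shift_sum d F a b"
proof -
  have "cf (2 * F) i j = fps_const 2 * cf F i j" for i j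
    by (rule fps_ext) (simp add: cf_def fps_numeral_nth fps_numeral_fps_const)
  then show ?thesis
    unfolding shift_sum_def sum_distrib_left
    by (intro sum.cong) (auto simp: shift_term_def theta_pow_cmult algebra_simps)
qed

lemma shift_sum_1: "shift_sum d 1 a b \<in> lau 0"
  unfolding shift_sum_def
proof (rule lau_sum)
  fix t :: "nat \<times> nat \<times> nat"
  obtain i j l where t: "t = (i, j, l)" by (cases t) auto
  have th: "(theta d ^^ p) 1 = fps_const (d ^ p)" for p
    by (induction p) (auto intro!: fps_ext simp: theta_def)
  have th0: "(theta d ^^ p) 0 = 0" for p by (induction p) auto
  have "(theta d ^^ p) (cf 1 x y) \<in> lau 0" for p x y
    using lau_monom [of 0 0 "d ^ p"] by (auto simp: cf_1 th th0 lau_zero)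
  then show "shift_term d 1 a b t \<in> lau 0"
    unfolding shift_term_def t by (auto intro!: lau_cmult)
qed

lemma cf_numeral_mult: "cf (2 * F) a b = fps_const 2 * cf F a b"
  by (rule fps_ext) (simp add: cf_def fps_numeral_fps_const)

lemma shifted_one_minus_twice:
  assumes "shifted d F F'"
  shows "shifted d (1 - 2 * F) (1 - 2 * F')"
  unfolding shifted_def
proof (intro conjI allI)
  show "cf (1 - 2 * F') 0 0 = cf (1 - 2 * F) 0 0"
    using assms by (simp add: shifted_def cf_diff cf_numeral_mult)
next
  fix a b
  have "cf (1 - 2 * F') a b - shift_sum d (1 - 2 * F) a b =
      cf 1 a b - shift_sum d 1 a b - fps_const 2 * (cf F' a b - shift_sum d F a b)"
    by (simp only: cf_diff cf_numeral_mult shift_sum_diff shift_sum_numeral right_diff_distrib) simp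
  moreover have "\<dots> \<in> lau 0"
  proof (intro lau_diff [of _ 0 "fps_const 2 * _"] lau_cmult)
    show "cf 1 a b - shift_sum d 1 a b \<in> lau 0"
      using lau_monom [of 0 0 1] by (intro lau_diff shift_sum_1) (auto simp: cf_1 lau_zero)
    show "cf F' a b - shift_sum d F a b \<in> lau 0"
      using assms by (simp add: shifted_def)
  qed
  ultimately show "cf (1 - 2 * F') a b - shift_sum d (1 - 2 * F) a b \<in> lau 0" by metis
qed

text \<open>The lowest coefficients of \<open>1 - 2 T\<close>, \<open>J\<close> and \<open>G\<close>. As series in \<open>\<alpha>\<close> and \<open>\<beta>\<close> they are the solutions of \<open>y\<^sup>2 = 1 + L\<^sub>1 y\<close>,
\<open>2 y j = 2 + L\<^bsub>-1\<^esub> j\<close> and \<open>y g = j\<close>, where \<open>L\<^sub>k\<close> is \<open>Lop k\<close>.\<close>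

function yc :: "nat \<Rightarrow> nat \<Rightarrow> real" where
  "yc a b = (if a = 0 \<and> b = 0 then 1 else
     ((if a = 0 then 0 else (3 * real a + 4 * real b - 4) / 2 * yc (a - 1) b)
      + (if b = 0 then 0 else 2 * (real a + 1) * yc (a + 1) (b - 1))
      - (\<Sum>(i, j)\<in>{..a} \<times> {..b} - {(0, 0), (a, b)}. yc i j * yc (a - i) (b - j))) / 2)"
  by auto
termination
  by (relation "inv_image (less_than <*lex*> less_than) prod.swap") (auto simp: prod.swap_def)

declare yc.simps [simp del]

function jc :: "nat \<Rightarrow> nat \<Rightarrow> real" where
  "jc a b = (if a = 0 \<and> b = 0 then 1 else
     ((if a = 0 then 0 else (3 * real a + 4 * real b - 2) / 2 * jc (a - 1) b)
      + (if b = 0 then 0 else 2 * (real a + 1) * jc (a + 1) (b - 1))) / 2 - yc a b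
      - (\<Sum>(i, j)\<in>{..a} \<times> {..b} - {(0, 0), (a, b)}. yc i j * jc (a - i) (b - j)))"
  by auto
termination
  by (relation "inv_image (less_than <*lex*> less_than) prod.swap") (auto simp: prod.swap_def)

declare jc.simps [simp del]

function gc :: "nat \<Rightarrow> nat \<Rightarrow> real" where
  "gc a b = (if a = 0 \<and> b = 0 then 1 else jc a b - yc a b
      - (\<Sum>(i, j)\<in>{..a} \<times> {..b} - {(0, 0), (a, b)}. yc i j * gc (a - i) (b - j)))"
  by auto
termination
  by (relation "inv_image (less_than <*lex*> less_than) prod.swap") (auto simp: prod.swap_def)

declare gc.simps [simp del]

lemma yc_0 [simp]: "yc 0 0 = 1" and jc_0 [simp]: "jc 0 0 = 1" and gc_0 [simp]: "gc 0 0 = 1"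
  by (simp_all add: yc.simps jc.simps gc.simps)

lemma yc_rec: "(a, b) \<noteq> (0, 0) \<Longrightarrow> 2 * yc a b = Lop 1 yc a b - convI yc yc a b"
  by (subst yc.simps) (auto simp: Lop_def convI_def)

lemma jc_rec: "(a, b) \<noteq> (0, 0) \<Longrightarrow> jc a b = Lop (-1) jc a b / 2 - yc a b - convI yc jc a b"
  by (subst jc.simps) (auto simp: Lop_def convI_def)

lemma gc_rec: "(a, b) \<noteq> (0, 0) \<Longrightarrow> gc a b = jc a b - yc a b - convI yc gc a b"
  by (subst gc.simps) (auto simp: convI_def)

lemma upow_even: "upow 1 * upow 1 = upow 2"
  by (simp flip: upow_add)

text \<open>In all three equations the unknown coefficient is multiplied by \<open>2 u\<close>.\<close>

lemma lead_solve:
  assumes "fps_const 2 * upow 1 * f = g" "lead (k + 1) (2 * c) g"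
  shows "lead k c f"
proof -
  have "lead (k + 1 + (-1)) (1 / 2 * (2 * c)) (upow (-1) * (fps_const (1 / 2) * g))"
    by (intro lead_upow_mult lead_cmult assms)
  moreover have "upow (-1) * (fps_const (1 / 2) * g) = (upow (-1) * upow 1) * (fps_const (1 / 2) * fps_const 2) * f"
    by (simp flip: assms(1) add: mult_ac)
  moreover have "upow (-1) * upow 1 = 1" by (simp flip: upow_add)
  ultimately show ?thesis by simp
qed

lemma famlau_minus_one:
  assumes "cf W 0 0 = 1" "\<And>a b. cf W a b \<in> lau 0"
  shows "famlau 3 (W - 1) i j"
proof (cases "i = 0 \<and> j = 0")
  case True
  then show ?thesis using assms(1) by (simp add: famlau_def cf_diff cf_1 lau_zero)
next
  case False
  then have "cf (W - 1) i j = cf W i j" by (simp add: cf_diff cf_1)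
  moreover have "3 - 3 * int i - 4 * int j \<le> 0" using False by auto
  ultimately show ?thesis using lau_mono [OF assms(2)] by (simp add: famlau_def)
qed

lemma famlau_one_minus:
  assumes "famlead 1 c Y i j"
  shows "famlau 0 (1 - Y) i j"
proof -
  have "cf Y i j \<in> lau (0 - 3 * int i - 4 * int j)"
    using lau_mono [OF lead_lau] assms by (fastforce simp: famlead_def)
  then show ?thesis
    unfolding famlau_def cf_diff using lau_monom [of 0 0 1]
    by (intro lau_diff) (auto simp: cf_1 lau_zero intro: lau_mono)
qed

text \<open>At \<open>(0, 0)\<close> the equation reads \<open>Y\<^sup>2 = u\<^sup>2\<close>, and the constant coefficient selects \<open>Y = u\<close>. At other indices the
terms with the unknown are \<open>2 u Y\<close>; the factor \<open>W - 1\<close> has degree at least 3 and does not reach the lowest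
order.\<close>

lemma Y_lead:
  fixes Y0 Y1 W :: biseries
  assumes eq: "Y1 - Y0 = Y1 * Y0 - (1 - 4 * fps_X) + (W - 1) * ((1 - Y1) * (1 - Y0))"
    and sh: "shifted d Y0 Y1"
    and const: "fps_nth (cf Y0 0 0) 0 = 1"
    and W0: "cf W 0 0 = 1" and W: "\<And>a b. cf W a b \<in> lau 0"
  shows "cf Y0 0 0 = upow 1" and "famlead 1 yc Y0 a b"
proof -
  have cfX: "cf (1 - 4 * fps_X) a b = (if a = 0 \<and> b = 0 then upow 2 else 0)" for a b
    by (rule fps_ext) (auto simp: cf_def upow_2 fps_numeral_fps_const fps_X_def)
  have same: "cf Y1 0 0 = cf Y0 0 0" using sh by (simp add: shifted_def)
  have conv0: "conv f g 0 0 = f 0 0 * g 0 0" for f g :: "nat \<Rightarrow> nat \<Rightarrow> real fps"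
    by (simp add: conv_def)
  have "cf Y1 0 0 - cf Y0 0 0 = cf Y1 0 0 * cf Y0 0 0 - upow 2 + (cf W 0 0 - cf 1 0 0) * cf ((1 - Y1) * (1 - Y0)) 0 0"
    using arg_cong [OF eq, of "\<lambda>F. cf F 0 0"]
    by (simp only: cf_diff [of Y1 Y0] cf_diff [of "Y1 * Y0"] cf_diff [of W] cf_add cf_mult [of Y1]
        cf_mult [of "W - 1"] conv0 cfX) simp
  then have "cf Y0 0 0 * cf Y0 0 0 = upow 1 * upow 1"
    by (simp add: same W0 cf_1 upow_even)
  then have "(cf Y0 0 0 - upow 1) * (cf Y0 0 0 + upow 1) = 0"
    by (simp add: algebra_simps)
  moreover have "fps_nth (cf Y0 0 0 + upow 1) 0 \<noteq> 0"
    using const by (simp add: upow_def)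
  then have "cf Y0 0 0 + upow 1 \<noteq> 0" by (metis fps_zero_nth)
  ultimately show Y00: "cf Y0 0 0 = upow 1" by simp
  note W1 = famlau_minus_one [OF W0 W]
  show "famlead 1 yc Y0 a b"
  proof (induction a b rule: lexless_induct)
    case (less a b)
    show ?case
    proof (cases "(a, b) = (0, 0)")
      case True
      then show ?thesis using lead_upow [of 1] by (simp add: famlead_def Y00)
    next
      case False
      have Y1: "famlead 1 yc Y1 i j" if "lexless (i, j) (a, b)" for i j
        using less that lexless_trans by (intro shift_famlead [OF sh]) blast+
      have "famlau (3 + 0) ((W - 1) * ((1 - Y1) * (1 - Y0))) a b"
      proof (rule famlau_mult_zero)
        show "cf (W - 1) 0 0 = 0" by (simp add: cf_diff W0 cf_1)
        show "famlau 3 (W - 1) i j" for i j by (rule W1)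
        fix i j assume ij: "lexless (i, j) (a, b)"
        have "famlau (0 + 0) ((1 - Y1) * (1 - Y0)) i j"
        proof (intro famlau_mult famlau_one_minus)
          fix i' j' assume "i' \<le> i" "j' \<le> j"
          then have "lexless (i', j') (a, b)" using ij by (auto simp: lexless_def)
          then show "famlead 1 yc Y1 i' j'" "famlead 1 yc Y0 i' j'"
            using Y1 less by blast+
        qed
        then show "famlau 0 ((1 - Y1) * (1 - Y0)) i j" by simp
      qed
      then have Z: "lead (2 - 3 * int a - 4 * int b) 0 (cf ((W - 1) * ((1 - Y1) * (1 - Y0))) a b)"
        unfolding famlau_def by (rule lead_zero) simp
      define D where "D = cf Y1 a b - cf Y0 a b"
      have D: "lead (2 - 3 * int a - 4 * int b) (Lop 1 yc a b) D"
        using shift_diff [OF sh _ less False] by (simp add: D_def)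
      have uD: "lead (2 - 3 * int a - 4 * int b) 0 (upow 1 * D)"
        using lead_upow_mult [OF D, of 1] lead_lau by (intro lead_zero [of _ "2 - 3 * int a - 4 * int b + 1"]) auto
      have C: "lead (2 - 3 * int a - 4 * int b) (convI yc yc a b) (convI (cf Y1) (cf Y0) a b)"
        using lead_convI [OF Y1 less] by simp
      have "cf (Y1 - Y0) a b = cf (Y1 * Y0 - (1 - 4 * fps_X) + (W - 1) * ((1 - Y1) * (1 - Y0))) a b"
        by (simp only: eq)
      then have "D = cf (Y1 * Y0) a b - cf (1 - 4 * fps_X) a b
          + cf ((W - 1) * ((1 - Y1) * (1 - Y0))) a b"
        by (simp only: D_def cf_add cf_diff [of Y1 Y0] cf_diff [of "Y1 * Y0"])
      then have "D = upow 1 * cf Y0 a b + cf Y1 a b * upow 1 + convI (cf Y1) (cf Y0) a b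
          + cf ((W - 1) * ((1 - Y1) * (1 - Y0))) a b"
        unfolding cfX cf_mult [of Y1] conv_split [OF False] using False by (auto simp add: same Y00)
      moreover have "cf Y1 a b = cf Y0 a b + D" by (simp add: D_def)
      ultimately have e: "fps_const 2 * upow 1 * cf Y0 a b = D - upow 1 * D - convI (cf Y1) (cf Y0) a b
          - cf ((W - 1) * ((1 - Y1) * (1 - Y0))) a b"
        by (simp add: algebra_simps flip: numeral_fps_const)
      have "lead (2 - 3 * int a - 4 * int b) (Lop 1 yc a b - 0 - convI yc yc a b - 0)
         (D - upow 1 * D - convI (cf Y1) (cf Y0) a b - cf ((W - 1) * ((1 - Y1) * (1 - Y0))) a b)"
        by (intro lead_diff D uD C Z)
      then have "lead (1 - 3 * int a - 4 * int b + 1) (2 * yc a b)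
         (D - upow 1 * D - convI (cf Y1) (cf Y0) a b - cf ((W - 1) * ((1 - Y1) * (1 - Y0))) a b)"
        using False by (simp add: yc_rec algebra_simps)
      then show ?thesis
        unfolding famlead_def by (rule lead_solve [OF e])
    qed
  qed
qed


text \<open>The unknown cancels in \<open>J0 - J1\<close> up to the first-order effect of raising the level, and appears once in each
of the two products.\<close>

lemma J_lead:
  fixes Y0 Y2 J0 J1 W1 W2 :: biseries
  assumes eq: "J0 - J1 + Y2 * J0 + Y0 * J1 =
      2 * W1 + (W2 - 1) * ((1 - Y2) * J0) + (W1 - 1) * ((1 - Y0) * J1)"
    and sh: "shifted d J0 J1"
    and Y0: "\<And>a b. famlead 1 yc Y0 a b" and Y2: "\<And>a b. famlead 1 yc Y2 a b"
    and Y00: "cf Y0 0 0 = upow 1" "cf Y2 0 0 = upow 1"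
    and W1: "cf W1 0 0 = 1" "\<And>a b. cf W1 a b \<in> lau 0"
    and W2: "cf W2 0 0 = 1" "\<And>a b. cf W2 a b \<in> lau 0"
  shows "famlead (-1) jc J0 a b"
proof (induction a b rule: lexless_induct)
  case (less a b)
  have same: "cf J1 0 0 = cf J0 0 0" using sh by (simp add: shifted_def)
  have cfeq: "cf J0 a b - cf J1 a b + cf (Y2 * J0) a b + cf (Y0 * J1) a b =
      fps_const 2 * cf W1 a b + cf ((W2 - 1) * ((1 - Y2) * J0)) a b + cf ((W1 - 1) * ((1 - Y0) * J1)) a b"
    using arg_cong [OF eq, of "\<lambda>F. cf F a b"] by (simp only: cf_add cf_diff [of J0] cf_numeral_mult)
  show ?case
  proof (cases "(a, b) = (0, 0)")
    case True
    then have "fps_const 2 * upow 1 * cf J0 0 0 = fps_const 2 * upow 0"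
      using cfeq by (simp add: cf_mult conv_def cf_diff cf_1 same Y00 W1 W2 flip: numeral_fps_const)
    moreover have "lead (-1 + 1) (2 * 1) (fps_const 2 * upow 0)"
      using lead_cmult [OF lead_upow, of 0 2] by simp
    ultimately have "lead (-1) 1 (cf J0 0 0)" by (rule lead_solve)
    then show ?thesis using True by (simp add: famlead_def)
  next
    case False
    let ?m = "- 3 * int a - 4 * int b"
    have J1: "famlead (-1) jc J1 i j" if "lexless (i, j) (a, b)" for i j
      using less that lexless_trans by (intro shift_famlead [OF sh]) (simp, blast)
    have Z: "lead ?m 0 (cf ((W - 1) * ((1 - Y) * J)) a b)"
      if W: "cf W 0 0 = 1" "\<And>a b. cf W a b \<in> lau 0" and Y: "\<And>i j. famlead 1 yc Y i j"
        and J: "\<And>i j. lexless (i, j) (a, b) \<Longrightarrow> famlead (-1) jc J i j" for W Y J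
    proof -
      have "famlau (3 + (0 + -1)) ((W - 1) * ((1 - Y) * J)) a b"
      proof (rule famlau_mult_zero)
        show "cf (W - 1) 0 0 = 0" by (simp add: cf_diff W cf_1)
        show "famlau 3 (W - 1) i j" for i j by (rule famlau_minus_one [OF W])
        fix i j assume ij: "lexless (i, j) (a, b)"
        show "famlau (0 + -1) ((1 - Y) * J) i j"
        proof (intro famlau_mult famlau_one_minus [OF Y] famlead_imp_famlau [OF J])
          fix i' j' assume "i' \<le> i" "j' \<le> j"
          then show "lexless (i', j') (a, b)" using ij by (auto simp: lexless_def)
        qed
      qed
      then show ?thesis unfolding famlau_def by (rule lead_zero) simp
    qed
    define D where "D = cf J1 a b - cf J0 a b"
    have D: "lead ?m (Lop (-1) jc a b) D"
      using shift_diff [OF sh _ less False] by (simp add: D_def)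
    have uD: "lead ?m 0 (upow 1 * D)"
      using lead_upow_mult [OF D, of 1] lead_lau by (intro lead_zero [of _ "?m + 1"]) auto
    have C0: "lead ?m (convI yc jc a b) (convI (cf Y2) (cf J0) a b)"
      using lead_convI [OF Y2 less] by simp
    have C1: "lead ?m (convI yc jc a b) (convI (cf Y0) (cf J1) a b)"
      using lead_convI [OF Y0 J1] by simp
    have Yj: "lead ?m (yc a b) (cf Y a b * cf J0 0 0)" if "famlead 1 yc Y a b" for Y
    proof -
      have "lexless (0, 0) (a, b)" using False by (auto simp: lexless_def)
      then have "lead (1 - 3 * int a - 4 * int b + -1) (yc a b * jc 0 0) (cf Y a b * cf J0 0 0)"
        using that less [of 0 0] by (intro lead_mult) (simp_all add: famlead_def)
      then show ?thesis by simp
    qed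
    have Wab: "lead ?m 0 (fps_const 2 * cf W1 a b)"
      using False by (intro lead_zero [of _ 0] lau_cmult W1) auto
    define R where "R = D - upow 1 * D - convI (cf Y2) (cf J0) a b - convI (cf Y0) (cf J1) a b
        - cf Y2 a b * cf J0 0 0 - cf Y0 a b * cf J0 0 0 + fps_const 2 * cf W1 a b
        + cf ((W2 - 1) * ((1 - Y2) * J0)) a b + cf ((W1 - 1) * ((1 - Y0) * J1)) a b"
    have J1D: "cf J1 a b = cf J0 a b + D" by (simp add: D_def)
    have "cf (Y2 * J0) a b = upow 1 * cf J0 a b + cf Y2 a b * cf J0 0 0 + convI (cf Y2) (cf J0) a b"
      and "cf (Y0 * J1) a b = upow 1 * cf J1 a b + cf Y0 a b * cf J0 0 0 + convI (cf Y0) (cf J1) a b"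
      unfolding cf_mult conv_split [OF False] by (simp_all add: Y00 same)
    then have e: "fps_const 2 * upow 1 * cf J0 a b = R"
      using cfeq unfolding R_def J1D numeral_fps_const [symmetric] by algebra
    have "lead ?m (Lop (-1) jc a b - 0 - convI yc jc a b - convI yc jc a b - yc a b - yc a b + 0 + 0 + 0) R"
      unfolding R_def by (intro lead_add lead_diff D uD C0 C1 Z Yj Wab Y0 Y2 W1 W2 J1 less)
    then have "lead (-1 - 3 * int a - 4 * int b + 1) (2 * jc a b) R"
      using False by (simp add: jc_rec algebra_simps)
    then show ?thesis
      unfolding famlead_def by (rule lead_solve [OF e])
  qed
qed

lemma G_lead:
  fixes Y0 Y1 J0 G W :: biseries
  assumes eq: "(Y0 + Y1 - (W - 1) * (1 - Y1)) * G = 2 * J0"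
    and Y0: "\<And>a b. famlead 1 yc Y0 a b" and Y1: "\<And>a b. famlead 1 yc Y1 a b"
    and J0: "\<And>a b. famlead (-1) jc J0 a b"
    and Y00: "cf Y0 0 0 = upow 1" "cf Y1 0 0 = upow 1"
    and W: "cf W 0 0 = 1" "\<And>a b. cf W a b \<in> lau 0"
  shows "famlead (-2) gc G a b"
proof -
  define D where "D = Y0 + Y1 - (W - 1) * (1 - Y1)"
  have D: "famlead 1 (\<lambda>a b. 2 * yc a b) D a b" for a b
  proof -
    have "famlau (3 + 0) ((W - 1) * (1 - Y1)) a b"
      by (intro famlau_mult famlau_minus_one W famlau_one_minus [OF Y1])
    then have "lead (1 - 3 * int a - 4 * int b) 0 (cf ((W - 1) * (1 - Y1)) a b)"
      unfolding famlau_def by (rule lead_zero) simp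
    then have "lead (1 - 3 * int a - 4 * int b) (yc a b + yc a b - 0) (cf D a b)"
      unfolding D_def cf_diff [of "Y0 + Y1"] cf_add using Y0 Y1
      by (intro lead_diff lead_add) (simp_all add: famlead_def)
    then show ?thesis by (simp add: famlead_def)
  qed
  have D00: "cf D 0 0 = fps_const 2 * upow 1"
    by (simp add: D_def cf_diff cf_add cf_mult conv_def W cf_1 Y00 flip: numeral_fps_const)
  have convI2: "convI (\<lambda>a b. 2 * yc a b) gc a b = 2 * convI yc gc a b" for a b
    unfolding convI_def sum_distrib_left by (intro sum.cong) auto
  have cfeq: "cf (D * G) a b = fps_const 2 * cf J0 a b" for a b
    using eq unfolding D_def by (simp add: cf_numeral_mult)
  show ?thesis
  proof (induction a b rule: lexless_induct)
    case (less a b)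
    have J2: "lead (-2 - 3 * int a - 4 * int b + 1) (2 * jc a b) (fps_const 2 * cf J0 a b)"
    proof -
      have "-1 - 3 * int a - 4 * int b = -2 - 3 * int a - 4 * int b + 1" by simp
      then show ?thesis
        using lead_cmult [OF J0 [of a b, unfolded famlead_def], of 2] by metis
    qed
    show ?case
    proof (cases "(a, b) = (0, 0)")
      case True
      have "fps_const 2 * upow 1 * cf G 0 0 = fps_const 2 * cf J0 0 0"
        using cfeq [of 0 0] by (simp add: cf_mult conv_def D00)
      moreover have "lead (-2 + 1) (2 * 1) (fps_const 2 * cf J0 0 0)"
        using J2 True by simp
      ultimately have "lead (-2) 1 (cf G 0 0)" by (rule lead_solve)
      then show ?thesis using True by (simp add: famlead_def)
    next
      case False
      then have "lexless (0, 0) (a, b)" by (auto simp: lexless_def)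
      then have DG: "lead (1 - 3 * int a - 4 * int b + -2) (2 * yc a b * gc 0 0) (cf D a b * cf G 0 0)"
        using D less [of 0 0] by (intro lead_mult) (simp_all add: famlead_def)
      have C: "lead (1 + -2 - 3 * int a - 4 * int b) (2 * convI yc gc a b) (convI (cf D) (cf G) a b)"
        using lead_convI [OF D less] by (simp add: convI2)
      have e: "fps_const 2 * upow 1 * cf G a b =
          fps_const 2 * cf J0 a b - cf D a b * cf G 0 0 - convI (cf D) (cf G) a b"
        using cfeq [of a b] unfolding cf_mult conv_split [OF False] D00 by (simp add: algebra_simps)
      have "lead (-2 - 3 * int a - 4 * int b + 1) (2 * jc a b - 2 * yc a b * gc 0 0 - 2 * convI yc gc a b)
         (fps_const 2 * cf J0 a b - cf D a b * cf G 0 0 - convI (cf D) (cf G) a b)"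
      proof (intro lead_diff J2)
        have i: "1 - 3 * int a - 4 * int b + -2 = -2 - 3 * int a - 4 * int b + 1"
          "1 + -2 - 3 * int a - 4 * int b = -2 - 3 * int a - 4 * int b + 1" by simp_all
        show "lead (-2 - 3 * int a - 4 * int b + 1) (2 * yc a b * gc 0 0) (cf D a b * cf G 0 0)"
          using DG unfolding i(1) .
        show "lead (-2 - 3 * int a - 4 * int b + 1) (2 * convI yc gc a b) (convI (cf D) (cf G) a b)"
          using C unfolding i(2) .
      qed
      moreover have "2 * jc a b - 2 * yc a b * gc 0 0 - 2 * convI yc gc a b = 2 * gc a b"
        using gc_rec [OF False] by simp
      ultimately show ?thesis
        unfolding famlead_def by (intro lead_solve [OF e]) metis
    qed
  qed
qed

section \<open>Exponential weights\<close>

text \<open>The series \<open>exp(A \<alpha> + C \<beta>)\<close>.\<close>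

definition E2 :: "real \<Rightarrow> real \<Rightarrow> real fps fps" where
  "E2 A C = Abs_fps (\<lambda>b. Abs_fps (\<lambda>a. A ^ a / fact a * (C ^ b / fact b)))"

lemma exp_conv: "(\<Sum>i\<le>n. x ^ i / fact i * (y ^ (n - i) / fact (n - i))) = (x + y) ^ n / (fact n :: real)"
proof -
  have "(fps_exp x * fps_exp y) $ n = fps_exp (x + y) $ n" by (simp add: fps_exp_add_mult)
  then show ?thesis by (simp add: fps_mult_nth atLeast0AtMost)
qed

lemma E2_mult: "E2 A C * E2 A' C' = E2 (A + A') (C + C')"
proof (rule fps_ext, rule fps_ext)
  fix b a
  have "(E2 A C * E2 A' C') $ b $ a =
      (\<Sum>j\<le>b. \<Sum>i\<le>a. (A ^ i / fact i * (A' ^ (a - i) / fact (a - i))) * (C ^ j / fact j * (C' ^ (b - j) / fact (b - j))))"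
    by (simp add: fps_mult_nth fps_sum_nth E2_def atLeast0AtMost mult_ac)
  also have "\<dots> = (\<Sum>i\<le>a. A ^ i / fact i * (A' ^ (a - i) / fact (a - i))) * (\<Sum>j\<le>b. C ^ j / fact j * (C' ^ (b - j) / fact (b - j)))"
    unfolding sum_product by (subst sum.swap) simp
  also have "\<dots> = E2 (A + A') (C + C') $ b $ a"
    unfolding exp_conv by (simp add: E2_def)
  finally show "(E2 A C * E2 A' C') $ b $ a = E2 (A + A') (C + C') $ b $ a" .
qed

lemma E2_0: "E2 0 0 = 1"
  by (rule fps_ext, rule fps_ext) (simp add: E2_def power_0_left)

text \<open>Sums of exponentials that depend on the level \<open>k\<close> as total weights of finitely many blocks of length \<open>n\<close> do: with
\<open>A\<close> and \<open>C\<close> the sums of the letters and of their squares at level 0, adding \<open>k\<close> to every letter gives the displayed exponents.\<close>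

inductive comb :: "nat \<Rightarrow> (nat \<Rightarrow> real fps fps) \<Rightarrow> bool" for n where
  comb_zero: "comb n (\<lambda>k. 0)"
| comb_add: "comb n f \<Longrightarrow> comb n (\<lambda>k. E2 (A + real k * n) (C + 2 * real k * A + (real k)\<^sup>2 * n) + f k)"

lemma comb_plus: "comb n f \<Longrightarrow> comb n g \<Longrightarrow> comb n (\<lambda>k. f k + g k)"
proof (induction rule: comb.induct)
  case (comb_add f A C)
  then show ?case using comb.comb_add [of n "\<lambda>k. f k + g k" A C] by (simp add: add.assoc)
qed simp

lemma comb_sum: "(\<And>i. i \<in> S \<Longrightarrow> comb n (f i)) \<Longrightarrow> comb n (\<lambda>k. \<Sum>i\<in>S. f i k)"
  by (induction S rule: infinite_finite_induct) (auto intro: comb_plus comb_zero)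

lemma comb_E2_mult:
  "comb m g \<Longrightarrow> comb (n + m) (\<lambda>k. E2 (A + real k * n) (C + 2 * real k * A + (real k)\<^sup>2 * n) * g k)"
proof (induction rule: comb.induct)
  case comb_zero
  then show ?case by (simp add: comb.comb_zero)
next
  case (comb_add g A' C')
  have "E2 (A + real k * n) (C + 2 * real k * A + (real k)\<^sup>2 * n) * (E2 (A' + real k * m) (C' + 2 * real k * A' + (real k)\<^sup>2 * m) + g k)
     = E2 ((A + A') + real k * real (n + m)) ((C + C') + 2 * real k * (A + A') + (real k)\<^sup>2 * real (n + m))
       + E2 (A + real k * n) (C + 2 * real k * A + (real k)\<^sup>2 * n) * g k" for k
    unfolding distrib_left E2_mult by (simp add: algebra_simps)
  then show ?case using comb.comb_add [OF comb_add.IH, of "A + A'" "C + C'"] by simp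
qed

lemma comb_mult: "comb n f \<Longrightarrow> comb m g \<Longrightarrow> comb (n + m) (\<lambda>k. f k * g k)"
proof (induction rule: comb.induct)
  case (comb_add f A C)
  then show ?case
    unfolding distrib_right by (intro comb_plus comb_E2_mult) auto
qed (simp add: comb_zero)

lemma comb_Suc: "comb n f \<Longrightarrow> comb n (\<lambda>k. f (Suc k))"
proof (induction rule: comb.induct)
  case (comb_add f A C)
  have "E2 (A + real (Suc k) * n) (C + 2 * real (Suc k) * A + (real (Suc k))\<^sup>2 * n) =
     E2 ((A + n) + real k * n) ((C + 2 * A + n) + 2 * real k * (A + n) + (real k)\<^sup>2 * n)" for k
    by (simp add: algebra_simps power2_eq_square)
  then show ?case using comb.comb_add [OF comb_add.IH, of "A + n" "C + 2 * A + n"] by simp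
qed (simp add: comb_zero)

lemma comb_1: "comb 0 (\<lambda>k. 1)"
  using comb_add [OF comb_zero, of 0 0 0] by (simp add: E2_0)

definition wt :: "nat \<Rightarrow> real fps fps" where
  "wt v = E2 (real v) ((real v)\<^sup>2)"

lemma wt_0: "wt 0 = 1"
  by (simp add: wt_def E2_0)

lemma comb_wt: "comb 1 wt"
  using comb_add [OF comb_zero, of 1 0 0] unfolding wt_def by simp

lemma comb_cc: "comb n (\<lambda>k. cc wt k n)"
proof (induction n rule: less_induct)
  case (less n)
  show ?case
  proof (cases n)
    case 0
    then show ?thesis by (simp add: comb_1)
  next
    case (Suc m)
    have "comb m (\<lambda>k. cc wt (Suc k) i * cc wt k (m - i))" if "i \<le> m" for i
      using comb_mult [OF comb_Suc [OF less, of i] less [of "m - i"]] that Suc by simp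
    then have "comb m (\<lambda>k. \<Sum>i\<le>m. cc wt (Suc k) i * cc wt k (m - i))"
      by (intro comb_sum) simp
    from comb_mult [OF comb_Suc [OF comb_wt] this] show ?thesis by (simp add: Suc)
  qed
qed

lemma comb_jj: "comb (Suc n) (\<lambda>k. jj wt k n)"
proof (induction n rule: less_induct)
  case (less n)
  show ?case
  proof (cases n)
    case 0
    then show ?thesis using comb_Suc [OF comb_wt] by simp
  next
    case (Suc m)
    have CC: "comb i (\<lambda>k. (Cf wt (Suc k) * Cf wt k) $ i)" for i
    proof -
      have "comb i (\<lambda>k. cc wt (Suc k) l * cc wt k (i - l))" if "l \<le> i" for l
        using comb_mult [OF comb_Suc [OF comb_cc [of l]] comb_cc [of "i - l"]] that by simp
      then have "comb i (\<lambda>k. \<Sum>l\<le>i. cc wt (Suc k) l * cc wt k (i - l))"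
        by (intro comb_sum) simp
      then show ?thesis by (simp add: fps_mult_nth Cf_def atLeast0AtMost)
    qed
    have "comb (Suc m) (\<lambda>k. (Cf wt (Suc k) * Cf wt k) $ i * jj wt (Suc k) (m - i))" if "i \<le> m" for i
      using comb_mult [OF CC [of i] comb_Suc [OF less [of "m - i"]]] that Suc by simp
    then have "comb (Suc m) (\<lambda>k. \<Sum>i\<le>m. (Cf wt (Suc k) * Cf wt k) $ i * jj wt (Suc k) (m - i))"
      by (intro comb_sum) simp
    then have "comb (Suc m) (\<lambda>k. cc wt (Suc k) (Suc m) + (\<Sum>i\<le>m. (Cf wt (Suc k) * Cf wt k) $ i * jj wt (Suc k) (m - i)))"
      by (intro comb_plus comb_Suc [OF comb_cc])
    from comb_mult [OF comb_Suc [OF comb_wt] this] show ?thesis by (simp add: Suc)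
  qed
qed

text \<open>The binomial expansion behind \<open>shift_sum\<close>.\<close>

lemma E2_shift:
  "E2 (A + n) (C + 2 * A + n) $ b $ a = (\<Sum>(i, j, l)\<in>trip a b.
     of_nat (a - i + l choose l) * 2 ^ l / (fact i * fact j) * n ^ (i + j) * E2 A C $ (b - j - l) $ (a - i + l))"
proof -
  have trip: "trip a b = (SIGMA i:{..a}. SIGMA j:{..b}. {..b - j})"
    by (auto simp: trip_def)
  have termeq: "of_nat (a - i + l choose l) * 2 ^ l / (fact i * fact j) * n ^ (i + j) * E2 A C $ (b - j - l) $ (a - i + l)
     = n ^ i / fact i * (A ^ (a - i) / fact (a - i)) * (n ^ j / fact j * ((2 * A) ^ l / fact l * (C ^ (b - j - l) / fact (b - j - l))))"
    for i j l
  proof -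
    have "(of_nat (a - i + l choose l) :: real) = fact (a - i + l) / (fact l * fact (a - i))"
      by (subst binomial_fact) auto
    then show ?thesis by (simp add: E2_def power_add power_mult_distrib field_simps)
  qed
  have "(\<Sum>(i, j, l)\<in>trip a b. of_nat (a - i + l choose l) * 2 ^ l / (fact i * fact j) * n ^ (i + j) * E2 A C $ (b - j - l) $ (a - i + l))
     = (\<Sum>i\<le>a. \<Sum>j\<le>b. \<Sum>l\<le>b - j. n ^ i / fact i * (A ^ (a - i) / fact (a - i)) * (n ^ j / fact j * ((2 * A) ^ l / fact l * (C ^ (b - j - l) / fact (b - j - l)))))"
    unfolding termeq trip by (simp add: sum.Sigma)
  also have "\<dots> = (\<Sum>i\<le>a. n ^ i / fact i * (A ^ (a - i) / fact (a - i)) * (\<Sum>j\<le>b. n ^ j / fact j * (\<Sum>l\<le>b - j. (2 * A) ^ l / fact l * (C ^ (b - j - l) / fact (b - j - l)))))"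
    by (simp only: sum_distrib_left)
  also have "\<dots> = (n + A) ^ a / fact a * ((n + (2 * A + C)) ^ b / fact b)"
    by (simp only: exp_conv sum_distrib_right [symmetric])
  finally show ?thesis by (simp add: E2_def add_ac)
qed

lemma comb_shift:
  "comb n f \<Longrightarrow> f (Suc k) $ b $ a = (\<Sum>(i, j, l)\<in>trip a b.
     of_nat (a - i + l choose l) * 2 ^ l / (fact i * fact j) * real n ^ (i + j) * f k $ (b - j - l) $ (a - i + l))"
proof (induction rule: comb.induct)
  case comb_zero
  then show ?case by simp
next
  case (comb_add f A C)
  let ?A = "A + real k * n" and ?C = "C + 2 * real k * A + (real k)\<^sup>2 * n"
  have "E2 (A + real (Suc k) * n) (C + 2 * real (Suc k) * A + (real (Suc k))\<^sup>2 * n) = E2 (?A + n) (?C + 2 * ?A + n)"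
    by (simp add: algebra_simps power2_eq_square)
  then show ?case
    unfolding fps_add_nth comb_add.IH
    by (simp only: E2_shift) (simp add: sum.distrib [symmetric] case_prod_unfold algebra_simps)
qed

text \<open>The offset \<open>d\<close> is the difference between the length of the blocks and the exponent of \<open>x\<close>.\<close>

lemma shifted_comb:
  fixes F :: "nat \<Rightarrow> biseries"
  assumes "\<And>n. (\<exists>m. comb m (\<lambda>k. F k $ n) \<and> real m = real n + d) \<or> (\<forall>k. F k $ n = 0)"
  shows "shifted d (F k) (F (Suc k))"
proof -
  have pow: "(theta d ^^ p) f $ n = (real n + d) ^ p * f $ n" for p f n
    by (induction p arbitrary: n) (auto simp: theta_def)
  have "cf (F (Suc k)) a b = shift_sum d (F k) a b" for a b
  proof (rule fps_ext)
    fix n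
    have "F (Suc k) $ n $ b $ a = (\<Sum>(i, j, l)\<in>trip a b.
        of_nat (a - i + l choose l) * 2 ^ l / (fact i * fact j) * (real n + d) ^ (i + j) * F k $ n $ (b - j - l) $ (a - i + l))"
      using assms [of n]
    proof
      assume "\<exists>m. comb m (\<lambda>k. F k $ n) \<and> real m = real n + d"
      then obtain m where m: "comb m (\<lambda>k. F k $ n)" "real m = real n + d" by blast
      from comb_shift [OF m(1), of k b a] show ?thesis unfolding m(2) .
    qed simp
    then show "cf (F (Suc k)) a b $ n = shift_sum d (F k) a b $ n"
      by (simp add: shift_sum_def shift_term_def cf_def fps_sum_nth case_prod_unfold pow mult_ac)
  qed
  moreover have "shift_sum d (F k) 0 0 = cf (F k) 0 0"
  proof -
    have "trip 0 0 = {(0, 0, 0)}" by (auto simp: trip_def)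
    then show ?thesis by (simp add: shift_sum_def shift_term_def)
  qed
  ultimately show ?thesis by (simp add: shifted_def lau_zero)
qed

lemma shifted_Tf: "shifted (-1) (Tf wt k) (Tf wt (Suc k))"
proof (rule shifted_comb)
  fix n
  show "(\<exists>m. comb m (\<lambda>k. Tf wt k $ n) \<and> real m = real n + -1) \<or> (\<forall>k. Tf wt k $ n = 0)"
  proof (cases n)
    case (Suc m)
    then have "comb m (\<lambda>k. Tf wt k $ n)" using comb_cc [of m] by (simp add: Tf_def Cf_def)
    then show ?thesis using Suc by (intro disjI1 exI [of _ m]) simp
  qed (simp add: Tf_def)
qed

lemma shifted_Jf: "shifted 1 (Jf wt k) (Jf wt (Suc k))"
proof (rule shifted_comb)
  fix n
  show "(\<exists>m. comb m (\<lambda>k. Jf wt k $ n) \<and> real m = real n + 1) \<or> (\<forall>k. Jf wt k $ n = 0)"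
    using comb_jj [of n] by (intro disjI1 exI [of _ "Suc n"]) (auto simp: Jf_def)
qed

lemma cf_wt_0: "cf (fps_const (wt v)) 0 0 = 1"
  by (rule fps_ext) (simp add: cf_def wt_def E2_def)

lemma cf_wt_lau: "cf (fps_const (wt v)) a b \<in> lau 0"
proof -
  have "cf (fps_const (wt v)) a b = fps_const (wt v $ b $ a) * upow 0"
    by (rule fps_ext) (simp add: cf_def)
  then show ?thesis using lau_monom by (metis order_refl)
qed

definition Yf :: "nat \<Rightarrow> biseries" where
  "Yf k = 1 - 2 * Tf wt k"

lemma Yf_eq: "Yf (Suc k) - Yf k = Yf (Suc k) * Yf k - (1 - 4 * fps_X)
    + (fps_const (wt (Suc k)) - 1) * ((1 - Yf (Suc k)) * (1 - Yf k))"
proof -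
  let ?t = "Tf wt k" and ?t' = "Tf wt (Suc k)" and ?w = "fps_const (wt (Suc k))"
  have "Yf (Suc k) * Yf k - (1 - 4 * fps_X) + (?w - 1) * ((1 - Yf (Suc k)) * (1 - Yf k)) =
    4 * (fps_X + ?w * ?t' * ?t) - 2 * ?t - 2 * ?t'"
    unfolding Yf_def by (simp add: algebra_simps)
  also have "fps_X + ?w * ?t' * ?t = ?t" by (rule Tf_eq [symmetric])
  finally show ?thesis by (simp add: Yf_def)
qed

lemma Yf_lead: "cf (Yf k) 0 0 = upow 1" "famlead 1 yc (Yf k) a b"
proof -
  have sh: "shifted (-1) (Yf k) (Yf (Suc k))"
    unfolding Yf_def by (rule shifted_one_minus_twice [OF shifted_Tf])
  have const: "cf (Yf k) 0 0 $ 0 = 1"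
    by (simp add: Yf_def Tf_def cf_def)
  show "cf (Yf k) 0 0 = upow 1" "famlead 1 yc (Yf k) a b"
    using Y_lead [OF Yf_eq sh const cf_wt_0 cf_wt_lau] by blast+
qed

lemma Jf_lead: "famlead (-1) jc (Jf wt 0) a b"
proof (rule J_lead [OF _ shifted_Jf Yf_lead(2) Yf_lead(2) Yf_lead(1) Yf_lead(1) cf_wt_0 cf_wt_lau cf_wt_0 cf_wt_lau])
  let ?w1 = "fps_const (wt (Suc 0))" and ?w2 = "fps_const (wt 2)"
  let ?J0 = "Jf wt 0" and ?J1 = "Jf wt (Suc 0)"
  have "?J0 - ?J1 + Yf 2 * ?J0 + Yf 0 * ?J1
      - (?w2 - 1) * ((1 - Yf 2) * ?J0) - (?w1 - 1) * ((1 - Yf 0) * ?J1)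
     = 2 * ?J0 - 2 * (?w2 * Tf wt 2 * ?J0 + ?w1 * Tf wt 0 * ?J1)"
    unfolding Yf_def by (simp add: algebra_simps)
  also have "\<dots> = 2 * ?w1"
  proof -
    have "?J0 = ?w1 + ?w2 * Tf wt 2 * ?J0 + ?w1 * Tf wt 0 * ?J1"
      using Jf_Tf [of wt 0] by (simp only: add_0 One_nat_def)
    moreover have "x - (p + q) = z" if "x = z + p + q" for x p q z :: biseries
      using that by simp
    ultimately have J: "?J0 - (?w2 * Tf wt 2 * ?J0 + ?w1 * Tf wt 0 * ?J1) = ?w1" by blast
    show ?thesis unfolding right_diff_distrib [symmetric] J ..
  qed
  finally have fin: "?J0 - ?J1 + Yf 2 * ?J0 + Yf 0 * ?J1
      - (?w2 - 1) * ((1 - Yf 2) * ?J0) - (?w1 - 1) * ((1 - Yf 0) * ?J1) = 2 * ?w1" .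
  have arr: "x = z + p + q" if "x - p - q = z" for x p q z :: biseries
    using that by (simp add: algebra_simps)
  show "?J0 - ?J1 + Yf 2 * ?J0 + Yf 0 * ?J1 = 2 * ?w1 + (?w2 - 1) * ((1 - Yf 2) * ?J0)
      + (?w1 - 1) * ((1 - Yf 0) * ?J1)"
    by (rule arr [OF fin])
qed

lemma Gf_lead: "famlead (-2) gc (Gf wt) a b"
proof (rule G_lead [OF _ Yf_lead(2) Yf_lead(2) Jf_lead Yf_lead(1) Yf_lead(1) cf_wt_0 cf_wt_lau])
  let ?w1 = "fps_const (wt (Suc 0))"
  have "(Yf 0 + Yf (Suc 0) - (?w1 - 1) * (1 - Yf (Suc 0))) = 2 * (1 - ?w1 * Tf wt (Suc 0) - Tf wt 0)"
    unfolding Yf_def by (simp add: algebra_simps)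
  then show "(Yf 0 + Yf (Suc 0) - (?w1 - 1) * (1 - Yf (Suc 0))) * Gf wt = 2 * Jf wt 0"
    using Gf_Jf [of wt, OF wt_0] by (simp only: mult.assoc One_nat_def)
qed

section \<open>Asymptotics\<close>

definition scale :: "real \<Rightarrow> nat \<Rightarrow> real" where
  "scale s n = 4 ^ n * real n powr s"

lemma scale_pos: "0 < n \<Longrightarrow> 0 < scale s n"
  by (simp add: scale_def)

text \<open>For even \<open>j \<ge> 0\<close> the argument is a pole of the Gamma function. There \<open>Gamma\<close> and its inverse have the value 0,
in accordance with the vanishing of almost all coefficients.\<close>

lemma upow_asymp:
  "(\<lambda>n. upow j $ n / scale (- of_int j / 2 - 1) n) \<longlonglongrightarrow> inverse (Gamma (- of_int j / 2))"
proof -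
  have "(\<lambda>n. (of_int j / 2 gchoose n) / ((-1) ^ n / exp ((of_int j / 2 + 1) * of_real (ln (real n)))))
      \<longlonglongrightarrow> inverse (Gamma (- (of_int j / 2 :: real)))"
    by (rule gbinomial_asymptotic)
  moreover have "eventually (\<lambda>n. (of_int j / 2 gchoose n) / ((-1) ^ n / exp ((of_int j / 2 + 1) * of_real (ln (real n)))) =
      upow j $ n / scale (- of_int j / 2 - 1) n) sequentially"
    using eventually_gt_at_top [of 0]
  proof eventually_elim
    case (elim n)
    have e: "exp ((of_int j / 2 + 1) * ln (real n)) = inverse (real n powr (- of_int j / 2 - 1))"
    proof -
      have "(of_int j / 2 + 1) * ln (real n) = - ((- of_int j / 2 - 1) * ln (real n))"
        by (simp add: algebra_simps)
      then show ?thesis using elim by (simp only: powr_def exp_minus) simp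
    qed
    have "(-4 :: real) ^ n = (-1) ^ n * 4 ^ n" using power_mult_distrib [of "-1 :: real" 4 n] by simp
    moreover have "(1 :: real) / (-1) ^ n = (-1) ^ n" by (cases "even n") auto
    ultimately show ?case
      unfolding scale_def upow_def of_real_eq_id id_apply e using elim
      by (simp add: field_simps)
  qed
  ultimately show ?thesis using tendsto_cong by fastforce
qed

lemma scale_ratio_tendsto:
  assumes "s < t"
  shows "(\<lambda>n. scale s n / scale t n) \<longlonglongrightarrow> 0"
proof -
  have "(\<lambda>n. real n powr (s - t)) \<longlonglongrightarrow> 0"
    using assms by (intro tendsto_neg_powr filterlim_real_sequentially) auto
  moreover have "scale s n / scale t n = real n powr (s - t)" for n
    by (simp add: scale_def powr_diff)
  ultimately show ?thesis by simp
qed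

lemma lau_asymp:
  assumes "f \<in> lau k" "- of_int k / 2 - 1 < s"
  shows "(\<lambda>n. f $ n / scale s n) \<longlonglongrightarrow> 0"
  using assms(1)
proof (induction rule: lau.induct)
  case lau_zero
  then show ?case by simp
next
  case (lau_step f j c)
  have "real_of_int k \<le> real_of_int j" using lau_step by simp
  then have "- of_int j / 2 - 1 < s" using assms(2) by (simp add: field_simps)
  have "(\<lambda>n. upow j $ n / scale (- of_int j / 2 - 1) n * (scale (- of_int j / 2 - 1) n / scale s n))
      \<longlonglongrightarrow> inverse (Gamma (- of_int j / 2)) * 0"
    by (intro tendsto_mult upow_asymp scale_ratio_tendsto) fact
  moreover have "eventually (\<lambda>n. upow j $ n / scale (- of_int j / 2 - 1) n * (scale (- of_int j / 2 - 1) n / scale s n)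
      = upow j $ n / scale s n) sequentially"
    using eventually_gt_at_top [of 0]
  proof eventually_elim
    case (elim n)
    then have "scale (- of_int j / 2 - 1) n \<noteq> 0" using scale_pos less_irrefl by metis
    moreover have "x / y * (y / z) = x / z" if "y \<noteq> 0" for x y z :: real
      using that by simp
    ultimately show ?case by blast
  qed
  ultimately have "(\<lambda>n. upow j $ n / scale s n) \<longlonglongrightarrow> inverse (Gamma (- of_int j / 2)) * 0"
    by (rule Lim_transform_eventually)
  then have "(\<lambda>n. upow j $ n / scale s n) \<longlonglongrightarrow> 0" by simp
  then have "(\<lambda>n. c * (upow j $ n / scale s n) + f $ n / scale s n) \<longlonglongrightarrow> c * 0 + 0"
    by (rule tendsto_add [OF tendsto_mult_left lau_step.IH])
  then show ?case by (simp add: add_divide_distrib flip: times_divide_eq_right)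
qed

lemma lead_asymp:
  assumes "lead k c f"
  shows "(\<lambda>n. f $ n / scale (- of_int k / 2 - 1) n) \<longlonglongrightarrow> c / Gamma (- of_int k / 2)"
proof -
  have "(\<lambda>n. (f - fps_const c * upow k) $ n / scale (- of_int k / 2 - 1) n) \<longlonglongrightarrow> 0"
    using assms unfolding lead_def by (rule lau_asymp) simp
  then have "(\<lambda>n. c * (upow k $ n / scale (- of_int k / 2 - 1) n) +
      (f - fps_const c * upow k) $ n / scale (- of_int k / 2 - 1) n) \<longlonglongrightarrow> c * inverse (Gamma (- of_int k / 2)) + 0"
    by (rule tendsto_add [OF tendsto_mult_left [OF upow_asymp]])
  moreover have "c * (upow k $ n / s) + (f - fps_const c * upow k) $ n / s = f $ n / s" for n s
    by (simp add: diff_divide_distrib)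
  ultimately have "(\<lambda>n. f $ n / scale (- of_int k / 2 - 1) n) \<longlonglongrightarrow> c * inverse (Gamma (- of_int k / 2)) + 0"
    by (simp only:)
  then show ?thesis by (simp only: divide_inverse add_0_right)
qed

section \<open>Sums over closed words\<close>

definition closed_words :: "nat \<Rightarrow> nat list set" where
  "closed_words n = {w. length w = 2 * n \<and> admissible (Suc (last (0 # w))) 0 w}"

text \<open>Sum of the letters and of their squares, the virtual letter included.\<close>

definition wA :: "nat list \<Rightarrow> nat" where
  "wA w = sum_list (Suc (last (0 # w)) # w)"

definition wC :: "nat list \<Rightarrow> nat" where
  "wC w = sum_list (map (\<lambda>x. x\<^sup>2) (Suc (last (0 # w)) # w))"

lemma wt_prod: "prod_list (map wt w) = E2 (real (sum_list w)) (real (sum_list (map (\<lambda>x. x\<^sup>2) w)))"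
  by (induction w) (simp_all add: E2_0 wt_def E2_mult)

text \<open>With all weights equal to 1, \<open>wsum\<close> counts words, and the count vanishes for a last letter \<open>r > n\<close>.\<close>

lemma closed_words_last:
  assumes "w \<in> closed_words n"
  shows "last (0 # w) \<le> n"
proof (rule ccontr)
  let ?r = "last (0 # w)"
  assume "\<not> ?r \<le> n"
  then have "Pf (\<lambda>_. 1 :: int) ?r (Suc ?r) $ n = 0" by (intro Pf_eq_0) auto
  then have "wsum (\<lambda>_. 1 :: int) ?r (Suc ?r) 0 (2 * n) = 0" by (simp add: Pf_def)
  define S where "S = {v \<in> words (Suc ?r) 0 (2 * n). last (0 # v) = ?r}"
  have "wsum (\<lambda>_. 1 :: int) ?r (Suc ?r) 0 (2 * n) = (\<Sum>v\<in>words (Suc ?r) 0 (2 * n). if last (0 # v) = ?r then 1 else 0)"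
    unfolding wsum_def by (intro sum.cong refl) (simp add: map_replicate_const)
  also have "\<dots> = (\<Sum>v\<in>S. 1)"
    unfolding S_def by (rule sum.inter_filter [symmetric]) simp
  finally have "card S = 0" using \<open>wsum _ _ _ _ _ = 0\<close> by simp
  moreover have "finite S" by (simp add: S_def)
  moreover have "w \<in> S" using assms by (simp add: S_def closed_words_def words_def)
  ultimately show False by auto
qed

lemma closed_words_UN: "closed_words n = (\<Union>r\<le>n. {w\<in>words (Suc r) 0 (2 * n). last (0 # w) = r})"
proof (intro equalityI subsetI)
  fix w assume w: "w \<in> closed_words n"
  then have "w \<in> words (Suc (last (0 # w))) 0 (2 * n)" by (simp add: closed_words_def words_def)
  with closed_words_last [OF w] show "w \<in> (\<Union>r\<le>n. {w\<in>words (Suc r) 0 (2 * n). last (0 # w) = r})" by blast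
qed (auto simp: closed_words_def words_def)

lemma finite_closed_words [simp]: "finite (closed_words n)"
  unfolding closed_words_UN by auto

lemma Gf_nth: "Gf wt $ n = (\<Sum>w\<in>closed_words n. E2 (real (wA w)) (real (wC w)))"
proof -
  let ?W = "\<lambda>r. {w\<in>words (Suc r) 0 (2 * n). last (0 # w) = r}"
  have "(\<Sum>w\<in>closed_words n. E2 (real (wA w)) (real (wC w))) =
      (\<Sum>r\<le>n. \<Sum>w\<in>?W r. E2 (real (wA w)) (real (wC w)))"
    unfolding closed_words_UN by (rule sum.UNION_disjoint) auto
  also have "\<dots> = (\<Sum>r\<le>n. \<Sum>w\<in>words (Suc r) 0 (2 * n). if last (0 # w) = r then wt (Suc r) * prod_list (map wt w) else 0)"
  proof (rule sum.cong [OF refl])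
    fix r
    have "(\<Sum>w\<in>?W r. E2 (real (wA w)) (real (wC w))) =
        (\<Sum>w\<in>?W r. wt (Suc r) * prod_list (map wt w))"
    proof (intro sum.cong refl)
      fix w assume "w \<in> ?W r"
      then show "E2 (real (wA w)) (real (wC w)) = wt (Suc r) * prod_list (map wt w)"
        unfolding wt_prod unfolding wt_def wA_def wC_def E2_mult by (simp add: add.assoc)
    qed
    also have "\<dots> = (\<Sum>w\<in>words (Suc r) 0 (2 * n). if last (0 # w) = r then wt (Suc r) * prod_list (map wt w) else 0)"
      by (rule sum.inter_filter) simp
    finally show "(\<Sum>w\<in>?W r. E2 (real (wA w)) (real (wC w))) =
       (\<Sum>w\<in>words (Suc r) 0 (2 * n). if last (0 # w) = r then wt (Suc r) * prod_list (map wt w) else 0)" .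
  qed
  also have "\<dots> = (\<Sum>r\<le>n. wt (Suc r) * wsum wt r (Suc r) 0 (2 * n))"
    by (simp add: wsum_def sum_distrib_left if_distrib cong: if_cong)
  finally show ?thesis by (simp add: Gf_def)
qed

definition msum :: "nat \<Rightarrow> nat \<Rightarrow> nat \<Rightarrow> real" where
  "msum a b n = (\<Sum>w\<in>closed_words n. real (wA w) ^ a * real (wC w) ^ b)"

lemma msum_asymp:
  "(\<lambda>n. msum a b n / scale (3 / 2 * real a + 2 * real b) n) \<longlonglongrightarrow> fact a * fact b * gc a b / Gamma (1 + (3 / 2 * real a + 2 * real b))"
proof -
  let ?k = "-2 - 3 * int a - 4 * int b"
  have e: "- of_int ?k / 2 - 1 = 3 / 2 * real a + 2 * real b" "- of_int ?k / 2 = 1 + (3 / 2 * real a + 2 * real b)"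
    by (simp_all add: field_simps)
  have "lead ?k (gc a b) (cf (Gf wt) a b)"
    using Gf_lead [of a b] unfolding famlead_def .
  from tendsto_mult_left [OF lead_asymp [OF this], of "fact a * fact b"]
  have "(\<lambda>n. fact a * fact b * (cf (Gf wt) a b $ n / scale (3 / 2 * real a + 2 * real b) n))
      \<longlonglongrightarrow> fact a * fact b * (gc a b / Gamma (1 + (3 / 2 * real a + 2 * real b)))"
    unfolding e(2) add_diff_cancel_left' .
  moreover have "fact a * fact b * (cf (Gf wt) a b $ n / s) = msum a b n / s" for n s
  proof -
    have "fact a * fact b * cf (Gf wt) a b $ n = (\<Sum>w\<in>closed_words n. fact a * fact b *
        (real (wA w) ^ a / fact a * (real (wC w) ^ b / fact b)))"
      by (simp only: cf_def Gf_nth fps_sum_nth E2_def fps_nth_Abs_fps sum_distrib_left)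
    also have "\<dots> = msum a b n"
      unfolding msum_def by (intro sum.cong refl) simp
    finally show ?thesis by simp
  qed
  ultimately show ?thesis by (simp only: times_divide_eq_right)
qed

lemma moment_asymp:
  "(\<lambda>n. msum a b n / card (closed_words n) / real n powr (3 / 2 * real a + 2 * real b))
    \<longlonglongrightarrow> fact a * fact b * gc a b / Gamma (1 + (3 / 2 * real a + 2 * real b))"
proof -
  have c: "msum 0 0 n = card (closed_words n)" for n by (simp add: msum_def)
  have "(\<lambda>n. card (closed_words n) / scale 0 n) \<longlonglongrightarrow> 1"
    using msum_asymp [of 0 0] by (simp add: c)
  from tendsto_divide [OF msum_asymp this, of a b]
  have "(\<lambda>n. (msum a b n / scale (3 / 2 * real a + 2 * real b) n) / (card (closed_words n) / scale 0 n))
    \<longlonglongrightarrow> fact a * fact b * gc a b / Gamma (1 + (3 / 2 * real a + 2 * real b))" by simp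
  moreover have "eventually (\<lambda>n. (msum a b n / scale (3 / 2 * real a + 2 * real b) n) / (card (closed_words n) / scale 0 n) =
      msum a b n / card (closed_words n) / real n powr (3 / 2 * real a + 2 * real b)) sequentially"
    using eventually_gt_at_top [of 0]
  proof eventually_elim
    case (elim n)
    have "x / (F * P) / (k / (F * 1)) = x / k / P" if "F \<noteq> 0" for x F P k :: real
      using that by (cases "k = 0"; cases "P = 0") simp_all
    from this [of "4 ^ n"] show ?case using elim by (simp add: scale_def)
  qed
  ultimately show ?thesis by (rule Lim_transform_eventually)
qed

section \<open>First-column hook lengths\<close>

text \<open>The first-column hook lengths: the part in row \<open>i\<close> of \<open>k\<close> rows yields \<open>part + k - i\<close>, and \<open>k - i\<close> is
the number of rows below.\<close>

fun beta :: "nat list \<Rightarrow> nat set" where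
  "beta [] = {}"
| "beta (x # xs) = insert (x + length xs) (beta xs)"

lemma beta_nth: "y \<in> beta p \<longleftrightarrow> (\<exists>i<length p. y = p ! i + (length p - Suc i))"
  by (induction p) (simp_all add: Ex_less_Suc2)

lemma finite_beta [simp]: "finite (beta p)"
  by (induction p) auto

text \<open>The rows reaching column \<open>j\<close> form an initial segment, whose length is the conjugate part.\<close>

lemma conjugate_part_iff:
  assumes "sorted_wrt (\<ge>) p" "1 \<le> i" "i \<le> length p"
  shows "j \<le> nth_part p i \<longleftrightarrow> i \<le> conjugate_part p j"
proof -
  let ?S = "{i \<in> {1..length p}. j \<le> nth_part p i}"
  have mono: "nth_part p i' \<le> nth_part p i" if "1 \<le> i" "i \<le> i'" "i' \<le> length p" for i i'
  proof (cases "i = i'")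
    case False
    with that have "i - 1 < i' - 1" "i' - 1 < length p" by auto
    with assms(1) show ?thesis by (simp add: nth_part_def sorted_wrt_iff_nth_less)
  qed simp
  show ?thesis
  proof
    assume "j \<le> nth_part p i"
    then have "{1..i} \<subseteq> ?S" using mono assms by (auto intro: order_trans)
    from card_mono [OF _ this] show "i \<le> conjugate_part p j" by (simp add: conjugate_part_def)
  next
    assume i: "i \<le> conjugate_part p j"
    show "j \<le> nth_part p i"
    proof (rule ccontr)
      assume "\<not> j \<le> nth_part p i"
      then have "?S \<subseteq> {1..<i}" using mono assms
        by (auto simp: not_le) (meson le_trans not_le)
      from card_mono [OF _ this] have "conjugate_part p j \<le> i - 1" by (simp add: conjugate_part_def)
      with i assms show False by simp
    qed
  qed
qed

lemma conjugate_part_le: "conjugate_part p j \<le> length p"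
proof -
  have "{i \<in> {1..length p}. j \<le> nth_part p i} \<subseteq> {1..length p}" by auto
  from card_mono [OF _ this] show ?thesis by (simp add: conjugate_part_def)
qed

lemma conjugate_part_1:
  assumes "\<forall>k\<in>set p. 0 < k"
  shows "conjugate_part p 1 = length p"
proof -
  have "1 \<le> nth_part p i" if "i \<in> {1..length p}" for i
  proof -
    have "p ! (i - 1) \<in> set p" using that by (intro nth_mem) auto
    then show ?thesis using assms by (auto simp: nth_part_def Suc_le_eq)
  qed
  then have "{i \<in> {1..length p}. 1 \<le> nth_part p i} = {1..length p}" by auto
  then show ?thesis by (simp add: conjugate_part_def)
qed

lemma beta_part: "beta p = {nth_part p i + (length p - i) | i. 1 \<le> i \<and> i \<le> length p}"
proof (intro equalityI subsetI)
  fix y assume "y \<in> beta p"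
  then obtain i where "i < length p" "y = p ! i + (length p - Suc i)" unfolding beta_nth by blast
  then show "y \<in> {nth_part p i + (length p - i) | i. 1 \<le> i \<and> i \<le> length p}"
    by (intro CollectI exI [of _ "Suc i"]) (simp add: nth_part_def)
next
  fix y assume "y \<in> {nth_part p i + (length p - i) | i. 1 \<le> i \<and> i \<le> length p}"
  then obtain i where "y = nth_part p i + (length p - i)" "1 \<le> i" "i \<le> length p" by blast
  then show "y \<in> beta p"
    unfolding beta_nth by (intro exI [of _ "i - 1"]) (auto simp: nth_part_def)
qed

text \<open>The complement of \<open>beta p\<close> is enumerated by the columns. Both describe the boundary path of the diagram: its vertical
steps have the positions \<open>beta p\<close>, its horizontal steps the positions \<open>gap p j\<close>.\<close>

definition gap :: "nat list \<Rightarrow> nat \<Rightarrow> nat" where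
  "gap p j = j - 1 + (length p - conjugate_part p j)"

lemma hook_length_gap:
  assumes "1 \<le> i" "i \<le> length p" "1 \<le> j"
  shows "hook_length p i j = int (nth_part p i + (length p - i)) - int (gap p j)"
  using assms conjugate_part_le [of p j] by (simp add: hook_length_def gap_def of_nat_diff)

lemma gap_notin_beta:
  assumes "sorted_wrt (\<ge>) p" "1 \<le> j"
  shows "gap p j \<notin> beta p"
proof
  assume "gap p j \<in> beta p"
  then obtain i where i: "gap p j = nth_part p i + (length p - i)" "1 \<le> i" "i \<le> length p"
    unfolding beta_part by blast
  show False
  proof (cases "j \<le> nth_part p i")
    case True
    then have "i \<le> conjugate_part p j" using conjugate_part_iff [OF assms(1) i(2,3)] by simp
    with True i assms(2) conjugate_part_le [of p j] show False by (simp add: gap_def)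
  next
    case False
    then have "\<not> i \<le> conjugate_part p j" using conjugate_part_iff [OF assms(1) i(2,3)] by simp
    with False i assms(2) conjugate_part_le [of p j] show False by (simp add: gap_def)
  qed
qed

text \<open>Consider the last column \<open>j\<close> with \<open>gap p j \<le> x\<close>. If \<open>gap p j < x < gap p (Suc j)\<close>, then \<open>x\<close> belongs to a row of length \<open>j\<close>
and lies in \<open>beta p\<close>.\<close>

lemma gap_surj:
  assumes p: "is_partition p" and x: "x \<notin> beta p"
  shows "\<exists>j\<ge>1. gap p j = x"
proof -
  have s: "sorted_wrt (\<ge>) p" using p by (simp add: is_partition_def)
  let ?J = "{j. 1 \<le> j \<and> gap p j \<le> x}"
  have fin: "finite ?J" by (rule finite_subset [of _ "{..x + 1}"]) (auto simp: gap_def)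
  have "gap p 1 = 0" using p conjugate_part_1 by (simp add: gap_def is_partition_def)
  then have "1 \<in> ?J" by simp
  define j where "j = Max ?J"
  have j: "1 \<le> j" "gap p j \<le> x" using Max_in [OF fin] \<open>1 \<in> ?J\<close> by (auto simp: j_def)
  have "Suc j \<notin> ?J" using Max_ge [OF fin, of "Suc j"] by (auto simp: j_def)
  then have j': "x < gap p (Suc j)" by auto
  have "gap p j = x"
  proof (rule ccontr)
    assume "gap p j \<noteq> x"
    with j have lt: "gap p j < x" by simp
    define i where "i = j + length p - x"
    have le: "conjugate_part p j \<le> length p" "conjugate_part p (Suc j) \<le> length p"
      by (rule conjugate_part_le)+
    have i: "i \<le> conjugate_part p j" "conjugate_part p (Suc j) < i"
      using lt j' j(1) le unfolding i_def gap_def by linarith+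
    then have r: "1 \<le> i" "i \<le> length p" using le by linarith+
    have "nth_part p i = j"
      using conjugate_part_iff [OF s r, of j] conjugate_part_iff [OF s r, of "Suc j"] i by linarith
    then have "x = nth_part p i + (length p - i)" using r lt j' j(1) le unfolding i_def gap_def by linarith
    with r x show False unfolding beta_part by blast
  qed
  with j show ?thesis by blast
qed

text \<open>The hook of cell \<open>(i, j)\<close> is the difference of the vertical position of row \<open>i\<close> and the horizontal position of
column \<open>j\<close>.\<close>

lemma hook_length_iff:
  assumes p: "is_partition p" and d: "1 \<le> d"
  shows "(\<exists>(i, j)\<in>cells p. hook_length p i j = int d) \<longleftrightarrow> (\<exists>b\<in>beta p. d \<le> b \<and> b - d \<notin> beta p)"
proof
  have s: "sorted_wrt (\<ge>) p" using p by (simp add: is_partition_def)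
  {
    assume "\<exists>(i, j)\<in>cells p. hook_length p i j = int d"
    then obtain i j where ij: "1 \<le> i" "i \<le> length p" "1 \<le> j" "hook_length p i j = int d"
      by (auto simp: cells_def)
    let ?b = "nth_part p i + (length p - i)"
    have "int ?b - int (gap p j) = int d" using hook_length_gap [OF ij(1-3)] ij(4) by simp
    then have "d \<le> ?b" "?b - d = gap p j" by linarith+
    moreover have "?b \<in> beta p" using ij unfolding beta_part by blast
    ultimately show "\<exists>b\<in>beta p. d \<le> b \<and> b - d \<notin> beta p"
      using gap_notin_beta [OF s ij(3)] by metis
  }
  {
    assume "\<exists>b\<in>beta p. d \<le> b \<and> b - d \<notin> beta p"
    then obtain i where i: "1 \<le> i" "i \<le> length p" and b: "d \<le> nth_part p i + (length p - i)"
      "nth_part p i + (length p - i) - d \<notin> beta p"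
      unfolding beta_part by blast
    then obtain j where j: "1 \<le> j" "gap p j = nth_part p i + (length p - i) - d"
      using gap_surj [OF p] by blast
    have "j \<le> nth_part p i"
    proof (rule ccontr)
      assume *: "\<not> j \<le> nth_part p i"
      then have "\<not> i \<le> conjugate_part p j" using conjugate_part_iff [OF s i] by simp
      with * j i b d conjugate_part_le [of p j] show False by (simp add: gap_def)
    qed
    then have "(i, j) \<in> cells p" using i j by (simp add: cells_def)
    moreover have "hook_length p i j = int d"
      using hook_length_gap [OF i j(1)] j(2) b(1) by simp
    ultimately show "\<exists>(i, j)\<in>cells p. hook_length p i j = int d" by blast
  }
qed

lemma is_core_iff:
  assumes "1 \<le> s" "1 \<le> t"
  shows "is_core s t p \<longleftrightarrow> is_partition p \<and>
    (\<forall>b\<in>beta p. (s \<le> b \<longrightarrow> b - s \<in> beta p) \<and> (t \<le> b \<longrightarrow> b - t \<in> beta p))"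
proof (cases "is_partition p")
  case True
  from hook_length_iff [OF True assms(1)] hook_length_iff [OF True assms(2)] True show ?thesis
    unfolding is_core_def by blast
qed (simp add: is_core_def)

section \<open>Partitions with distinct parts and sets without consecutive elements\<close>

definition sparse :: "nat set \<Rightarrow> bool" where
  "sparse B \<longleftrightarrow> finite B \<and> 0 \<notin> B \<and> (\<forall>b\<in>B. Suc b \<notin> B)"

definition strict_part :: "nat list \<Rightarrow> bool" where
  "strict_part p \<longleftrightarrow> is_partition p \<and> distinct p"

lemma strict_part_Cons:
  "strict_part (x # xs) \<longleftrightarrow> 0 < x \<and> (\<forall>y\<in>set xs. y < x) \<and> strict_part xs"
  by (auto simp: strict_part_def is_partition_def) (metis le_neq_implies_less)

lemma beta_less: "strict_part xs \<Longrightarrow> \<forall>y\<in>set xs. y < x \<Longrightarrow> b \<in> beta xs \<Longrightarrow> Suc b < x + length xs"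
proof (induction xs arbitrary: x)
  case (Cons y ys)
  then show ?case by (fastforce simp: strict_part_Cons)
qed simp

lemma beta_fresh:
  assumes "strict_part (x # xs)"
  shows "x + length xs \<notin> beta xs"
  using beta_less [of xs x "x + length xs"] assms by (auto simp: strict_part_Cons)

lemma card_beta: "strict_part p \<Longrightarrow> card (beta p) = length p"
proof (induction p)
  case (Cons x xs)
  then show ?case using beta_fresh [of x xs] by (simp add: strict_part_Cons)
qed simp

lemma sum_beta: "strict_part p \<Longrightarrow> 2 * \<Sum>(beta p) = 2 * sum_list p + length p * (length p - 1)"
proof (induction p)
  case (Cons x xs)
  then have "\<Sum>(beta (x # xs)) = x + length xs + \<Sum>(beta xs)"
    using beta_fresh [of x xs] by simp
  moreover have "2 * \<Sum>(beta xs) = 2 * sum_list xs + length xs * (length xs - 1)"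
    using Cons by (simp add: strict_part_Cons)
  ultimately show ?case by (cases xs) (simp_all add: algebra_simps)
qed simp

lemma sparse_beta: "strict_part p \<Longrightarrow> sparse (beta p)"
proof (induction p)
  case (Cons x xs)
  then have xs: "strict_part xs" "\<forall>y\<in>set xs. y < x" "0 < x" by (auto simp: strict_part_Cons)
  from Cons.IH [OF xs(1)] beta_less [OF xs(1,2)] xs(3) show ?case
    by (fastforce simp: sparse_def)
qed (simp add: sparse_def)

lemma beta_Max:
  assumes "strict_part (x # xs)"
  shows "Max (beta (x # xs)) = x + length xs"
  using beta_less [of xs x] assms
  by (intro Max_eqI) (auto simp: strict_part_Cons intro: less_imp_le Suc_lessD)

lemma beta_inj: "strict_part p \<Longrightarrow> strict_part q \<Longrightarrow> beta p = beta q \<Longrightarrow> p = q"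
proof (induction p arbitrary: q)
  case Nil
  then show ?case by (cases q) auto
next
  case (Cons x xs)
  then obtain y ys where q: "q = y # ys" by (cases q) auto
  have "length (x # xs) = length (y # ys)"
    using card_beta [OF Cons.prems(1)] card_beta [OF Cons.prems(2)] Cons.prems(3) q by simp
  moreover have "x + length xs = y + length ys"
    using beta_Max [OF Cons.prems(1)] beta_Max [of y ys] Cons.prems q by simp
  ultimately have xy: "x = y" "length xs = length ys" by auto
  have "beta xs = beta (x # xs) - {x + length xs}"
    using beta_fresh [OF Cons.prems(1)] by auto
  also have "\<dots> = beta (y # ys) - {y + length ys}"
    using Cons.prems(3) q xy by simp
  also have "\<dots> = beta ys"
    using beta_fresh [of y ys] Cons.prems(2) q by auto
  finally show ?case using Cons.IH [of ys] Cons.prems q xy by (simp add: strict_part_Cons)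
qed

text \<open>The largest element is the hook length of the first row. Since its predecessor is absent, the remaining
elements leave room for a strictly larger first part.\<close>

lemma beta_surj: "sparse B \<Longrightarrow> \<exists>p. strict_part p \<and> beta p = B"
proof (induction "card B" arbitrary: B)
  case 0
  then have "B = {}" by (simp add: sparse_def)
  then show ?case by (intro exI [of _ "[]"]) (simp add: strict_part_def is_partition_def)
next
  case (Suc m)
  then have B: "finite B" "B \<noteq> {}" by (auto simp: sparse_def)
  define b where "b = Max B"
  have b: "b \<in> B" "\<And>c. c \<in> B \<Longrightarrow> c \<le> b" using B by (auto simp: b_def)
  have "sparse (B - {b})" using Suc.prems by (auto simp: sparse_def)
  moreover have "card (B - {b}) = m" using Suc.hyps(2) b(1) B by simp
  ultimately obtain p where p: "strict_part p" "beta p = B - {b}" using Suc.hyps(1) by metis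
  have lt: "Suc c < b" if "c \<in> beta p" for c
  proof -
    have "c \<in> B" "c \<noteq> b" using that p by auto
    moreover have "Suc c \<noteq> b" using Suc.prems b(1) \<open>c \<in> B\<close> by (auto simp: sparse_def)
    ultimately show ?thesis using b(2) [of c] by simp
  qed
  have "strict_part ((b - length p) # p) \<and> length p \<le> b"
  proof (cases p)
    case Nil
    have "0 < b" using Suc.prems b(1) by (cases b) (auto simp: sparse_def)
    then show ?thesis using Nil by (simp add: strict_part_def is_partition_def)
  next
    case (Cons y ys)
    then have "Suc (y + length ys) < b" using lt by simp
    with p(1) Cons show ?thesis by (auto simp: strict_part_Cons)
  qed
  then show ?case using p(2) b(1) by (intro exI [of _ "(b - length p) # p"]) auto
qed


section \<open>Closed words\<close>

lemma admissible_nth: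
  "admissible p q w \<longleftrightarrow> (\<forall>i<length w. w ! i = 0 \<or> (q # w) ! i = 0 \<and> w ! i \<le> (p # q # w) ! i + 1)"
proof (induction w arbitrary: p q)
  case (Cons x w)
  show ?case
    unfolding admissible.simps Cons.IH [of q x] length_Cons All_less_Suc2 by simp
qed simp

text \<open>Occupancy conditions on the runners \<open>1, \<dots>, 2n\<close> of the abacus with \<open>2n + 1\<close> runners. Runner 0 is empty, which explains the bound
\<open>h 2 \<le> 1\<close>; subtracting \<open>2n + 3\<close> from an element of runner 1 lands two levels lower on runner \<open>2n\<close>, hence the
exceptional bound on \<open>h 1\<close>.\<close>

definition heights :: "nat \<Rightarrow> (nat \<Rightarrow> nat) \<Rightarrow> bool" where
  "heights n h \<longleftrightarrow> h 1 \<le> h (2 * n) + 2 \<and> h 2 \<le> 1 \<and>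
     (\<forall>r. 2 \<le> r \<longrightarrow> r \<le> 2 * n \<longrightarrow> h r = 0 \<or> h (r - 1) = 0) \<and>
     (\<forall>r. 3 \<le> r \<longrightarrow> r \<le> 2 * n \<longrightarrow> h r \<le> h (r - 2) + 1)"

lemma closed_words_iff:
  assumes "1 \<le> n"
  shows "w \<in> closed_words n \<longleftrightarrow> length w = 2 * n \<and> heights n (\<lambda>r. w ! (r - 1))"
proof (cases "length w = 2 * n")
  case True
  then have ne: "w \<noteq> []" using assms by auto
  have last: "last (0 # w) = w ! (2 * n - 1)" using ne True by (simp add: last_conv_nth)
  define P where "P i \<longleftrightarrow> w ! i = 0 \<or> (0 # w) ! i = 0 \<and> w ! i \<le> (Suc (w ! (2 * n - 1)) # 0 # w) ! i + 1" for i
  have P0: "P 0 \<longleftrightarrow> w ! 0 \<le> w ! (2 * n - 1) + 2" by (auto simp: P_def)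
  have P1: "P 1 \<longleftrightarrow> (w ! 1 = 0 \<or> w ! 0 = 0) \<and> w ! 1 \<le> 1" by (auto simp: P_def)
  have P2: "P (Suc (Suc i)) \<longleftrightarrow> (w ! Suc (Suc i) = 0 \<or> w ! Suc i = 0) \<and> w ! Suc (Suc i) \<le> w ! i + 1" for i
    by (auto simp: P_def)
  have "w \<in> closed_words n \<longleftrightarrow> (\<forall>i<2 * n. P i)"
    unfolding closed_words_def mem_Collect_eq admissible_nth last P_def using True by (simp only: simp_thms)
  also have "\<dots> \<longleftrightarrow> P 0 \<and> P 1 \<and> (\<forall>i. Suc (Suc i) < 2 * n \<longrightarrow> P (Suc (Suc i)))" (is "?l \<longleftrightarrow> ?r")
  proof
    assume l: ?l
    show ?r
    proof (intro conjI allI impI)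
      show "P 0" "P 1" using assms by (auto intro!: l [rule_format])
    qed (rule l [rule_format])
  next
    assume r: ?r
    show ?l
    proof (intro allI impI)
      fix i assume "i < 2 * n"
      have "i = 0 \<or> i = 1 \<or> i = Suc (Suc (i - 2))" by arith
      then consider "i = 0" | "i = 1" | j where "i = Suc (Suc j)" by blast
      then show "P i" using r \<open>i < 2 * n\<close> by cases blast+
    qed
  qed
  also have "\<dots> \<longleftrightarrow> heights n (\<lambda>r. w ! (r - 1))" (is "?l \<longleftrightarrow> ?r")
  proof
    assume l: ?l
    show ?r
      unfolding heights_def
    proof (intro conjI allI impI)
      show "w ! (1 - 1) \<le> w ! (2 * n - 1) + 2" "w ! (2 - 1) \<le> 1" using l P0 P1 by simp_all
    next
      fix r :: nat assume r: "2 \<le> r" "r \<le> 2 * n"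
      show "w ! (r - 1) = 0 \<or> w ! (r - 1 - 1) = 0"
      proof (cases "r = 2")
        case True
        then show ?thesis using conjunct1 [OF conjunct2 [OF l]] P1 by simp
      next
        case False
        then have "r = Suc (Suc (Suc (r - 3)))" using r by simp
        then obtain j where "r = Suc (Suc (Suc j))" by blast
        moreover from this r have "P (Suc (Suc j))" using l by simp
        ultimately show ?thesis using P2 [of j] by simp
      qed
    next
      fix r :: nat assume r: "3 \<le> r" "r \<le> 2 * n"
      then have "r = Suc (Suc (Suc (r - 3)))" by simp
      then obtain j where "r = Suc (Suc (Suc j))" by blast
      moreover from this r have "P (Suc (Suc j))" using l by simp
      ultimately show "w ! (r - 1) \<le> w ! (r - 2 - 1) + 1" using P2 [of j] by simp
    qed
  next
    assume ?r
    then have h: "w ! 0 \<le> w ! (2 * n - 1) + 2" "w ! 1 \<le> 1"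
      "\<And>r. 2 \<le> r \<Longrightarrow> r \<le> 2 * n \<Longrightarrow> w ! (r - 1) = 0 \<or> w ! (r - 1 - 1) = 0"
      "\<And>r. 3 \<le> r \<Longrightarrow> r \<le> 2 * n \<Longrightarrow> w ! (r - 1) \<le> w ! (r - 2 - 1) + 1"
      by (simp_all add: heights_def)
    show ?l
    proof (intro conjI allI impI)
      show "P 0" using h(1) P0 by simp
      show "P 1" using h(2) h(3) [of 2] assms P1 by simp
      fix i assume "Suc (Suc i) < 2 * n"
      then show "P (Suc (Suc i))" using h(3) [of "i + 3"] h(4) [of "i + 3"] P2 [of i]
        by (simp add: numeral_3_eq_3)
    qed
  qed
  finally show ?thesis using True by simp
qed (simp add: closed_words_def)

section \<open>The abacus\<close>

definition runner_set :: "nat \<Rightarrow> (nat \<Rightarrow> nat) \<Rightarrow> nat set" where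
  "runner_set s h = {b. b mod s \<noteq> 0 \<and> b div s < h (b mod s)}"

definition core_sets :: "nat \<Rightarrow> nat set set" where
  "core_sets n = {B. sparse B \<and> (\<forall>b\<in>B. (2 * n + 1 \<le> b \<longrightarrow> b - (2 * n + 1) \<in> B) \<and> (2 * n + 3 \<le> b \<longrightarrow> b - (2 * n + 3) \<in> B))}"

lemma distinct_cores_iff: "p \<in> distinct_cores n \<longleftrightarrow> strict_part p \<and> beta p \<in> core_sets n"
  using is_core_iff [of "2 * n + 1" "2 * n + 3" p] sparse_beta [of p]
  by (auto simp: distinct_cores_def strict_part_def core_sets_def)

lemma bij_beta: "bij_betw beta (distinct_cores n) (core_sets n)"
  unfolding bij_betw_def
proof
  show "inj_on beta (distinct_cores n)"
    by (auto intro!: inj_onI beta_inj simp: distinct_cores_iff)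
  show "beta ` distinct_cores n = core_sets n"
  proof (intro equalityI subsetI)
    fix B assume B: "B \<in> core_sets n"
    then obtain p where "strict_part p" "beta p = B" using beta_surj [of B] by (auto simp: core_sets_def)
    then show "B \<in> beta ` distinct_cores n" using B by (auto simp: distinct_cores_iff)
  qed (auto simp: distinct_cores_iff)
qed

lemma runner_set_mem:
  assumes "1 \<le> r" "r < s"
  shows "k * s + r \<in> runner_set s h \<longleftrightarrow> k < h r"
  using assms by (simp add: runner_set_def)

lemma runner_set_finite:
  assumes "1 \<le> s"
  shows "finite (runner_set s h)"
proof (rule finite_subset)
  show "runner_set s h \<subseteq> (\<lambda>(r, k). k * s + r) ` (SIGMA r:{..<s}. {..<h r})"
  proof
    fix b assume "b \<in> runner_set s h"
    then show "b \<in> (\<lambda>(r, k). k * s + r) ` (SIGMA r:{..<s}. {..<h r})"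
      using assms by (intro image_eqI [of _ _ "(b mod s, b div s)"]) (auto simp: runner_set_def)
  qed
qed auto

lemma heightsD:
  assumes "heights n h"
  shows "h 1 \<le> h (2 * n) + 2" and "h 2 \<le> 1"
    and "\<And>r. 2 \<le> r \<Longrightarrow> r \<le> 2 * n \<Longrightarrow> h r = 0 \<or> h (r - 1) = 0"
    and "\<And>r. 3 \<le> r \<Longrightarrow> r \<le> 2 * n \<Longrightarrow> h r \<le> h (r - 2) + 1"
proof -
  note c = assms [unfolded heights_def]
  note c2 = c [THEN conjunct2] note c3 = c2 [THEN conjunct2]
  show "h 1 \<le> h (2 * n) + 2" by (rule c [THEN conjunct1])
  show "h 2 \<le> 1" by (rule c2 [THEN conjunct1])
  show "2 \<le> r \<Longrightarrow> r \<le> 2 * n \<Longrightarrow> h r = 0 \<or> h (r - 1) = 0" for r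
    by (rule c3 [THEN conjunct1, rule_format])
  show "3 \<le> r \<Longrightarrow> r \<le> 2 * n \<Longrightarrow> h r \<le> h (r - 2) + 1" for r
    by (rule c3 [THEN conjunct2, rule_format])
qed

lemma runner_set_core:
  assumes n: "1 \<le> n" and h: "heights n h"
  shows "runner_set (2 * n + 1) h \<in> core_sets n"
proof -
  let ?s = "2 * n + 1"
  let ?B = "runner_set ?s h"
  note h1 = heightsD(1) [OF h] and h2 = heightsD(2) [OF h] and h3 = heightsD(3) [OF h]
    and h4 = heightsD(4) [OF h]
  have split: "\<exists>k r. b = k * ?s + r \<and> 1 \<le> r \<and> r \<le> 2 * n \<and> k < h r" if "b \<in> ?B" for b
  proof (intro exI conjI)
    show "b = b div ?s * ?s + b mod ?s" by (rule div_mult_mod_eq [symmetric])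
    show "1 \<le> b mod ?s" "b mod ?s \<le> 2 * n" "b div ?s < h (b mod ?s)"
      using that mod_less_divisor [of ?s b] by (auto simp: runner_set_def)
  qed
  have mem: "k * ?s + r \<in> ?B \<longleftrightarrow> k < h r" if "1 \<le> r" "r \<le> 2 * n" for k r
    using runner_set_mem [of r ?s k h] that by simp
  have mult: "k * ?s \<notin> ?B" for k
    unfolding runner_set_def mem_Collect_eq by (simp only: mod_mult_self2_is_0 simp_thms)
  have "sparse ?B"
    unfolding sparse_def
  proof (intro conjI ballI)
    show "finite ?B" by (rule runner_set_finite) simp
    show "0 \<notin> ?B" by (simp add: runner_set_def)
    fix b assume b: "b \<in> ?B"
    from split [OF b] obtain k r where kr: "b = k * ?s + r" "1 \<le> r" "r \<le> 2 * n" "k < h r" by blast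
    show "Suc b \<notin> ?B"
    proof (cases "r = 2 * n")
      case True
      then have "Suc b = (k + 1) * ?s" using kr by simp
      then show ?thesis using mult by metis
    next
      case False
      then have r1: "1 \<le> Suc r" "Suc r \<le> 2 * n" using kr by auto
      have "h (Suc r) = 0 \<or> h (Suc r - 1) = 0" using r1 kr(2) by (intro h3) simp_all
      then have "\<not> k < h (Suc r)" using kr(4) by auto
      moreover have "Suc b = k * ?s + Suc r" using kr(1) by simp
      ultimately show ?thesis using mem [OF r1] by metis
    qed
  qed
  moreover have "b - ?s \<in> ?B" if "b \<in> ?B" "?s \<le> b" for b
  proof -
    from split [OF that(1)] obtain k r where kr: "b = k * ?s + r" "1 \<le> r" "r \<le> 2 * n" "k < h r" by blast
    have "k \<noteq> 0"
    proof
      assume "k = 0"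
      then have "b = r" using kr(1) by simp
      then show False using kr(3) that(2) by simp
    qed
    then obtain k' where "k = Suc k'" using not0_implies_Suc by blast
    then have e: "b = ?s + (k' * ?s + r)" and "k' < h r"
      using kr(1,4) by (simp_all only: mult_Suc add.assoc Suc_lessD)
    have "b - ?s = k' * ?s + r" unfolding e by (rule add_diff_cancel_left')
    then show ?thesis using mem [OF kr(2,3)] \<open>k' < h r\<close> by (simp only:)
  qed
  moreover have "b - (2 * n + 3) \<in> ?B" if "b \<in> ?B" "2 * n + 3 \<le> b" for b
  proof -
    from split [OF that(1)] obtain k r where kr: "b = k * ?s + r" "1 \<le> r" "r \<le> 2 * n" "k < h r" by blast
    have "k \<noteq> 0"
    proof
      assume "k = 0"
      then have "b = r" using kr(1) by simp
      then show False using kr(3) that(2) by simp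
    qed
    then obtain k' where k': "k = Suc k'" using not0_implies_Suc by blast
    consider "r = 1" | "r = 2" | "3 \<le> r" using kr by linarith
    then show ?thesis
    proof cases
      case 1
      have "k' \<noteq> 0"
      proof
        assume "k' = 0"
        then have "b = ?s + 1" using kr(1) k' 1 by simp
        then show False using that(2) by simp
      qed
      then obtain k'' where k'': "k' = Suc k''" using not0_implies_Suc by blast
      have "k'' < h (2 * n)" using h1 kr(4) unfolding 1 k' k'' by linarith
      then have "k'' * ?s + 2 * n \<in> ?B" using mem [of "2 * n" k''] n by linarith
      moreover have "b - (2 * n + 3) = k'' * ?s + 2 * n" unfolding kr(1) 1 k' k'' by simp
      ultimately show ?thesis by (simp only:)
    next
      case 2
      then show ?thesis using h2 kr(4) k' by simp
    next
      case 3
      then have "h r \<le> h (r - 2) + 1" using kr(3) by (rule h4)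
      then have "k' < h (r - 2)" using kr(4) k' by simp
      then have "k' * ?s + (r - 2) \<in> ?B" using mem [of "r - 2" k'] 3 kr(3) by linarith
      moreover have "b - (2 * n + 3) = k' * ?s + (r - 2)" using 3 unfolding kr(1) k' by simp
      ultimately show ?thesis by (simp only:)
    qed
  qed
  ultimately show ?thesis by (simp add: core_sets_def)
qed

text \<open>A runner is filled from the bottom without gaps, as the set is closed under subtracting \<open>2n + 1\<close>.\<close>

lemma downward_closed_nat:
  assumes "finite K" "\<And>k. Suc k \<in> K \<Longrightarrow> k \<in> K"
  shows "k \<in> K \<longleftrightarrow> k < card K"
proof -
  have down: "j \<in> K" if "i \<in> K" "j \<le> i" for i j
    using that(2,1) by (induction rule: inc_induct) (auto intro: assms(2))
  have lt: "i < card K" if "i \<in> K" for i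
  proof -
    have "{..i} \<subseteq> K" using down that by auto
    from card_mono [OF assms(1) this] show ?thesis by simp
  qed
  then have "K \<subseteq> {..<card K}" by auto
  from card_subset_eq [OF finite_lessThan this] have "K = {..<card K}" by simp
  then show ?thesis by blast
qed

definition level :: "nat \<Rightarrow> nat set \<Rightarrow> nat \<Rightarrow> nat" where
  "level s B r = card {k. k * s + r \<in> B}"

lemma level_iff:
  assumes B: "B \<in> core_sets n"
  shows "k * (2 * n + 1) + r \<in> B \<longleftrightarrow> k < level (2 * n + 1) B r"
proof -
  let ?s = "2 * n + 1"
  have fin: "finite B" and cl: "\<And>b. b \<in> B \<Longrightarrow> ?s \<le> b \<Longrightarrow> b - ?s \<in> B"
    using B unfolding core_sets_def sparse_def by blast+
  have "inj (\<lambda>k. k * ?s + r)" by (intro injI) (simp only: add_right_cancel mult_cancel2, simp)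
  then have "finite ((\<lambda>k. k * ?s + r) -` B)" using fin by (intro finite_vimageI)
  then have "finite {k. k * ?s + r \<in> B}" by (simp add: vimage_def)
  moreover have "k \<in> {k. k * ?s + r \<in> B}" if "Suc k \<in> {k. k * ?s + r \<in> B}" for k
  proof -
    have "Suc k * ?s + r - ?s \<in> B" using that by (intro cl) (simp_all only: mem_Collect_eq, simp)
    moreover have "Suc k * ?s + r - ?s = k * ?s + r" by simp
    ultimately show ?thesis by (simp only: mem_Collect_eq)
  qed
  ultimately have "k \<in> {k. k * ?s + r \<in> B} \<longleftrightarrow> k < card {k. k * ?s + r \<in> B}"
    by (rule downward_closed_nat)
  then show ?thesis unfolding level_def mem_Collect_eq .
qed

lemma level_heights:
  assumes n: "1 \<le> n" and B: "B \<in> core_sets n"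
  shows "heights n (level (2 * n + 1) B)"
proof -
  let ?s = "2 * n + 1"
  let ?h = "level ?s B"
  have mem: "k * ?s + r \<in> B \<longleftrightarrow> k < ?h r" for k r by (rule level_iff [OF B])
  have zero: "0 \<notin> B" and adj: "\<And>b. b \<in> B \<Longrightarrow> Suc b \<notin> B"
    and cl: "\<And>b. b \<in> B \<Longrightarrow> 2 * n + 3 \<le> b \<Longrightarrow> b - (2 * n + 3) \<in> B"
    using B unfolding core_sets_def sparse_def by blast+
  show ?thesis
    unfolding heights_def
  proof (intro conjI allI impI)
    show "?h 1 \<le> ?h (2 * n) + 2"
    proof (cases "?h 1 \<le> 2")
      case False
      then have "?h 1 = Suc (Suc (Suc (?h 1 - 3)))" by simp
      then obtain k where k: "?h 1 = Suc (Suc (Suc k))" by blast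
      have "Suc (Suc k) * ?s + 1 \<in> B" unfolding mem k by simp
      moreover have e: "Suc (Suc k) * ?s + 1 = (2 * n + 3) + (k * ?s + 2 * n)" by simp
      have "2 * n + 3 \<le> Suc (Suc k) * ?s + 1" unfolding e by (rule le_add1)
      ultimately have "Suc (Suc k) * ?s + 1 - (2 * n + 3) \<in> B" by (rule cl)
      moreover have "Suc (Suc k) * ?s + 1 - (2 * n + 3) = k * ?s + 2 * n" unfolding e by (rule add_diff_cancel_left')
      ultimately have "k * ?s + 2 * n \<in> B" by (simp only:)
      then have "k < ?h (2 * n)" using mem by blast
      with k show ?thesis by simp
    qed simp
    show "?h 2 \<le> 1"
    proof (rule ccontr)
      assume "\<not> ?h 2 \<le> 1"
      then have "1 * ?s + 2 \<in> B" unfolding mem by linarith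
      moreover have "2 * n + 3 \<le> 1 * ?s + 2" by simp
      ultimately have "1 * ?s + 2 - (2 * n + 3) \<in> B" by (rule cl)
      with zero show False by simp
    qed
  next
    fix r :: nat assume r: "2 \<le> r" "r \<le> 2 * n"
    have "\<not> (0 < ?h r \<and> 0 < ?h (r - 1))"
    proof
      assume "0 < ?h r \<and> 0 < ?h (r - 1)"
      then have "0 * ?s + r \<in> B" "0 * ?s + (r - 1) \<in> B" using mem by blast+
      moreover have "Suc (0 * ?s + (r - 1)) = 0 * ?s + r" using r by simp
      ultimately show False using adj by metis
    qed
    then show "?h r = 0 \<or> ?h (r - 1) = 0" by linarith
  next
    fix r :: nat assume r: "3 \<le> r" "r \<le> 2 * n"
    show "?h r \<le> ?h (r - 2) + 1"
    proof (cases "?h r \<le> 1")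
      case False
      then have "?h r = Suc (Suc (?h r - 2))" by simp
      then obtain k where k: "?h r = Suc (Suc k)" by blast
      have "Suc k * ?s + r \<in> B" unfolding mem k by simp
      then have "Suc k * ?s + r - (2 * n + 3) \<in> B" by (rule cl) (use r in simp)
      moreover have "Suc k * ?s + r - (2 * n + 3) = k * ?s + (r - 2)" using r by simp
      ultimately have "k * ?s + (r - 2) \<in> B" by (simp only:)
      then have "k < ?h (r - 2)" using mem by blast
      with k show ?thesis by simp
    qed simp
  qed
qed

definition word_of :: "nat \<Rightarrow> nat set \<Rightarrow> nat list" where
  "word_of n B = map (\<lambda>i. level (2 * n + 1) B (Suc i)) [0..<2 * n]"

lemma word_of_nth: "1 \<le> r \<Longrightarrow> r \<le> 2 * n \<Longrightarrow> word_of n B ! (r - 1) = level (2 * n + 1) B r"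
  by (cases r) (simp_all add: word_of_def)

lemma heights_cong:
  assumes "1 \<le> n" and eq: "\<And>r. 1 \<le> r \<Longrightarrow> r \<le> 2 * n \<Longrightarrow> h' r = h r" and h: "heights n h"
  shows "heights n h'"
  unfolding heights_def
proof (intro conjI allI impI)
  show "h' 1 \<le> h' (2 * n) + 2" "h' 2 \<le> 1"
    using h assms(1) by (simp_all add: heights_def eq)
next
  fix r :: nat assume "2 \<le> r" "r \<le> 2 * n"
  then show "h' r = 0 \<or> h' (r - 1) = 0" using h eq [of r] eq [of "r - 1"] by (simp add: heights_def)
next
  fix r :: nat assume "3 \<le> r" "r \<le> 2 * n"
  then show "h' r \<le> h' (r - 2) + 1" using h eq [of r] eq [of "r - 2"] by (simp add: heights_def)
qed

lemma runner_set_word_of: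
  assumes B: "B \<in> core_sets n"
  shows "runner_set (2 * n + 1) (\<lambda>r. word_of n B ! (r - 1)) = B" (is "runner_set ?s _ = B")
proof (rule set_eqI)
  fix b
  have "b mod ?s \<le> 2 * n" using mod_less_divisor [of ?s b] by simp
  have mem: "b \<in> B \<longleftrightarrow> b div ?s < level ?s B (b mod ?s)"
    using level_iff [OF B, of "b div ?s" "b mod ?s"] unfolding div_mult_mod_eq .
  show "b \<in> runner_set ?s (\<lambda>r. word_of n B ! (r - 1)) \<longleftrightarrow> b \<in> B"
  proof (cases "b mod ?s = 0")
    case True
    have "0 * ?s + 0 \<notin> B" using B by (simp add: core_sets_def sparse_def)
    then have "level ?s B 0 = 0" using level_iff [OF B, of 0 0] by simp
    then show ?thesis using True mem by (simp add: runner_set_def)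
  next
    case False
    then have "1 \<le> b mod ?s" by linarith
    from word_of_nth [OF this \<open>b mod ?s \<le> 2 * n\<close>]
    have "word_of n B ! (b mod ?s - 1) = level ?s B (b mod ?s)" .
    then show ?thesis using False mem by (simp add: runner_set_def)
  qed
qed

lemma bij_word_of:
  assumes n: "1 \<le> n"
  shows "bij_betw (word_of n) (core_sets n) (closed_words n)"
proof (rule bij_betw_byWitness [where f' = "\<lambda>w. runner_set (2 * n + 1) (\<lambda>r. w ! (r - 1))"])
  let ?s = "2 * n + 1"
  show "\<forall>B\<in>core_sets n. runner_set ?s (\<lambda>r. word_of n B ! (r - 1)) = B"
    by (intro ballI runner_set_word_of)
  show "\<forall>w\<in>closed_words n. word_of n (runner_set ?s (\<lambda>r. w ! (r - 1))) = w"
  proof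
    fix w assume w: "w \<in> closed_words n"
    let ?B = "runner_set ?s (\<lambda>r. w ! (r - 1))"
    have len: "length w = 2 * n" and h: "heights n (\<lambda>r. w ! (r - 1))"
      using w unfolding closed_words_iff [OF n] by blast+
    show "word_of n ?B = w"
    proof (rule nth_equalityI)
      show "length (word_of n ?B) = length w" by (simp add: word_of_def len)
      fix i assume "i < length (word_of n ?B)"
      then have i: "i < 2 * n" by (simp add: word_of_def)
      have "{k. k * ?s + Suc i \<in> ?B} = {..<w ! i}"
        using runner_set_mem [of "Suc i" ?s _ "\<lambda>r. w ! (r - 1)"] i by auto
      then show "word_of n ?B ! i = w ! i" using i by (simp add: word_of_def level_def)
    qed
  qed
  show "word_of n ` core_sets n \<subseteq> closed_words n"
  proof clarify
    fix B assume B: "B \<in> core_sets n"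
    have "heights n (\<lambda>r. word_of n B ! (r - 1))"
    proof (rule heights_cong [OF n _ level_heights [OF n B]])
      fix r assume "1 \<le> r" "r \<le> 2 * n"
      then show "word_of n B ! (r - 1) = level ?s B r" by (rule word_of_nth)
    qed
    moreover have "length (word_of n B) = 2 * n" by (simp add: word_of_def)
    ultimately show "word_of n B \<in> closed_words n"
      unfolding closed_words_iff [OF n] by blast
  qed
  show "(\<lambda>w. runner_set ?s (\<lambda>r. w ! (r - 1))) ` closed_words n \<subseteq> core_sets n"
  proof (rule image_subsetI)
    fix w assume "w \<in> closed_words n"
    then have "heights n (\<lambda>r. w ! (r - 1))" unfolding closed_words_iff [OF n] by blast
    then show "runner_set ?s (\<lambda>r. w ! (r - 1)) \<in> core_sets n" by (rule runner_set_core [OF n])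
  qed
qed

section \<open>Size of a core\<close>

lemma runner_set_image:
  "runner_set (2 * n + 1) h = (\<lambda>(r, k). k * (2 * n + 1) + r) ` (SIGMA r:{1..2 * n}. {..<h r})"
  (is "?B = ?f ` ?S")
proof (intro equalityI subsetI)
  fix b assume b: "b \<in> ?B"
  have "b mod (2 * n + 1) < 2 * n + 1" by (rule mod_less_divisor) simp
  with b have "(b mod (2 * n + 1), b div (2 * n + 1)) \<in> ?S" by (simp add: runner_set_def)
  moreover have "b = ?f (b mod (2 * n + 1), b div (2 * n + 1))"
    unfolding prod.case by (rule div_mult_mod_eq [symmetric])
  ultimately show "b \<in> ?f ` ?S" by (rule rev_image_eqI)
next
  fix b assume "b \<in> ?f ` ?S"
  then obtain r k where rk: "b = k * (2 * n + 1) + r" "1 \<le> r" "r \<le> 2 * n" "k < h r" by auto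
  have "r < 2 * n + 1" using rk(3) by simp
  show "b \<in> ?B" unfolding rk(1) runner_set_mem [OF rk(2) \<open>r < 2 * n + 1\<close>] by (rule rk(4))
qed

lemma runner_inj:
  fixes n :: nat
  shows "inj_on (\<lambda>(r, k). k * (2 * n + 1) + r) (SIGMA r:{1..2 * n}. {..<h r})"
proof (rule inj_onI, clarify)
  fix r k r' k' :: nat
  assume r: "r \<in> {1..2 * n}" "r' \<in> {1..2 * n}" and eq: "k * (2 * n + 1) + r = k' * (2 * n + 1) + r'"
  have *: "(k * (2 * n + 1) + r) mod (2 * n + 1) = r" "(k * (2 * n + 1) + r) div (2 * n + 1) = k"
    if "r \<in> {1..2 * n}" for k r
  proof -
    have "r < 2 * n + 1" using that by simp
    then show "(k * (2 * n + 1) + r) mod (2 * n + 1) = r" "(k * (2 * n + 1) + r) div (2 * n + 1) = k"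
      by (simp_all only: mod_mult_self3 mod_less div_mult_self3 div_less)
  qed
  show "r = r' \<and> k = k'" using *[OF r(1), of k] *[OF r(2), of k'] eq by simp
qed

lemma card_runner_set: "card (runner_set (2 * n + 1) h) = (\<Sum>r=1..2 * n. h r)"
  unfolding runner_set_image card_image [OF runner_inj] by simp

lemma sum_runner_set:
  "real (\<Sum>(runner_set (2 * n + 1) h)) =
   (\<Sum>r=1..2 * n. real r * h r + (2 * real n + 1) * ((real (h r))\<^sup>2 - h r) / 2)"
proof -
  have inner: "(\<Sum>k<m. real (k * (2 * n + 1) + r)) = real r * m + (2 * real n + 1) * ((real m)\<^sup>2 - m) / 2" for m r
    by (induction m) (simp_all add: power2_eq_square field_simps)
  have "real (\<Sum>(runner_set (2 * n + 1) h)) = real (\<Sum>(r, k)\<in>(SIGMA r:{1..2 * n}. {..<h r}). k * (2 * n + 1) + r)"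
    unfolding runner_set_image by (subst sum.reindex [OF runner_inj]) (simp add: case_prod_unfold)
  also have "\<dots> = (\<Sum>r=1..2 * n. \<Sum>k<h r. real (k * (2 * n + 1) + r))"
    by (subst sum.Sigma [symmetric]) (simp_all only: finite_atLeastAtMost finite_lessThan of_nat_sum ball_simps simp_thms ball_triv)
  finally show ?thesis by (simp only: inner)
qed

text \<open>The last bound holds because the heights on the runners \<open>2, 4, \<dots>, 2n\<close> start at most at 1 and rise by at most 1, so reaching
\<open>q\<close> requires \<open>1 + 2 + \<dots> + q\<close> elements. It makes the contribution \<open>n (q + 1)\<^sup>2\<close> of the virtual letter to \<open>n C\<close>
negligible.\<close>

lemma heights_bounds:
  assumes n: "1 \<le> n" and h: "heights n h"
  shows "r \<in> {1..2 * n} \<Longrightarrow> h r \<le> 2 * n + 2"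
    and "h (2 * n) \<le> n"
    and "h (2 * n) * (h (2 * n) + 1) \<le> 2 * (\<Sum>r=1..2 * n. h r)"
proof -
  note h1 = heightsD(1) [OF h] and h2 = heightsD(2) [OF h] and h4 = heightsD(4) [OF h]
  have even: "h (2 * m) \<le> m \<and> h (2 * m) * (h (2 * m) + 1) \<le> 2 * (\<Sum>i=1..m. h (2 * i))"
    if "1 \<le> m" "m \<le> n" for m
    using that
  proof (induction m rule: dec_induct)
    case base
    have "h 2 = 0 \<or> h 2 = 1" using h2 by linarith
    then show ?case by auto
  next
    case (step m)
    let ?x = "h (2 * m)" and ?y = "h (2 * Suc m)"
    have IH: "?x \<le> m" "?x * (?x + 1) \<le> 2 * (\<Sum>i=1..m. h (2 * i))" using step by auto
    have y: "?y \<le> ?x + 1" using h4 [of "2 * Suc m"] step by simp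
    have "?y * (?y + 1) \<le> ?x * (?x + 1) + 2 * ?y"
    proof (cases "?y")
      case (Suc z)
      then have "z \<le> ?x" using y by simp
      then have "z * (z + 1) \<le> ?x * (?x + 1)" by (intro mult_le_mono) auto
      then show ?thesis unfolding Suc by simp
    qed simp
    also have "\<dots> \<le> 2 * (\<Sum>i=1..m. h (2 * i)) + 2 * ?y" using IH(2) by simp
    also have "\<dots> = 2 * (\<Sum>i=1..Suc m. h (2 * i))" by simp
    finally show ?case using y IH(1) by linarith
  qed
  show q: "h (2 * n) \<le> n" using even [of n] n by simp
  have odd: "h (2 * m + 1) \<le> n + 2 + m" if "m < n" for m
    using that
  proof (induction m)
    case 0
    then show ?case using h1 q by simp
  next
    case (Suc m)
    then have "h (2 * Suc m + 1) \<le> h (2 * m + 1) + 1" using h4 [of "2 * Suc m + 1"] by simp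
    with Suc show ?case by simp
  qed
  show "h r \<le> 2 * n + 2" if r: "r \<in> {1..2 * n}"
  proof (cases "even r")
    case True
    then obtain m where "r = 2 * m" by (rule evenE)
    then show ?thesis using even [of m] r by simp
  next
    case False
    then obtain m where m: "r = 2 * m + 1" by (rule oddE)
    then have "m < n" using r by simp
    with odd [of m] m show ?thesis by simp
  qed
  have "(\<Sum>i=1..n. h (2 * i)) = sum h ((*) 2 ` {1..n})"
    by (subst sum.reindex) (auto simp: inj_on_def)
  also have "\<dots> \<le> (\<Sum>r=1..2 * n. h r)"
    by (intro sum_mono2) auto
  finally show "h (2 * n) * (h (2 * n) + 1) \<le> 2 * (\<Sum>r=1..2 * n. h r)"
    using even [of n] n by linarith
qed

text \<open>Besides \<open>n H2\<close> and \<open>H\<^sup>2 / 2\<close> only terms of order \<open>n H\<close> and those with \<open>q\<close> remain. The latter come from the virtual letter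
and are controlled by the two bounds on \<open>q\<close>.\<close>

lemma size_estimate:
  fixes n H H2 R q X :: real
  assumes "1 \<le> n" "0 \<le> H" "0 \<le> q" "q \<le> n" "0 \<le> R" "R \<le> 2 * n * H" "0 \<le> H2" "H2 \<le> (2 * n + 2) * H"
    and q: "q * (q + 1) \<le> 2 * H"
    and X: "X = R + (2 * n + 1) * (H2 - H) / 2 - (H\<^sup>2 - H) / 2"
  shows "\<bar>X - (n * (H2 + (q + 1)\<^sup>2) - (H + q + 1)\<^sup>2 / 2)\<bar> \<le> 5 * (n + 1) * (H + q + 1)"
proof -
  let ?A = "H + q + 1"
  have eq: "X - (n * (H2 + (q + 1)\<^sup>2) - ?A\<^sup>2 / 2) =
     (R - n * H) + H2 / 2 + H * (q + 1) + (q + 1)\<^sup>2 / 2 - n * (q + 1)\<^sup>2"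
    unfolding X by (simp add: power2_eq_square field_simps)
  have q2: "(q + 1)\<^sup>2 \<le> 2 * ?A" using q \<open>0 \<le> q\<close> by (simp add: power2_eq_square algebra_simps)
  have nH: "n * H \<le> n * ?A" using assms by (intro mult_left_mono) auto
  have nq: "n * (q + 1)\<^sup>2 \<le> n * (2 * ?A)" using assms q2 by (intro mult_left_mono) auto
  have Hq: "H * (q + 1) \<le> ?A * (n + 1)" using assms by (intro mult_mono) auto
  have H2: "H2 / 2 \<le> (n + 1) * ?A"
  proof -
    have "H2 / 2 \<le> (n + 1) * H" using assms by (simp add: field_simps)
    also have "\<dots> \<le> (n + 1) * ?A" using assms by (intro mult_left_mono) auto
    finally show ?thesis .
  qed
  have nn: "0 \<le> H * (q + 1)" "0 \<le> (q + 1)\<^sup>2" "0 \<le> n * (q + 1)\<^sup>2" "0 \<le> n * H" "0 \<le> n * ?A" using assms by auto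
  have exp: "5 * (n + 1) * ?A = 5 * (n * ?A) + 5 * ?A" "(n + 1) * ?A = n * ?A + ?A" "?A * (n + 1) = n * ?A + ?A"
    "n * (2 * ?A) = 2 * (n * ?A)" "2 * n * H = 2 * (n * H)"
    by (simp_all add: algebra_simps)
  have A0: "0 \<le> ?A" using assms by simp
  have gen: "\<bar>(R - x) + H2 / 2 + z + s / 2 - w\<bar> \<le> 5 * y + 5 * a"
    if "x \<le> y" "w \<le> 2 * y" "z \<le> y + a" "H2 / 2 \<le> y + a" "s \<le> 2 * a" "0 \<le> z" "0 \<le> s" "0 \<le> w"
      "0 \<le> x" "0 \<le> y" "R \<le> 2 * x" "0 \<le> a" for x y z s w a
  proof (rule abs_leI)
    have "R - x \<le> y" using that(1,11) by linarith
    then have "(R - x) + H2 / 2 + z + s / 2 - w \<le> y + (y + a) + (y + a) + a" using that(3,4,5,8) by linarith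
    then show "(R - x) + H2 / 2 + z + s / 2 - w \<le> 5 * y + 5 * a" using that(10,12) by linarith
    have "x - R \<le> y" using that(1) \<open>0 \<le> R\<close> by linarith
    then have "- ((R - x) + H2 / 2 + z + s / 2 - w) \<le> y + 2 * y" using that(2,6,7) \<open>0 \<le> H2\<close> by linarith
    then show "- ((R - x) + H2 / 2 + z + s / 2 - w) \<le> 5 * y + 5 * a" using that(10,12) by linarith
  qed
  show ?thesis
    unfolding eq exp(1)
    by (rule gen [OF nH nq [unfolded exp] Hq [unfolded exp] H2 [unfolded exp] q2 nn
      \<open>R \<le> 2 * n * H\<close> [unfolded exp] A0])
qed

lemma core_word_bijection:
  assumes n: "1 \<le> n"
  shows "bij_betw (word_of n \<circ> beta) (distinct_cores n) (closed_words n)"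
  using bij_beta bij_word_of [OF n] by (rule bij_betw_trans)

lemma core_size:
  assumes n: "1 \<le> n" and p: "p \<in> distinct_cores n"
  defines "w \<equiv> word_of n (beta p)"
  shows "\<bar>partition_size p - (real n * real (wC w) - (real (wA w))\<^sup>2 / 2)\<bar> \<le> 5 * (real n + 1) * real (wA w)"
proof -
  define h where "h r = w ! (r - 1)" for r
  have B: "beta p \<in> core_sets n" and sp: "strict_part p" using p by (auto simp: distinct_cores_iff)
  have Bh: "beta p = runner_set (2 * n + 1) h"
    unfolding h_def w_def by (rule runner_set_word_of [OF B, symmetric])
  have "w \<in> closed_words n"
    using bij_betw_apply [OF bij_word_of [OF n] B] by (simp add: w_def)
  then have len: "length w = 2 * n" and hh: "heights n h"
    unfolding closed_words_iff [OF n] h_def by blast+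
  have last: "last (0 # w) = h (2 * n)"
  proof -
    have "w \<noteq> []" using n len by auto
    then show ?thesis by (simp add: last_conv_nth h_def len)
  qed
  have sl: "sum_list (map f w) = (\<Sum>r=1..2 * n. f (h r))" for f :: "nat \<Rightarrow> nat"
  proof -
    have "sum_list (map f w) = (\<Sum>i=0..<2 * n. f (w ! i))" by (simp add: sum_list_sum_nth len)
    also have "\<dots> = (\<Sum>r=1..2 * n. f (h r))"
      by (rule sum.reindex_bij_witness [of _ "\<lambda>r. r - 1" "\<lambda>i. i + 1"]) (auto simp: h_def)
    finally show ?thesis .
  qed
  define q where "q = real (h (2 * n))"
  define H where "H = real (\<Sum>r=1..2 * n. h r)"
  define H2 where "H2 = (\<Sum>r=1..2 * n. (real (h r))\<^sup>2)"
  define R where "R = (\<Sum>r=1..2 * n. real r * h r)"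
  have A: "real (wA w) = H + q + 1"
    using sl [of "\<lambda>x. x"] unfolding wA_def last H_def q_def by simp
  have C: "real (wC w) = H2 + (q + 1)\<^sup>2"
    using sl [of "\<lambda>x. x\<^sup>2"] unfolding wC_def last H2_def q_def by (simp add: add.commute)
  have "real (\<Sum>(beta p)) = R + (2 * real n + 1) * (H2 - H) / 2"
    unfolding Bh sum_runner_set R_def H2_def H_def
    by (simp add: sum.distrib sum_subtractf sum_distrib_left sum_divide_distrib right_diff_distrib diff_divide_distrib)
  moreover have "2 * real (\<Sum>(beta p)) = 2 * partition_size p + (H\<^sup>2 - H)"
  proof -
    have l: "real (length p) = H" using card_beta [OF sp] card_runner_set [of n h] Bh by (simp add: H_def)
    have "real (2 * \<Sum>(beta p)) = real (2 * sum_list p + length p * (length p - 1))"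
      by (simp only: sum_beta [OF sp])
    moreover have "real (length p * (length p - 1)) = H\<^sup>2 - H"
      unfolding l [symmetric] by (cases p) (simp_all add: power2_eq_square algebra_simps)
    ultimately show ?thesis by (simp add: partition_size_def)
  qed
  ultimately have X: "partition_size p = R + (2 * real n + 1) * (H2 - H) / 2 - (H\<^sup>2 - H) / 2"
    by (simp add: field_simps)
  show ?thesis
    unfolding A C
  proof (rule size_estimate)
    show "partition_size p = R + (2 * real n + 1) * (H2 - H) / 2 - (H\<^sup>2 - H) / 2" by (rule X)
    show "1 \<le> real n" using n by simp
    show "0 \<le> H" "0 \<le> q" "0 \<le> R" "0 \<le> H2" by (simp_all add: H_def q_def R_def H2_def sum_nonneg)
    show "q \<le> real n" using heights_bounds(2) [OF n hh] by (simp add: q_def)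
    show "R \<le> 2 * real n * H"
      unfolding R_def H_def of_nat_sum sum_distrib_left by (intro sum_mono mult_right_mono) auto
    show "H2 \<le> (2 * real n + 2) * H"
      unfolding H2_def H_def of_nat_sum sum_distrib_left power2_eq_square
    proof (intro sum_mono mult_right_mono)
      fix r assume "r \<in> {1..2 * n}"
      from heights_bounds(1) [OF n hh this] have "real (h r) \<le> real (2 * n + 2)" by (rule of_nat_mono)
      then show "real (h r) \<le> 2 * real n + 2" by simp
    qed simp
    have "real (h (2 * n) * (h (2 * n) + 1)) \<le> real (2 * (\<Sum>r=1..2 * n. h r))"
      using heights_bounds(3) [OF n hh] by (rule of_nat_mono)
    then show "q * (q + 1) \<le> 2 * H" by (simp add: q_def H_def algebra_simps)
  qed
qed

section \<open>Values of the leading coefficients\<close>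

text \<open>The values of \<open>yc\<close>, \<open>jc\<close>, \<open>gc\<close> for \<open>a + 2 b \<le> 10\<close>, multiplied by \<open>8\<^bsup>a+b\<^esup>\<close>, which makes them integers; the row is \<open>b\<close>, the position in it \<open>a\<close>. The
tables are verified against the recursions, not derived from them: evaluating the recursions directly would repeat the
same calls exponentially often.\<close>

definition ytab :: "nat \<Rightarrow> nat \<Rightarrow> int" where
  "ytab a b = [[1, -2, -10, -120, -2210, -54240, -1656500, -60441600, -2564063050, -123998092800, -6733922487500],
    [-2, -36, -884, -27120, -993900, -42309120, -2051250440, -111598283520, -6733922487500],
    [-38, -2448, -138012, -7955040, -487129668, -32040645120, -2268256278680],
    [-2524, -342864, -34574024, -3220988160, -297363991624],
    [-348634, -81173952, -12843024172],
    [-81967132]] ! b ! a"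

definition jtab :: "nat \<Rightarrow> nat \<Rightarrow> int" where
  "jtab a b = [[1, 4, 50, 960, 24310, 759360, 28160500, 1208832000, 58973450150, 3223950412800, 195283752137500],
    [6, 216, 7956, 325440, 14908500, 761564160, 43076259240, 2678358804480, 181815907162500],
    [266, 24480, 1794156, 127280640, 9255463692, 704894192640, 56706406967000],
    [27764, 4800096, 587758408, 64419763200, 6839371807352],
    [5229510, 1461131136, 269703507612],
    [1557375508]] ! b ! a"

definition gtab :: "nat \<Rightarrow> nat \<Rightarrow> int" where
  "gtab a b = [[1, 6, 72, 1284, 30528, 909396, 32579712, 1363872264, 65319211008, 3521663939076, 211055963830272],
    [8, 280, 9840, 386464, 17158656, 856257648, 47593294848, 2920262819200, 196216805234688],
    [320, 28644, 2046912, 142299112, 10186248960, 766394141016, 61067903809536],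
    [31232, 5319600, 643094208, 69752599168, 7343192051712],
    [5672960, 1572827828, 288355862784],
    [1655472128]] ! b ! a"

text \<open>An executable form of \<open>convI\<close>.\<close>

definition convL :: "(nat \<Rightarrow> nat \<Rightarrow> int) \<Rightarrow> (nat \<Rightarrow> nat \<Rightarrow> int) \<Rightarrow> nat \<Rightarrow> nat \<Rightarrow> int" where
  "convL f g a b = (\<Sum>i\<leftarrow>[0..<Suc a]. \<Sum>j\<leftarrow>[0..<Suc b].
     if i = 0 \<and> j = 0 \<or> i = a \<and> j = b then 0 else f i j * g (a - i) (b - j))"

lemma convI_eq_convL: "convI f g a b = convL f g a b"
proof -
  let ?P = "\<lambda>i j. i = 0 \<and> j = 0 \<or> i = a \<and> j = b"
  have "convI f g a b = (\<Sum>(i, j)\<in>{..a} \<times> {..b}. if ?P i j then 0 else f i j * g (a - i) (b - j))"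
    unfolding convI_def by (rule sum.mono_neutral_cong_left) (auto split: if_split_asm)
  also have "\<dots> = (\<Sum>i\<le>a. \<Sum>j\<le>b. if ?P i j then 0 else f i j * g (a - i) (b - j))"
    by (rule sum.cartesian_product [symmetric])
  also have "\<dots> = convL f g a b"
    unfolding convL_def interv_sum_list_conv_sum_set_nat by (simp only: set_upt atLeast0LessThan lessThan_Suc_atMost)
  finally show ?thesis .
qed

definition indices :: "(nat \<times> nat) list" where
  "indices = [(a, b). b \<leftarrow> [0..<6], a \<leftarrow> [0..<11 - 2 * b]]"

lemma indices_iff: "(a, b) \<in> set indices \<longleftrightarrow> a + 2 * b \<le> 10"
  unfolding indices_def by (auto intro!: bexI [of _ b])

lemma tables_check:
  "list_all (\<lambda>(a, b). a = 0 \<and> b = 0 \<or>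
     2 * ytab a b = (if a = 0 then 0 else 4 * (3 * int a + 4 * int b - 4) * ytab (a - 1) b)
       + (if b = 0 then 0 else 2 * (int a + 1) * ytab (a + 1) (b - 1)) - convL ytab ytab a b \<and>
     2 * jtab a b = (if a = 0 then 0 else 4 * (3 * int a + 4 * int b - 2) * jtab (a - 1) b)
       + (if b = 0 then 0 else 2 * (int a + 1) * jtab (a + 1) (b - 1)) - 2 * ytab a b - 2 * convL ytab jtab a b \<and>
     gtab a b = jtab a b - ytab a b - convL ytab gtab a b) indices"
  by code_simp

lemma convI_scaled:
  assumes "\<And>i j. i \<le> a \<Longrightarrow> j \<le> b \<Longrightarrow> (i, j) \<noteq> (a, b) \<Longrightarrow> real_of_int (F i j) = 8 ^ (i + j) * f i j"
    and "\<And>i j. i \<le> a \<Longrightarrow> j \<le> b \<Longrightarrow> (i, j) \<noteq> (a, b) \<Longrightarrow> real_of_int (G i j) = 8 ^ (i + j) * g i j"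
  shows "real_of_int (convI F G a b) = 8 ^ (a + b) * convI f g a b"
  unfolding convI_def of_int_sum sum_distrib_left
proof (rule sum.cong [OF refl])
  fix p assume "p \<in> {..a} \<times> {..b} - {(0, 0), (a, b)}"
  then obtain i j where p: "p = (i, j)" "i \<le> a" "j \<le> b" "(i, j) \<noteq> (a, b)" "(i, j) \<noteq> (0, 0)"
    by (cases p) auto
  then have "(a - i, b - j) \<noteq> (a, b)" by auto
  have "(8 :: real) ^ (a + b) = 8 ^ (i + j) * 8 ^ (a - i + (b - j))"
    using p by (simp flip: power_add)
  then show "real_of_int (case p of (i, j) \<Rightarrow> F i j * G (a - i) (b - j)) =
      8 ^ (a + b) * (case p of (i, j) \<Rightarrow> f i j * g (a - i) (b - j))"
    using assms(1) [of i j] assms(2) [of "a - i" "b - j"] p \<open>(a - i, b - j) \<noteq> (a, b)\<close> by simp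
qed

lemma lexless_le: "i \<le> a \<Longrightarrow> j \<le> b \<Longrightarrow> (i, j) \<noteq> (a, b) \<Longrightarrow> lexless (i, j) (a, b)"
  by (auto simp: lexless_def)

lemma yc_table: "a + 2 * b \<le> 10 \<Longrightarrow> real_of_int (ytab a b) = 8 ^ (a + b) * yc a b"
proof (induction a b rule: lexless_induct)
  case (less a b)
  show ?case
  proof (cases "(a, b) = (0, 0)")
    case True
    then show ?thesis by (simp add: ytab_def)
  next
    case False
    from tables_check less.prems False have "2 * ytab a b =
        (if a = 0 then 0 else 4 * (3 * int a + 4 * int b - 4) * ytab (a - 1) b)
        + (if b = 0 then 0 else 2 * (int a + 1) * ytab (a + 1) (b - 1)) - convI ytab ytab a b"
      unfolding list_all_iff convI_eq_convL using indices_iff [of a b] by fastforce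
    from arg_cong [OF this, of real_of_int] have "2 * real_of_int (ytab a b) =
        (if a = 0 then 0 else 4 * (3 * real a + 4 * real b - 4) * real_of_int (ytab (a - 1) b))
        + (if b = 0 then 0 else 2 * (real a + 1) * real_of_int (ytab (a + 1) (b - 1))) - real_of_int (convI ytab ytab a b)"
      by simp
    also have "real_of_int (convI ytab ytab a b) = 8 ^ (a + b) * convI yc yc a b"
      using less.prems by (intro convI_scaled less.IH lexless_le) auto
    also have "(if a = 0 then 0 else 4 * (3 * real a + 4 * real b - 4) * real_of_int (ytab (a - 1) b))
        = 8 ^ (a + b) * (if a = 0 then 0 else (3 * real a + 4 * real b - 4) / 2 * yc (a - 1) b)"
      using less.prems less.IH [of "a - 1" b] by (cases a) (simp_all add: lexless_def)
    also have "(if b = 0 then 0 else 2 * (real a + 1) * real_of_int (ytab (a + 1) (b - 1)))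
        = 8 ^ (a + b) * (if b = 0 then 0 else 2 * (real a + 1) * yc (a + 1) (b - 1))"
      using less.prems less.IH [of "a + 1" "b - 1"] by (cases b) (simp_all add: lexless_def)
    finally have "2 * real_of_int (ytab a b) = 8 ^ (a + b) * (Lop 1 yc a b - convI yc yc a b)"
      by (simp add: Lop_def distrib_left right_diff_distrib)
    then show ?thesis unfolding yc_rec [OF False, symmetric] by simp
  qed
qed

lemma jc_table: "a + 2 * b \<le> 10 \<Longrightarrow> real_of_int (jtab a b) = 8 ^ (a + b) * jc a b"
proof (induction a b rule: lexless_induct)
  case (less a b)
  show ?case
  proof (cases "(a, b) = (0, 0)")
    case True
    then show ?thesis by (simp add: jtab_def)
  next
    case False
    from tables_check less.prems False have "2 * jtab a b =
        (if a = 0 then 0 else 4 * (3 * int a + 4 * int b - 2) * jtab (a - 1) b)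
        + (if b = 0 then 0 else 2 * (int a + 1) * jtab (a + 1) (b - 1)) - 2 * ytab a b - 2 * convI ytab jtab a b"
      unfolding list_all_iff convI_eq_convL using indices_iff [of a b] by fastforce
    from arg_cong [OF this, of real_of_int] have "2 * real_of_int (jtab a b) =
        (if a = 0 then 0 else 4 * (3 * real a + 4 * real b - 2) * real_of_int (jtab (a - 1) b))
        + (if b = 0 then 0 else 2 * (real a + 1) * real_of_int (jtab (a + 1) (b - 1)))
        - 2 * real_of_int (ytab a b) - 2 * real_of_int (convI ytab jtab a b)"
      by simp
    also have "real_of_int (convI ytab jtab a b) = 8 ^ (a + b) * convI yc jc a b"
      using less.prems by (intro convI_scaled less.IH lexless_le yc_table) auto
    also have "(if a = 0 then 0 else 4 * (3 * real a + 4 * real b - 2) * real_of_int (jtab (a - 1) b))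
        = 8 ^ (a + b) * (if a = 0 then 0 else (3 * real a + 4 * real b - 2) / 2 * jc (a - 1) b)"
      using less.prems less.IH [of "a - 1" b] by (cases a) (simp_all add: lexless_def)
    also have "(if b = 0 then 0 else 2 * (real a + 1) * real_of_int (jtab (a + 1) (b - 1)))
        = 8 ^ (a + b) * (if b = 0 then 0 else 2 * (real a + 1) * jc (a + 1) (b - 1))"
      using less.prems less.IH [of "a + 1" "b - 1"] by (cases b) (simp_all add: lexless_def)
    also have "real_of_int (ytab a b) = 8 ^ (a + b) * yc a b" by (rule yc_table [OF less.prems])
    finally have "2 * real_of_int (jtab a b) = 8 ^ (a + b) * (Lop (-1) jc a b - 2 * yc a b - 2 * convI yc jc a b)"
      by (simp add: Lop_def distrib_left right_diff_distrib)
    also have "Lop (-1) jc a b - 2 * yc a b - 2 * convI yc jc a b = 2 * jc a b" using jc_rec [OF False] by simp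
    finally show ?thesis by simp
  qed
qed

lemma gc_table: "a + 2 * b \<le> 10 \<Longrightarrow> real_of_int (gtab a b) = 8 ^ (a + b) * gc a b"
proof (induction a b rule: lexless_induct)
  case (less a b)
  show ?case
  proof (cases "(a, b) = (0, 0)")
    case True
    then show ?thesis by (simp add: gtab_def)
  next
    case False
    from tables_check less.prems False have "gtab a b = jtab a b - ytab a b - convI ytab gtab a b"
      unfolding list_all_iff convI_eq_convL using indices_iff [of a b] by fastforce
    from arg_cong [OF this, of real_of_int] have "real_of_int (gtab a b) =
        real_of_int (jtab a b) - real_of_int (ytab a b) - real_of_int (convI ytab gtab a b)"
      by simp
    also have "real_of_int (convI ytab gtab a b) = 8 ^ (a + b) * convI yc gc a b"
      using less.prems by (intro convI_scaled less.IH lexless_le yc_table) auto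
    finally show ?thesis
      using gc_rec [OF False] yc_table [OF less.prems] jc_table [OF less.prems] by (simp add: right_diff_distrib)
  qed
qed

lemma gc_value: "a + 2 * b \<le> 10 \<Longrightarrow> gc a b = real_of_int (gtab a b) / 8 ^ (a + b)"
  using gc_table [of a b] by simp

lemma gc_values:
  "gc 0 (Suc 0) = 1" "gc 2 0 = 9 / 8" "gc 0 2 = 5" "gc 2 (Suc 0) = 615 / 32"
  "gc 4 0 = 477 / 64" "gc 0 3 = 61" "gc 2 2 = 31983 / 64" "gc 4 (Suc 0) = 33513 / 64"
  "gc 6 0 = 254529 / 2048" "gc 0 4 = 1385" "gc 2 3 = 10048347 / 512" "gc 4 2 = 39790035 / 1024"
  "gc 6 (Suc 0) = 46477827 / 2048" "gc 8 0 = 15947073 / 4096" "gc 0 5 = 50521" "gc 2 4 = 1126390089 / 1024"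
  "gc 4 3 = 1792771497 / 512" "gc 6 2 = 29818312407 / 8192" "gc 8 (Suc 0) = 95808986931 / 65536" "gc 10 0 = 103054669839 / 524288"
  by (simp_all add: gc_value gtab_def)

text \<open>The limit of the \<open>k\<close>-th moment of \<open>C/n\<^sup>2 - (A/n\<^bsup>3/2\<^esup>)\<^sup>2/2\<close>, expanded binomially. The Gamma values are factorials because \<open>A\<close>
occurs in even powers only.\<close>

definition mu :: "nat \<Rightarrow> real" where
  "mu k = (\<Sum>j\<le>k. of_nat (k choose j) * (- 1 / 2) ^ j *
     (fact (2 * j) * fact (k - j) * gc (2 * j) (k - j) / fact (2 * k + j)))"

lemma binomial_values:
  "(3::nat) choose 2 = 3" "(4::nat) choose 2 = 6" "(4::nat) choose 3 = 4"
  "(5::nat) choose 2 = 10" "(5::nat) choose 3 = 10" "(5::nat) choose 4 = 5"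
  by code_simp+

lemma mu_upt: "mu k = (\<Sum>j\<leftarrow>[0..<Suc k]. of_nat (k choose j) * (- 1 / 2) ^ j *
     (fact (2 * j) * fact (k - j) * gc (2 * j) (k - j) / fact (2 * k + j)))"
  unfolding mu_def interv_sum_list_conv_sum_set_nat by (simp only: set_upt atLeast0LessThan lessThan_Suc_atMost)

lemma upt_values: "[0..<3] = [0, 1, 2]" "[0..<4] = [0, 1, 2, 3]" "[0..<5] = [0, 1, 2, 3, 4]"
  "[0..<6] = [0, 1, 2, 3, 4, 5]"
  by code_simp+

lemma mu_values:
  "mu 1 = 5 / 16" "mu 2 = 1217 / 7680" "mu 3 = 1601353 / 13762560" "mu 4 = 3264219 / 28835840"
  "mu 5 = 226724203201 / 1648864788480"
  unfolding mu_upt by (simp_all add: gc_values binomial_values upt_values fact_numeral power_divide)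

section \<open>Moments of the size\<close>

lemma distinct_cores_finite:
  assumes "1 \<le> n"
  shows "finite (distinct_cores n)" "distinct_cores n \<noteq> {}" "card (distinct_cores n) = card (closed_words n)"
proof -
  note bij = core_word_bijection [OF assms]
  show "finite (distinct_cores n)" using bij_betw_finite [OF bij] by simp
  show "card (distinct_cores n) = card (closed_words n)" by (rule bij_betw_same_card [OF bij])
  have "[] \<in> distinct_cores n"
    by (simp add: distinct_cores_def is_core_def is_partition_def cells_def)
  then show "distinct_cores n \<noteq> {}" by blast
qed

definition mean :: "nat \<Rightarrow> (nat list \<Rightarrow> real) \<Rightarrow> real" where
  "mean n f = (\<Sum>p\<in>distinct_cores n. f p) / card (distinct_cores n)"

lemma expectation_core_pmf:
  assumes "1 \<le> n"
  shows "measure_pmf.expectation (core_pmf n) f = mean n f"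
  unfolding core_pmf_def mean_def
  by (rule integral_pmf_of_set [OF distinct_cores_finite(2,1) [OF assms]])

lemma mean_add: "mean n (\<lambda>p. f p + g p) = mean n f + mean n g"
  and mean_diff: "mean n (\<lambda>p. f p - g p) = mean n f - mean n g"
  and mean_cmult: "mean n (\<lambda>p. c * f p) = c * mean n f"
  and mean_sum: "mean n (\<lambda>p. \<Sum>i\<in>S. F i p) = (\<Sum>i\<in>S. mean n (F i))"
  by (simp_all add: mean_def sum.distrib sum_subtractf add_divide_distrib diff_divide_distrib
      sum_distrib_left sum_divide_distrib sum.swap [of _ _ S])

lemma mean_const: "1 \<le> n \<Longrightarrow> mean n (\<lambda>p. c) = c"
  using distinct_cores_finite(1,2) [of n] by (simp add: mean_def)

lemma mean_mono: "(\<And>p. p \<in> distinct_cores n \<Longrightarrow> f p \<le> g p) \<Longrightarrow> mean n f \<le> mean n g"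
  unfolding mean_def by (intro divide_right_mono sum_mono) auto

text \<open>The statistics scaled to have convergent moments.\<close>

definition Aw :: "nat \<Rightarrow> nat list \<Rightarrow> real" where
  "Aw n p = real (wA (word_of n (beta p))) / real n powr (3 / 2)"

definition Cw :: "nat \<Rightarrow> nat list \<Rightarrow> real" where
  "Cw n p = real (wC (word_of n (beta p))) / (real n)\<^sup>2"

definition Xw :: "nat \<Rightarrow> nat list \<Rightarrow> real" where
  "Xw n p = partition_size p / real n ^ 3"

definition mom :: "nat \<Rightarrow> nat \<Rightarrow> real" where
  "mom a b = fact a * fact b * gc a b / Gamma (1 + (3 / 2 * real a + 2 * real b))"

lemma AC_nonneg: "0 \<le> Aw n p" "0 \<le> Cw n p"
  by (simp_all add: Aw_def Cw_def)

text \<open>Moments of all orders converge, odd powers of \<open>A\<close> included; the latter serve to bound the error terms.\<close>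

lemma mean_AC: "(\<lambda>n. mean n (\<lambda>p. Aw n p ^ a * Cw n p ^ b)) \<longlonglongrightarrow> mom a b"
proof (rule Lim_transform_eventually)
  show "(\<lambda>n. msum a b n / card (closed_words n) / real n powr (3 / 2 * real a + 2 * real b)) \<longlonglongrightarrow> mom a b"
    unfolding mom_def by (rule moment_asymp)
  show "eventually (\<lambda>n. msum a b n / card (closed_words n) / real n powr (3 / 2 * real a + 2 * real b) =
      mean n (\<lambda>p. Aw n p ^ a * Cw n p ^ b)) sequentially"
    using eventually_ge_at_top [of 1]
  proof eventually_elim
    case (elim n)
    let ?f = "\<lambda>p. word_of n (beta p)"
    have pw: "real n powr (3 / 2 * real a + 2 * real b) = (real n powr (3 / 2)) ^ a * ((real n)\<^sup>2) ^ b"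
    proof -
      have "real n powr (3 / 2 * real a) = (real n powr (3 / 2)) ^ a"
        using elim powr_realpow [of "real n powr (3 / 2)" a] by (simp add: powr_powr)
      moreover have "real n powr (2 * real b) = ((real n)\<^sup>2) ^ b"
        using elim powr_realpow [of "real n" "2 * b"] by (simp add: power_mult)
      ultimately show ?thesis by (simp add: powr_add)
    qed
    have "msum a b n = (\<Sum>p\<in>distinct_cores n. real (wA (?f p)) ^ a * real (wC (?f p)) ^ b)"
      unfolding msum_def using sum.reindex_bij_betw [OF core_word_bijection [OF elim], of "\<lambda>w. real (wA w) ^ a * real (wC w) ^ b"]
      by (simp add: o_def)
    also have "\<dots> = real n powr (3 / 2 * real a + 2 * real b) * (\<Sum>p\<in>distinct_cores n. Aw n p ^ a * Cw n p ^ b)"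
      unfolding sum_distrib_left
    proof (rule sum.cong [OF refl])
      fix p
      have s: "real n powr (3 / 2) \<noteq> 0" "(real n)\<^sup>2 \<noteq> 0" using elim by auto
      have "x ^ a * y ^ b = s ^ a * t ^ b * ((x / s) ^ a * (y / t) ^ b)" if "s \<noteq> 0" "t \<noteq> 0" for x y s t :: real
        using that by (simp add: power_divide)
      from this [OF s] show "real (wA (?f p)) ^ a * real (wC (?f p)) ^ b =
          real n powr (3 / 2 * real a + 2 * real b) * (Aw n p ^ a * Cw n p ^ b)"
        unfolding pw Aw_def Cw_def .
    qed
    finally have "msum a b n = real n powr (3 / 2 * real a + 2 * real b) * (\<Sum>p\<in>distinct_cores n. Aw n p ^ a * Cw n p ^ b)" .
    moreover have "real n powr (3 / 2 * real a + 2 * real b) \<noteq> 0" using elim by simp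
    ultimately show ?case
      by (simp add: mean_def distinct_cores_finite(3) [OF elim])
  qed
qed

lemma X_close:
  assumes n: "1 \<le> n" and p: "p \<in> distinct_cores n"
  shows "\<bar>Xw n p - (Cw n p - (Aw n p)\<^sup>2 / 2)\<bar> \<le> 10 * Aw n p / sqrt (real n)"
proof -
  let ?A = "real (wA (word_of n (beta p)))" and ?C = "real (wC (word_of n (beta p)))"
  let ?n = "real n"
  have pos: "0 < ?n" using n by simp
  have p32: "?n powr (3 / 2) = ?n * sqrt ?n"
    using pos powr_add [of ?n 1 "1 / 2"] by (simp add: powr_half_sqrt)
  have sq: "(?n powr (3 / 2))\<^sup>2 = ?n ^ 3"
    unfolding p32 using pos by (simp add: power_mult_distrib power2_eq_square power3_eq_cube)
  have "Xw n p - (Cw n p - (Aw n p)\<^sup>2 / 2) = (partition_size p - (?n * ?C - ?A\<^sup>2 / 2)) / ?n ^ 3"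
    unfolding Xw_def Cw_def Aw_def power_divide sq using pos
    by (simp add: field_simps power2_eq_square power3_eq_cube)
  also have "\<bar>\<dots>\<bar> \<le> (10 * ?n * ?A) / ?n ^ 3"
  proof -
    have "5 * (?n + 1) * ?A \<le> 10 * ?n * ?A" using n by (intro mult_right_mono) auto
    with core_size [OF n p] have "\<bar>partition_size p - (?n * ?C - ?A\<^sup>2 / 2)\<bar> \<le> 10 * ?n * ?A" by linarith
    then show ?thesis using pos by (simp add: abs_divide divide_right_mono)
  qed
  also have "\<dots> = 10 * Aw n p / sqrt ?n"
  proof -
    have "sqrt ?n * sqrt ?n = ?n" "sqrt ?n \<noteq> 0" using pos by simp_all
    then show ?thesis unfolding Aw_def p32 using pos
      by (simp add: field_simps power3_eq_cube)
  qed
  finally show ?thesis .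
qed

lemma power_diff_bound:
  fixes x y :: real
  shows "\<bar>x ^ Suc k - y ^ Suc k\<bar> \<le> real (Suc k) * \<bar>x - y\<bar> * (\<bar>x\<bar> + \<bar>y\<bar>) ^ k"
proof -
  have "x ^ Suc k - y ^ Suc k = (x - y) * (\<Sum>i<Suc k. y ^ (Suc k - Suc i) * x ^ i)"
    by (rule power_diff_sumr2)
  then have "\<bar>x ^ Suc k - y ^ Suc k\<bar> = \<bar>x - y\<bar> * \<bar>\<Sum>i<Suc k. y ^ (Suc k - Suc i) * x ^ i\<bar>"
    by (simp only: abs_mult)
  also have "\<dots> \<le> \<bar>x - y\<bar> * (\<Sum>i<Suc k. (\<bar>x\<bar> + \<bar>y\<bar>) ^ k)"
  proof (intro mult_left_mono order_trans [OF sum_abs] sum_mono)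
    fix i assume "i \<in> {..<Suc k}"
    then have "k = (Suc k - Suc i) + i" by simp
    then have "(\<bar>x\<bar> + \<bar>y\<bar>) ^ k = (\<bar>x\<bar> + \<bar>y\<bar>) ^ (Suc k - Suc i) * (\<bar>x\<bar> + \<bar>y\<bar>) ^ i"
      by (metis power_add)
    moreover have "\<bar>y\<bar> ^ (Suc k - Suc i) * \<bar>x\<bar> ^ i \<le> (\<bar>x\<bar> + \<bar>y\<bar>) ^ (Suc k - Suc i) * (\<bar>x\<bar> + \<bar>y\<bar>) ^ i"
      by (intro mult_mono power_mono) auto
    ultimately show "\<bar>y ^ (Suc k - Suc i) * x ^ i\<bar> \<le> (\<bar>x\<bar> + \<bar>y\<bar>) ^ k"
      by (simp add: abs_mult power_abs)
  qed simp
  finally show ?thesis by (simp add: mult_ac)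
qed

lemma power_three_bound:
  fixes a b c :: real
  assumes "0 \<le> a" "0 \<le> b" "0 \<le> c"
  shows "(a + b + c) ^ k \<le> 3 ^ k * (a ^ k + b ^ k + c ^ k)"
proof -
  define m where "m = max a (max b c)"
  have "(a + b + c) ^ k \<le> (3 * m) ^ k" using assms by (intro power_mono) (auto simp: m_def)
  also have "\<dots> = 3 ^ k * m ^ k" by (rule power_mult_distrib)
  also have "m ^ k \<le> a ^ k + b ^ k + c ^ k"
    using assms zero_le_power [of a k] zero_le_power [of b k] zero_le_power [of c k]
    unfolding m_def max_def by (auto split: if_split)
  finally show ?thesis by simp
qed

text \<open>The error of \<open>X_close\<close> is of order \<open>n\<^bsup>-1/2\<^esup>\<close> times polynomials in \<open>A\<close> and \<open>C\<close> whose means stay bounded.\<close>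

lemma mean_X: "(\<lambda>n. mean n (\<lambda>p. Xw n p ^ Suc k)) \<longlonglongrightarrow> mu (Suc k)"
proof -
  let ?Y = "\<lambda>n p. Cw n p - (Aw n p)\<^sup>2 / 2"
  let ?K = "10 * real (Suc k) * 3 ^ k"
  let ?E = "\<lambda>n. 2 ^ k * mean n (\<lambda>p. Aw n p ^ 1 * Cw n p ^ k) + 2 ^ k * mean n (\<lambda>p. Aw n p ^ (2 * k + 1) * Cw n p ^ 0)
      + 10 ^ k * mean n (\<lambda>p. Aw n p ^ (k + 1) * Cw n p ^ 0)"
  have Y: "(\<lambda>n. mean n (\<lambda>p. ?Y n p ^ Suc k)) \<longlonglongrightarrow> mu (Suc k)"
  proof -
    have exp: "?Y n p ^ Suc k = (\<Sum>j\<le>Suc k. of_nat (Suc k choose j) * (- 1 / 2) ^ j * (Aw n p ^ (2 * j) * Cw n p ^ (Suc k - j)))"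
      for n p
    proof -
      have "?Y n p = (- 1 / 2) * (Aw n p)\<^sup>2 + Cw n p" by simp
      then show ?thesis
        by (simp only: binomial_ring power_mult_distrib power_mult [symmetric] mult.assoc)
    qed
    have "(\<lambda>n. \<Sum>j\<le>Suc k. of_nat (Suc k choose j) * (- 1 / 2) ^ j * mean n (\<lambda>p. Aw n p ^ (2 * j) * Cw n p ^ (Suc k - j)))
        \<longlonglongrightarrow> (\<Sum>j\<le>Suc k. of_nat (Suc k choose j) * (- 1 / 2) ^ j * mom (2 * j) (Suc k - j))"
      by (intro tendsto_sum tendsto_mult tendsto_const mean_AC)
    moreover have "(\<Sum>j\<le>Suc k. of_nat (Suc k choose j) * (- 1 / 2) ^ j * mom (2 * j) (Suc k - j)) = mu (Suc k)"
      unfolding mu_def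
    proof (rule sum.cong [OF refl])
      fix j assume "j \<in> {..Suc k}"
      then have e: "1 + (3 / 2 * real (2 * j) + 2 * real (Suc k - j)) = 1 + real (2 * Suc k + j)"
        by (simp add: of_nat_diff)
      have "Gamma (1 + real (2 * Suc k + j)) = fact (2 * Suc k + j)" by (rule Gamma_fact)
      then show "of_nat (Suc k choose j) * (- 1 / 2) ^ j * mom (2 * j) (Suc k - j) =
          of_nat (Suc k choose j) * (- 1 / 2) ^ j *
          (fact (2 * j) * fact (Suc k - j) * gc (2 * j) (Suc k - j) / fact (2 * Suc k + j))"
        unfolding mom_def e by (simp only:)
    qed
    ultimately show ?thesis unfolding exp mean_sum mean_cmult by (simp only:)
  qed
  have E: "?E \<longlonglongrightarrow> 2 ^ k * mom 1 k + 2 ^ k * mom (2 * k + 1) 0 + 10 ^ k * mom (k + 1) 0"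
    by (intro tendsto_add tendsto_mult tendsto_const mean_AC)
  have "(\<lambda>n. ?K / sqrt (real n)) \<longlonglongrightarrow> 0"
    by (intro tendsto_divide_0 [OF tendsto_const] filterlim_at_top_imp_at_infinity
        filterlim_compose [OF sqrt_at_top filterlim_real_sequentially])
  from tendsto_mult [OF this E] have lim: "(\<lambda>n. ?K / sqrt (real n) * ?E n) \<longlonglongrightarrow> 0" by simp
  have "(\<lambda>n. mean n (\<lambda>p. Xw n p ^ Suc k) - mean n (\<lambda>p. ?Y n p ^ Suc k)) \<longlonglongrightarrow> 0"
  proof (rule Lim_null_comparison [OF _ lim])
    show "eventually (\<lambda>n. norm (mean n (\<lambda>p. Xw n p ^ Suc k) - mean n (\<lambda>p. ?Y n p ^ Suc k)) \<le> ?K / sqrt (real n) * ?E n) sequentially"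
      using eventually_ge_at_top [of 1]
    proof eventually_elim
      case (elim n)
      define r where "r = sqrt (real n)"
      have r: "1 \<le> r" using elim by (simp add: r_def)
      define B where "B p = ?K / r * (2 ^ k * (Aw n p ^ 1 * Cw n p ^ k) + 2 ^ k * (Aw n p ^ (2 * k + 1) * Cw n p ^ 0)
          + 10 ^ k * (Aw n p ^ (k + 1) * Cw n p ^ 0))" for p
      have bound: "\<bar>Xw n p ^ Suc k - ?Y n p ^ Suc k\<bar> \<le> B p" if p: "p \<in> distinct_cores n" for p
      proof -
        let ?a = "Aw n p" and ?c = "Cw n p" and ?x = "Xw n p"
        have ac: "0 \<le> ?a" "0 \<le> ?c" by (rule AC_nonneg)+
        have d: "\<bar>?x - ?Y n p\<bar> \<le> 10 * ?a / r" using X_close [OF elim p] by (simp add: r_def)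
        have "10 * ?a / r \<le> 10 * ?a" using ac r by (simp add: divide_le_eq mult_le_cancel_left1)
        with d ac have "\<bar>?x\<bar> + \<bar>?Y n p\<bar> \<le> 2 * ?c + 2 * ?a\<^sup>2 + 10 * ?a"
          using zero_le_power2 [of ?a] by linarith
        then have "(\<bar>?x\<bar> + \<bar>?Y n p\<bar>) ^ k \<le> (2 * ?c + 2 * ?a\<^sup>2 + 10 * ?a) ^ k"
          by (intro power_mono) auto
        also have "\<dots> \<le> 3 ^ k * ((2 * ?c) ^ k + (2 * ?a\<^sup>2) ^ k + (10 * ?a) ^ k)"
          using ac by (intro power_three_bound) auto
        finally have s: "(\<bar>?x\<bar> + \<bar>?Y n p\<bar>) ^ k \<le> 3 ^ k * ((2 * ?c) ^ k + (2 * ?a\<^sup>2) ^ k + (10 * ?a) ^ k)" .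
        have "\<bar>?x ^ Suc k - ?Y n p ^ Suc k\<bar> \<le> real (Suc k) * \<bar>?x - ?Y n p\<bar> * (\<bar>?x\<bar> + \<bar>?Y n p\<bar>) ^ k"
          by (rule power_diff_bound)
        also have "\<dots> \<le> real (Suc k) * (10 * ?a / r) * (3 ^ k * ((2 * ?c) ^ k + (2 * ?a\<^sup>2) ^ k + (10 * ?a) ^ k))"
          using d s ac r by (intro mult_mono mult_left_mono) auto
        also have "\<dots> = B p"
        proof -
          have "?a ^ (2 * k) = (?a\<^sup>2) ^ k" by (rule power_mult)
          then have e: "?a ^ (2 * k + 1) = ?a * (?a\<^sup>2) ^ k" "?a ^ (k + 1) = ?a * ?a ^ k" by simp_all
          show ?thesis unfolding B_def e power_mult_distrib by (simp add: algebra_simps)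
        qed
        finally show ?thesis .
      qed
      have "\<bar>mean n (\<lambda>p. Xw n p ^ Suc k) - mean n (\<lambda>p. ?Y n p ^ Suc k)\<bar> \<le> mean n B"
      proof (rule abs_leI)
        show "mean n (\<lambda>p. Xw n p ^ Suc k) - mean n (\<lambda>p. ?Y n p ^ Suc k) \<le> mean n B"
          unfolding mean_diff [symmetric] using bound by (intro mean_mono) (blast dest: abs_le_D1)
        have "mean n (\<lambda>p. ?Y n p ^ Suc k) - mean n (\<lambda>p. Xw n p ^ Suc k) \<le> mean n B"
          unfolding mean_diff [symmetric] using bound by (intro mean_mono) (fastforce dest: abs_le_D2)
        then show "- (mean n (\<lambda>p. Xw n p ^ Suc k) - mean n (\<lambda>p. ?Y n p ^ Suc k)) \<le> mean n B" by simp
      qed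
      also have "mean n B = ?K / r * ?E n"
        unfolding B_def mean_cmult mean_add ..
      finally show ?case by (simp add: r_def)
    qed
  qed
  from tendsto_add [OF this Y] show ?thesis by simp
qed

lemma fifth_central_moment:
  assumes n: "1 \<le> n"
  shows "mean n (\<lambda>p. (f p - m) ^ 5) =
    mean n (\<lambda>p. f p ^ 5) - 5 * m * mean n (\<lambda>p. f p ^ 4) + 10 * m ^ 2 * mean n (\<lambda>p. f p ^ 3)
    - 10 * m ^ 3 * mean n (\<lambda>p. f p ^ 2) + 5 * m ^ 4 * mean n f - m ^ 5"
proof -
  have "(f p - m) ^ 5 = f p ^ 5 - (5 * m) * f p ^ 4 + (10 * m ^ 2) * f p ^ 3 - (10 * m ^ 3) * f p ^ 2
      + (5 * m ^ 4) * f p - m ^ 5" for p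
    by (simp add: eval_nat_numeral algebra_simps)
  then show ?thesis
    by (simp only: mean_add mean_diff mean_cmult mean_const [OF n])
qed

lemma second_central_moment:
  assumes n: "1 \<le> n"
  shows "mean n (\<lambda>p. (f p - m)\<^sup>2) = mean n (\<lambda>p. (f p)\<^sup>2) - 2 * m * mean n f + m\<^sup>2"
proof -
  have "(f p - m)\<^sup>2 = (f p)\<^sup>2 - (2 * m) * f p + m\<^sup>2" for p
    by (simp add: power2_eq_square algebra_simps)
  then show ?thesis
    by (simp only: mean_add mean_diff mean_cmult mean_const [OF n])
qed

definition kappa2 :: real where "kappa2 = 467 / 7680"
definition kappa5 :: real where "kappa5 = 685932873011 / 18137512673280"

theorem mainTheorem12:
  shows "(\<lambda>n::nat.
      measure_pmf.expectation (core_pmf n)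
        (\<lambda>p. (partition_size p - measure_pmf.expectation (core_pmf n) partition_size) ^ 5)
      / measure_pmf.variance (core_pmf n) partition_size powr (5 / 2))
    \<longlonglongrightarrow> 3429664365055 / 156594294624768 * sqrt 467 * sqrt 7680"
proof (rule Lim_transform_eventually)
  define e where "e k n = mean n (\<lambda>p. Xw n p ^ k)" for k n
  define m5 where "m5 n = e 5 n - 5 * e 1 n * e 4 n + 10 * e 1 n ^ 2 * e 3 n - 10 * e 1 n ^ 3 * e 2 n
      + 5 * e 1 n ^ 4 * e 1 n - e 1 n ^ 5" for n
  define m2 where "m2 n = e 2 n - 2 * e 1 n * e 1 n + (e 1 n)\<^sup>2" for n
  have lims: "e 1 \<longlonglongrightarrow> 5 / 16" "e 2 \<longlonglongrightarrow> 1217 / 7680" "e 3 \<longlonglongrightarrow> 1601353 / 13762560"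
    "e 4 \<longlonglongrightarrow> 3264219 / 28835840" "e 5 \<longlonglongrightarrow> 226724203201 / 1648864788480"
  proof -
    have "e k \<longlonglongrightarrow> mu k" if "0 < k" for k
      using mean_X [of "k - 1"] that by (simp add: e_def [abs_def])
    from this [of 1] this [of 2] this [of 3] this [of 4] this [of 5]
    show "e 1 \<longlonglongrightarrow> 5 / 16" "e 2 \<longlonglongrightarrow> 1217 / 7680" "e 3 \<longlonglongrightarrow> 1601353 / 13762560"
      "e 4 \<longlonglongrightarrow> 3264219 / 28835840" "e 5 \<longlonglongrightarrow> 226724203201 / 1648864788480"
      unfolding mu_values by simp_all
  qed
  have "m5 \<longlonglongrightarrow> 226724203201 / 1648864788480 - 5 * (5 / 16) * (3264219 / 28835840) + 10 * (5 / 16) ^ 2 * (1601353 / 13762560)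
      - 10 * (5 / 16) ^ 3 * (1217 / 7680) + 5 * (5 / 16) ^ 4 * (5 / 16) - (5 / 16) ^ 5"
    unfolding m5_def [abs_def] by (intro tendsto_intros lims)
  then have m5: "m5 \<longlonglongrightarrow> kappa5" by (simp add: kappa5_def power_divide)
  have "m2 \<longlonglongrightarrow> 1217 / 7680 - 2 * (5 / 16) * (5 / 16) + (5 / 16)\<^sup>2"
    unfolding m2_def [abs_def] by (intro tendsto_intros lims)
  then have m2: "m2 \<longlonglongrightarrow> kappa2" by (simp add: kappa2_def power2_eq_square)
  have k2: "0 < kappa2" by (simp add: kappa2_def)
  have "(\<lambda>n. m5 n / m2 n powr (5 / 2)) \<longlonglongrightarrow> kappa5 / kappa2 powr (5 / 2)"
    using k2 by (intro tendsto_divide tendsto_powr m5 m2 tendsto_const) auto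
  moreover have "kappa5 / kappa2 powr (5 / 2) = 3429664365055 / 156594294624768 * sqrt 467 * sqrt 7680"
  proof -
    have "(5 / 2 :: real) = 2 + 1 / 2" by simp
    then have "kappa2 powr (5 / 2) = kappa2 powr 2 * kappa2 powr (1 / 2)" by (simp only: powr_add)
    also have "\<dots> = kappa2\<^sup>2 * (sqrt 467 / sqrt 7680)"
      using k2 by (simp add: powr_half_sqrt) (simp add: kappa2_def real_sqrt_divide)
    finally have "kappa5 / kappa2 powr (5 / 2) = kappa5 / kappa2\<^sup>2 * (sqrt 7680 / sqrt 467)" by simp
    also have "sqrt 7680 / sqrt 467 = sqrt 467 * sqrt 7680 / 467"
    proof -
      have "sqrt 467 * sqrt 467 = (467 :: real)" by simp
      then show ?thesis by (simp add: field_simps)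
    qed
    also have "kappa5 / kappa2\<^sup>2 * (sqrt 467 * sqrt 7680 / 467) = kappa5 / kappa2\<^sup>2 / 467 * sqrt 467 * sqrt 7680"
      by simp
    also have "kappa5 / kappa2\<^sup>2 / 467 = 3429664365055 / 156594294624768"
      by (simp add: kappa5_def kappa2_def power2_eq_square)
    finally show ?thesis .
  qed
  ultimately show "(\<lambda>n. m5 n / m2 n powr (5 / 2)) \<longlonglongrightarrow> 3429664365055 / 156594294624768 * sqrt 467 * sqrt 7680"
    by (simp only:)
  show "eventually (\<lambda>n. m5 n / m2 n powr (5 / 2) =
      measure_pmf.expectation (core_pmf n)
        (\<lambda>p. (partition_size p - measure_pmf.expectation (core_pmf n) partition_size) ^ 5)
      / measure_pmf.variance (core_pmf n) partition_size powr (5 / 2)) sequentially"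
    using eventually_ge_at_top [of 1]
  proof eventually_elim
    case (elim n)
    let ?N = "real n ^ 3"
    let ?m = "mean n partition_size"
    have N: "0 < ?N" using elim by simp
    have size: "partition_size p = ?N * Xw n p" for p using N by (simp add: Xw_def)
    have "?m = mean n (\<lambda>p. ?N * Xw n p)"
      by (rule arg_cong [where f = "mean n"]) (rule ext, rule size)
    also have "\<dots> = ?N * mean n (Xw n)" by (rule mean_cmult)
    finally have m: "?m = ?N * e 1 n" by (simp add: e_def)
    have diff: "partition_size p - ?m = ?N * (Xw n p - e 1 n)" for p
      unfolding m size by (simp add: right_diff_distrib)
    have "mean n (\<lambda>p. (partition_size p - ?m) ^ 5) = ?N ^ 5 * m5 n"
      unfolding diff power_mult_distrib mean_cmult fifth_central_moment [OF elim]
      by (simp add: m5_def e_def)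
    moreover have "mean n (\<lambda>p. (partition_size p - ?m)\<^sup>2) = ?N\<^sup>2 * m2 n"
      unfolding diff power_mult_distrib mean_cmult second_central_moment [OF elim]
      by (simp add: m2_def e_def)
    moreover have "(?N\<^sup>2 * m2 n) powr (5 / 2) = ?N ^ 5 * m2 n powr (5 / 2)"
    proof -
      have "0 \<le> m2 n"
      proof -
        have "m2 n = mean n (\<lambda>p. (Xw n p - e 1 n)\<^sup>2)"
          unfolding second_central_moment [OF elim] by (simp add: m2_def e_def)
        also have "0 \<le> \<dots>" unfolding mean_def by (intro divide_nonneg_nonneg sum_nonneg) auto
        finally show ?thesis .
      qed
      moreover have "(?N\<^sup>2) powr (5 / 2) = ?N ^ 5"
      proof -
        have "(?N\<^sup>2) powr (5 / 2) = (?N powr 2) powr (5 / 2)"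
          using N by (simp only: powr_numeral)
        also have "\<dots> = ?N powr 5" by (simp only: powr_powr) simp
        also have "\<dots> = ?N ^ 5" using N by (simp only: powr_numeral)
        finally show ?thesis .
      qed
      ultimately show ?thesis by (simp add: powr_mult)
    qed
    ultimately show ?case
      unfolding expectation_core_pmf [OF elim] using N by simp
  qed
qed

end
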